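(* Let $G$ be a linear Lie group (i.e., a Lie group admitting a faithful continuous finite-dimensional linear representation). Suppose that there is an integer $n\ge 1$ such that every irreducible continuous finite-dimensional (not necessarily unitary) complex linear representation of $G$ has dimension at most $n$, and suppose that the family of all irreducible continuous finite-dimensional complex linear representations of $G$ separates the points of $G$ (i.e., for every $g\neq e$ in $G$ there is such a representation $\pi$ with $\pi(g)\neq \mathrm{id}$). Then $G$ is a finite extension of a commutative Lie group, i.e., $G$ contains a closed commutative normal subgroup $A$ such that the quotient $G/A$ is finite.
   Context: Representations are continuous homomorphisms $\pi\colon G\to GL(V)$ with $V$ a finite-dimensional complex vector space; they are not required to be unitary. A representation is irreducible if $V\neq 0$ has no proper nonzero $\pi(G)$-invariant subspace. *)

theory Defs
  imports "HOL-Analysis.Analysis" "HOL-Algebra.Coset" "Jordan_Normal_Form.Matrix"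
begin

text \<open>A Lie group: a Hausdorff topological group (carrier = underlying space of the
  topology X, continuous multiplication and inversion) which is locally Euclidean of
  some fixed dimension d.  By Gleason--Montgomery--Zippin this is equivalent to the
  existence of a (unique compatible) real-analytic Lie group structure.\<close>
definition lie_group :: "('a, 'b) monoid_scheme \<Rightarrow> 'a topology \<Rightarrow> bool" where
  "lie_group G X \<longleftrightarrow>
     group G \<and> topspace X = carrier G \<and> Hausdorff_space X \<and>
     continuous_map (prod_topology X X) X (\<lambda>(x, y). x \<otimes>\<^bsub>G\<^esub> y) \<and>
     continuous_map X X (\<lambda>x. inv\<^bsub>G\<^esub> x) \<and>
     (\<exists>d. \<forall>x\<in>topspace X. \<exists>U V. openin X U \<and> x \<in> U \<and>
         openin (Euclidean_space d) V \<and>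
         subtopology X U homeomorphic_space subtopology (Euclidean_space d) V)"

definition cont_rep :: "('a, 'b) monoid_scheme \<Rightarrow> 'a topology \<Rightarrow> nat \<Rightarrow> ('a \<Rightarrow> complex mat) \<Rightarrow> bool" where
  "cont_rep G X m \<pi> \<longleftrightarrow>
     (\<forall>g\<in>carrier G. \<pi> g \<in> carrier_mat m m) \<and>
     (\<forall>g\<in>carrier G. \<forall>h\<in>carrier G. \<pi> (g \<otimes>\<^bsub>G\<^esub> h) = \<pi> g * \<pi> h) \<and>
     \<pi> \<one>\<^bsub>G\<^esub> = 1\<^sub>m m \<and>
     (\<forall>i<m. \<forall>j<m. continuous_map X euclidean (\<lambda>g. \<pi> g $$ (i, j)))"

definition invariant_subspace :: "('a, 'b) monoid_scheme \<Rightarrow> nat \<Rightarrow> ('a \<Rightarrow> complex mat) \<Rightarrow> complex vec set \<Rightarrow> bool" where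
  "invariant_subspace G m \<pi> W \<longleftrightarrow>
     W \<subseteq> carrier_vec m \<and> 0\<^sub>v m \<in> W \<and>
     (\<forall>v\<in>W. \<forall>w\<in>W. v + w \<in> W) \<and> (\<forall>c. \<forall>v\<in>W. c \<cdot>\<^sub>v v \<in> W) \<and>
     (\<forall>g\<in>carrier G. \<forall>v\<in>W. \<pi> g *\<^sub>v v \<in> W)"

definition irreducible_rep :: "('a, 'b) monoid_scheme \<Rightarrow> 'a topology \<Rightarrow> nat \<Rightarrow> ('a \<Rightarrow> complex mat) \<Rightarrow> bool" where
  "irreducible_rep G X m \<pi> \<longleftrightarrow>
     cont_rep G X m \<pi> \<and> m > 0 \<and>
     (\<forall>W. invariant_subspace G m \<pi> W \<longrightarrow> W = {0\<^sub>v m} \<or> W = carrier_vec m)"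

definition linear_lie_group :: "('a, 'b) monoid_scheme \<Rightarrow> 'a topology \<Rightarrow> bool" where
  "linear_lie_group G X \<longleftrightarrow> lie_group G X \<and>
     (\<exists>m \<pi>. cont_rep G X m \<pi> \<and> inj_on \<pi> (carrier G))"

end

theory Submission
  imports Defs "Jordan_Normal_Form.Schur_Decomposition"
begin

unbundle no vec_syntax

text \<open>
  The only input from Lie theory is a faithful continuous representation on a Hausdorff group; everything else is
  algebra.

  Let \<open>u\<close> act unipotently in an irreducible representation \<open>V\<close>. The character of \<open>V\<^sup>\<otimes>\<^sup>n\<close> at \<open>u\<^sup>k h\<close>
  is the \<open>n\<close>-th power of a polynomial \<open>p\<close> in \<open>k\<close>, but it is also the sum of the characters of composition factors
  of dimension at most \<open>n\<close>, each of which is a polynomial of degree less than \<open>n\<close>. Hence \<open>p\<close> is constant, and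
  irreducibility forces \<open>u\<close> to act trivially. So, by the separation hypothesis, every \<open>y \<noteq> 1\<close> is detected by some
  function \<open>g \<mapsto> tr (\<pi>(g)\<^sup>k)\<close> with \<open>\<pi>\<close> irreducible. This function is the trace of \<open>g\<close> on a tensor power
  multiplied by a commuting matrix, a class of functions closed under products.

  For \<open>d > n\<^sup>2\<close> the alternating sum of the products \<open>x\<^bsub>s(1)\<^esub> \<dots> x\<^bsub>s(d)\<^esub>\<close> vanishes in
  all irreducible representations, so it is nilpotent in all representations and is annihilated by all functions of that
  class. Since they separate points, any \<open>d\<close> elements of \<open>G\<close> have two distinct orderings with the same product.
  By B. H. Neumann's coset covering argument the FC-centre \<open>D\<close> (the elements whose centralizer has finite index)
  then has finite index.

  In a linear group centralizers satisfy the descending chain condition, so the centralizer \<open>K\<close> of \<open>D\<close> is a finite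
  intersection of subgroups of finite index. The centre of \<open>K\<close> is closed, normal, commutative and contains
  \<open>D \<inter> K\<close>.
\<close>

subsection \<open>Subgroups of finite index and the FC-centre\<close>

text \<open>A trace sees only the composition factors, so it can be controlled on tensor products
  whatever extensions occur there. The price is that a trace cannot tell a unipotent element from 1,
  and removing this blindness is the purpose of the argument with tensor powers. The exponent n is
  chosen so that a nonconstant p would give p^n degree at least n, which factors of dimension at
  most n cannot reach. Powers of \<pi>(g) are traced because, without unitarity, the eigenvalues of
  \<pi>(g) can add up to the dimension without all being 1.

  Closure under products serves to isolate the given ordering among all d! of them: for each other
  ordering there is one factor that vanishes at it and not at the given one, and the product of all
  these factors must still be annihilated by the alternating sum.

  The bound n^2 is the number of index pairs of an n by n matrix and enters through the pigeonhole
  principle. The chain condition on centralizers enters because D may be infinite, and an infinite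
  intersection of subgroups of finite index can have infinite index.\<close>

definition centralizer :: "('a, 'b) monoid_scheme \<Rightarrow> 'a set \<Rightarrow> 'a set" where
  "centralizer G S = {x \<in> carrier G. \<forall>a\<in>S. x \<otimes>\<^bsub>G\<^esub> a = a \<otimes>\<^bsub>G\<^esub> x}"

definition fc_centre :: "('a, 'b) monoid_scheme \<Rightarrow> 'a set" where
  "fc_centre G = {a \<in> carrier G. finite (rcosets\<^bsub>G\<^esub> (centralizer G {a}))}"

context group
begin

lemma inv_cancel_left:
  assumes "x \<in> carrier G" "y \<in> carrier G"
  shows "inv x \<otimes> (x \<otimes> y) = y" "x \<otimes> (inv x \<otimes> y) = y"
  using assms by (simp_all flip: m_assoc)

lemma inv_commute:
  assumes "x \<in> carrier G" "a \<in> carrier G" "x \<otimes> a = a \<otimes> x"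
  shows "inv x \<otimes> a = a \<otimes> inv x"
proof -
  have "inv x \<otimes> a = inv x \<otimes> (a \<otimes> x) \<otimes> inv x"
    using assms(1,2) by (simp add: m_assoc)
  also have "\<dots> = inv x \<otimes> (x \<otimes> a) \<otimes> inv x" using assms(3) by simp
  also have "\<dots> = a \<otimes> inv x" using assms(1,2) by (simp flip: m_assoc)
  finally show ?thesis .
qed

text \<open>The map \<open>C \<mapsto> K <#> C\<close> sends the coset of x under \<open>H\<close>
  to the coset of x under \<open>K\<close>, so it is onto the cosets of \<open>K\<close>.\<close>

lemma finite_index_mono:
  assumes H: "subgroup H G" and K: "subgroup K G" and sub: "H \<subseteq> K" and fin: "finite (rcosets H)"
  shows "finite (rcosets K)"
proof -
  have "K #> x = K <#> (H #> x)" if x: "x \<in> carrier G" for x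
  proof -
    have Kc: "K \<subseteq> carrier G" and Hc: "H \<subseteq> carrier G"
      using H K subgroup.subset by auto
    have "K <#> (H #> x) = (K <#> H) #> x"
      using Kc Hc x by (simp add: setmult_rcos_assoc)
    also have "K <#> H = K"
    proof
      show "K <#> H \<subseteq> K"
        using sub subgroup.m_closed[OF K] unfolding set_mult_def by blast
      show "K \<subseteq> K <#> H"
      proof
        fix k assume "k \<in> K"
        then show "k \<in> K <#> H"
          using subgroup.one_closed[OF H] Kc unfolding set_mult_def using r_one by fastforce
      qed
    qed
    finally show ?thesis by simp
  qed
  then have "rcosets K \<subseteq> (\<lambda>C. K <#> C) ` (rcosets H)"
    unfolding RCOSETS_def by blast
  then show ?thesis
    using fin finite_surj by blast
qed

lemma finite_index_Int:
  assumes H: "subgroup H G" and K: "subgroup K G"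
    and "finite (rcosets H)" "finite (rcosets K)"
  shows "finite (rcosets (H \<inter> K))"
proof -
  have eq: "(H \<inter> K) #> x = (H #> x) \<inter> (K #> x)" if x: "x \<in> carrier G" for x
    using subgroup.mem_carrier[OF H] subgroup.mem_carrier[OF K] x
    unfolding r_coset_def by auto
  then have "rcosets (H \<inter> K) \<subseteq> (\<lambda>(C, D). C \<inter> D) ` ((rcosets H) \<times> (rcosets K))"
  proof (intro subsetI)
    fix C assume "C \<in> rcosets (H \<inter> K)"
    then obtain x where "x \<in> carrier G" "C = (H \<inter> K) #> x" unfolding RCOSETS_def by blast
    then have "C = (case (H #> x, K #> x) of (C, D) \<Rightarrow> C \<inter> D)" using eq by simp
    moreover have "(H #> x, K #> x) \<in> (rcosets H) \<times> (rcosets K)"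
      using \<open>x \<in> carrier G\<close> H K by (simp add: rcosetsI subgroup.subset)
    ultimately show "C \<in> (\<lambda>(C, D). C \<inter> D) ` ((rcosets H) \<times> (rcosets K))"
      by (rule image_eqI)
  qed
  then show ?thesis
    by (rule finite_surj[OF finite_cartesian_product[OF assms(3,4)]])
qed

lemma subgroup_centralizer:
  assumes "S \<subseteq> carrier G"
  shows "subgroup (centralizer G S) G"
proof (rule subgroupI)
  show "centralizer G S \<subseteq> carrier G" "centralizer G S \<noteq> {}"
    using assms unfolding centralizer_def by (auto intro!: exI[of _ \<one>])
next
  fix x assume x: "x \<in> centralizer G S"
  have xc: "x \<in> carrier G" using x unfolding centralizer_def by auto
  have "inv x \<otimes> a = a \<otimes> inv x" if "a \<in> S" for a
  proof -
    have "x \<otimes> a = a \<otimes> x" "a \<in> carrier G"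
      using x that assms unfolding centralizer_def by auto
    then show ?thesis
      using xc inv_commute by blast
  qed
  then show "inv x \<in> centralizer G S"
    using xc unfolding centralizer_def by auto
next
  fix x y assume x: "x \<in> centralizer G S" and y: "y \<in> centralizer G S"
  have "(x \<otimes> y) \<otimes> a = a \<otimes> (x \<otimes> y)" if "a \<in> S" for a
  proof -
    have "x \<otimes> a = a \<otimes> x" "y \<otimes> a = a \<otimes> y" "a \<in> carrier G" "x \<in> carrier G" "y \<in> carrier G"
      using x y that assms unfolding centralizer_def by auto
    then show ?thesis by (metis m_assoc)
  qed
  then show "x \<otimes> y \<in> centralizer G S"
    using x y unfolding centralizer_def by auto
qed

lemma finite_index_centralizer_mult:
  assumes "a \<in> fc_centre G" "b \<in> fc_centre G"
  shows "a \<otimes> b \<in> fc_centre G"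
proof -
  have ab: "a \<in> carrier G" "b \<in> carrier G"
    using assms unfolding fc_centre_def by auto
  have "centralizer G {a} \<inter> centralizer G {b} \<subseteq> centralizer G {a \<otimes> b}"
    using ab unfolding centralizer_def by auto (metis m_assoc)
  moreover have "finite (rcosets (centralizer G {a} \<inter> centralizer G {b}))"
    using assms ab by (intro finite_index_Int subgroup_centralizer) (auto simp: fc_centre_def)
  ultimately have "finite (rcosets (centralizer G {a \<otimes> b}))"
    using finite_index_mono[OF subgroups_Inter_pair[OF subgroup_centralizer subgroup_centralizer] subgroup_centralizer,
        of "{a}" "{b}" "{a \<otimes> b}"] ab by simp
  then show ?thesis using ab unfolding fc_centre_def by auto
qed

lemma subgroup_fc_centre: "subgroup (fc_centre G) G"
proof (rule subgroupI)
  show "fc_centre G \<subseteq> carrier G" unfolding fc_centre_def by auto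
  have "centralizer G {\<one>} = carrier G" unfolding centralizer_def by auto
  moreover have "rcosets (carrier G) \<subseteq> {carrier G}"
    unfolding RCOSETS_def by (auto simp: coset_join2 subgroup_self)
  ultimately have "\<one> \<in> fc_centre G"
    unfolding fc_centre_def using finite_subset by auto
  then show "fc_centre G \<noteq> {}" by blast
next
  fix a assume a: "a \<in> fc_centre G"
  then have ac: "a \<in> carrier G" unfolding fc_centre_def by auto
  have "centralizer G {a} \<subseteq> centralizer G {inv a}"
  proof
    fix x assume "x \<in> centralizer G {a}"
    then have "x \<in> carrier G" "x \<otimes> a = a \<otimes> x" unfolding centralizer_def by auto
    then have "x \<otimes> inv a = inv a \<otimes> x"
      using ac inv_commute[of a x] by simp
    then show "x \<in> centralizer G {inv a}" using \<open>x \<in> carrier G\<close> unfolding centralizer_def by auto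
  qed
  then have "finite (rcosets (centralizer G {inv a}))"
    using a ac finite_index_mono[OF subgroup_centralizer subgroup_centralizer, of "{a}" "{inv a}"]
    unfolding fc_centre_def by simp
  then show "inv a \<in> fc_centre G" using ac unfolding fc_centre_def by auto
next
  fix a b assume "a \<in> fc_centre G" "b \<in> fc_centre G"
  then show "a \<otimes> b \<in> fc_centre G" by (rule finite_index_centralizer_mult)
qed

text \<open>Conjugation by x carries the centralizer of a onto that of its conjugate, hence
  preserves the index. Normality is used when a condition that places x inside a longer product has
  to be turned into a single coset condition on x, and again for the normality of the final
  subgroup.\<close>

lemma normal_fc_centre: "fc_centre G \<lhd> G"
  unfolding normal_inv_iff
proof (intro conjI ballI)
  show "subgroup (fc_centre G) G" by (rule subgroup_fc_centre)
next
  fix x a assume x: "x \<in> carrier G" and a: "a \<in> fc_centre G"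
  then have ac: "a \<in> carrier G" unfolding fc_centre_def by auto
  define b where "b = x \<otimes> a \<otimes> inv x"
  have bc: "b \<in> carrier G" using x ac unfolding b_def by simp
  have conj: "x \<otimes> c \<otimes> inv x \<in> centralizer G {b}" if "c \<in> centralizer G {a}" for c
  proof -
    have c: "c \<in> carrier G" "c \<otimes> a = a \<otimes> c" using that unfolding centralizer_def by auto
    have "(x \<otimes> c \<otimes> inv x) \<otimes> b = x \<otimes> (c \<otimes> a) \<otimes> inv x"
      using x ac c(1) unfolding b_def by (simp add: m_assoc inv_cancel_left)
    also have "\<dots> = b \<otimes> (x \<otimes> c \<otimes> inv x)"
      using x ac c unfolding b_def by (simp add: m_assoc inv_cancel_left)
    finally show ?thesis using x c unfolding centralizer_def by auto
  qed
  have conj': "inv x \<otimes> c \<otimes> x \<in> centralizer G {a}" if "c \<in> centralizer G {b}" for c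
  proof -
    have c: "c \<in> carrier G" "c \<otimes> b = b \<otimes> c" using that unfolding centralizer_def by auto
    have "(inv x \<otimes> c \<otimes> x) \<otimes> a = inv x \<otimes> (c \<otimes> b) \<otimes> x"
      using x ac c(1) unfolding b_def by (simp add: m_assoc inv_cancel_left)
    also have "\<dots> = a \<otimes> (inv x \<otimes> c \<otimes> x)"
      using x ac c(1) unfolding c(2) unfolding b_def by (simp add: m_assoc inv_cancel_left)
    finally show ?thesis using x c unfolding centralizer_def by auto
  qed
  \<comment> \<open>As the centralizer of b is x C(a) x^-1, its coset through y is a left translate
    by x of a coset of C(a).\<close>
  have "centralizer G {b} #> y = x <# (centralizer G {a} #> (inv x \<otimes> y))" if y: "y \<in> carrier G" for y
  proof
    show "centralizer G {b} #> y \<subseteq> x <# (centralizer G {a} #> (inv x \<otimes> y))"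
    proof
      fix z assume "z \<in> centralizer G {b} #> y"
      then obtain c where c: "c \<in> centralizer G {b}" "z = c \<otimes> y" unfolding r_coset_def by auto
      then have cc: "c \<in> carrier G" unfolding centralizer_def by auto
      have "z = x \<otimes> ((inv x \<otimes> c \<otimes> x) \<otimes> (inv x \<otimes> y))"
        using cc x y c(2) by (simp add: m_assoc inv_cancel_left)
      then show "z \<in> x <# (centralizer G {a} #> (inv x \<otimes> y))"
        using conj'[OF c(1)] unfolding l_coset_def r_coset_def by blast
    qed
    show "x <# (centralizer G {a} #> (inv x \<otimes> y)) \<subseteq> centralizer G {b} #> y"
    proof
      fix z assume "z \<in> x <# (centralizer G {a} #> (inv x \<otimes> y))"
      then obtain c where c: "c \<in> centralizer G {a}" "z = x \<otimes> (c \<otimes> (inv x \<otimes> y))"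
        unfolding l_coset_def r_coset_def by auto
      then have cc: "c \<in> carrier G" unfolding centralizer_def by auto
      have "z = (x \<otimes> c \<otimes> inv x) \<otimes> y"
        using cc x y c(2) by (simp add: m_assoc)
      then show "z \<in> centralizer G {b} #> y"
        using conj[OF c(1)] unfolding r_coset_def by blast
    qed
  qed
  moreover have "centralizer G {a} #> (inv x \<otimes> y) \<in> rcosets (centralizer G {a})"
    if "y \<in> carrier G" for y
    using x that by (intro rcosetsI) (auto simp: centralizer_def)
  ultimately have "rcosets (centralizer G {b}) \<subseteq> (\<lambda>C. x <# C) ` (rcosets (centralizer G {a}))"
    unfolding RCOSETS_def[of G "centralizer G {b}"] by auto
  then have "finite (rcosets (centralizer G {b}))"
    using a finite_surj unfolding fc_centre_def by blast
  then show "x \<otimes> a \<otimes> inv x \<in> fc_centre G"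
    using bc unfolding fc_centre_def b_def by auto
qed

text \<open>If some coset \<open>H y\<close> is missing from the cover, it is covered by cosets of the other subgroups;
  translating that cover eliminates every coset of \<open>H\<close>.\<close>
lemma Union_cosets_infinite_index_aux:
  assumes "finite \<H>" "\<And>H. H \<in> \<H> \<Longrightarrow> subgroup H G \<and> infinite (rcosets H)"
    "finite \<C>" "\<C> \<subseteq> (\<Union>H\<in>\<H>. rcosets H)"
  shows "\<Union>\<C> \<noteq> carrier G"
  using assms
proof (induction \<H> arbitrary: \<C> rule: finite_induct)
  case empty
  then show ?case using one_closed by auto
next
  case (insert H \<H>)
  show ?case
  proof
    assume cover: "\<Union>\<C> = carrier G"
    have H: "subgroup H G" "infinite (rcosets H)" using insert.prems(1) by auto
    then have "\<not> rcosets H \<subseteq> \<C>" using insert.prems(2) finite_subset by blast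
    then obtain y where y: "y \<in> carrier G" "H #> y \<notin> \<C>"
      unfolding RCOSETS_def by auto
    define \<C>' where "\<C>' = \<C> \<inter> (\<Union>K\<in>\<H>. rcosets K)"
    define r where "r D = (SOME g. g \<in> carrier G \<and> D = H #> g)" for D
    have r: "r D \<in> carrier G \<and> D = H #> r D" if "D \<in> rcosets H" for D
      proof -
      have "\<exists>g. g \<in> carrier G \<and> D = H #> g" using that unfolding RCOSETS_def by auto
      then show ?thesis unfolding r_def by (rule someI_ex)
    qed
    \<comment> \<open>Right multiplication by \<open>inv y \<otimes> r D\<close> takes
      \<open>H #> y\<close> to \<open>D\<close>, so it takes the cover of \<open>H #> y\<close> by
      \<open>\<C>'\<close> to a cover of \<open>D\<close> that again uses only cosets of members of
      \<open>\<H>\<close>.\<close>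
    define \<D> where "\<D> = \<C>' \<union> (\<Union>D \<in> \<C> \<inter> rcosets H. (\<lambda>C. C #> (inv y \<otimes> r D)) ` \<C>')"
    have "finite \<D>" using insert.prems(2) unfolding \<D>_def \<C>'_def by auto
    have \<C>'_coset: "\<exists>K\<in>\<H>. \<exists>g\<in>carrier G. C = K #> g" if "C \<in> \<C>'" for C
      using that unfolding \<C>'_def RCOSETS_def by auto
    have Kc: "K \<subseteq> carrier G" if "K \<in> \<H>" for K
      using insert.prems(1) that subgroup.subset by auto
    have \<D>sub: "\<D> \<subseteq> (\<Union>K\<in>\<H>. rcosets K)"
    proof
      fix E assume "E \<in> \<D>"
      then consider "E \<in> \<C>'" | D C where "D \<in> rcosets H" "C \<in> \<C>'" "E = C #> (inv y \<otimes> r D)"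
        unfolding \<D>_def by auto
      then show "E \<in> (\<Union>K\<in>\<H>. rcosets K)"
      proof cases
        case 1
        then show ?thesis unfolding \<C>'_def by auto
      next
        case 2
        obtain K g where K: "K \<in> \<H>" "g \<in> carrier G" "C = K #> g" using \<C>'_coset[OF 2(2)] by auto
        have "E = K #> (g \<otimes> (inv y \<otimes> r D))"
          using 2(3) K Kc[OF K(1)] y(1) r[OF 2(1)] by (simp add: coset_mult_assoc)
        moreover have "g \<otimes> (inv y \<otimes> r D) \<in> carrier G" using K(2) y(1) r[OF 2(1)] by simp
        ultimately show ?thesis using K(1) unfolding RCOSETS_def by blast
      qed
    qed
    have Hy: "H #> y \<subseteq> \<Union>\<C>'"
    proof
      fix x assume x: "x \<in> H #> y"
      then have "x \<in> carrier G" using y(1) H(1) by (meson r_coset_subset_G subgroup.subset subsetD)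
      then obtain C where C: "C \<in> \<C>" "x \<in> C" using cover by auto
      have "C \<notin> rcosets H"
      proof
        assume "C \<in> rcosets H"
        then obtain g where g: "g \<in> carrier G" "C = H #> g" unfolding RCOSETS_def by auto
        have "H #> g = H #> y"
          using repr_independence[OF _ _ H(1)] x C(2) g y(1) by metis
        then show False using g C y(2) by simp
      qed
      then show "x \<in> \<Union>\<C>'" using C insert.prems(3) unfolding \<C>'_def by auto
    qed
    have "carrier G \<subseteq> \<Union>\<D>"
    proof
      fix x assume x: "x \<in> carrier G"
      then obtain C where C: "C \<in> \<C>" "x \<in> C" using cover by auto
      show "x \<in> \<Union>\<D>"
      proof (cases "C \<in> rcosets H")
        case False
        then show ?thesis using C insert.prems(3) unfolding \<D>_def \<C>'_def by auto
      next
        case True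
        then obtain h where h: "h \<in> H" "x = h \<otimes> r C"
          using r[OF True] C(2) unfolding r_coset_def by auto
        then have "h \<otimes> y \<in> \<Union>\<C>'" using Hy unfolding r_coset_def by auto
        then obtain B where B: "B \<in> \<C>'" "h \<otimes> y \<in> B" by auto
        have "x = (h \<otimes> y) \<otimes> (inv y \<otimes> r C)"
          using h y(1) r[OF True] subgroup.mem_carrier[OF H(1) h(1)] by (simp add: m_assoc inv_cancel_left)
        then have "x \<in> B #> (inv y \<otimes> r C)" using B(2) unfolding r_coset_def by auto
        then show ?thesis using B(1) C True unfolding \<D>_def by auto
      qed
    qed
    moreover have "\<Union>\<D> \<subseteq> carrier G"
    proof
      fix x assume "x \<in> \<Union>\<D>"
      then obtain K g where "K \<in> \<H>" "g \<in> carrier G" "x \<in> K #> g"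
        using \<D>sub unfolding RCOSETS_def by blast
      then show "x \<in> carrier G" using Kc r_coset_subset_G by blast
    qed
    ultimately show False
      using insert.IH[OF _ \<open>finite \<D>\<close> \<D>sub] insert.prems(1) by auto
  qed
qed

text \<open>The sets to be avoided later are solution sets of equations. They may be empty or
  smaller than a coset, so only inclusion in a coset is demanded, and each set may come with its own
  subgroup.\<close>

lemma exists_outside_cosets_infinite_index:
  assumes "finite \<C>"
    and "\<And>C. C \<in> \<C> \<Longrightarrow> \<exists>H g. subgroup H G \<and> infinite (rcosets H) \<and> g \<in> carrier G \<and> C \<subseteq> H #> g"
  shows "\<exists>x\<in>carrier G. x \<notin> \<Union>\<C>"
proof -
  obtain H g where Hg: "\<And>C. C \<in> \<C> \<Longrightarrow> subgroup (H C) G \<and> infinite (rcosets (H C)) \<and> g C \<in> carrier G \<and> C \<subseteq> H C #> g C"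
    using assms(2) by metis
  have "\<Union>((\<lambda>C. H C #> g C) ` \<C>) \<noteq> carrier G"
    using Hg assms(1)
    by (intro Union_cosets_infinite_index_aux[of "H ` \<C>"]) (auto simp: RCOSETS_def)
  moreover have "\<Union>((\<lambda>C. H C #> g C) ` \<C>) \<subseteq> carrier G"
    using Hg r_coset_subset_G subgroup.subset by blast
  ultimately show ?thesis using Hg by blast
qed

end

subsection \<open>Rewritable tuples\<close>

definition list_mult :: "('a, 'b) monoid_scheme \<Rightarrow> 'a list \<Rightarrow> 'a" where
  "list_mult G xs = foldr (\<otimes>\<^bsub>G\<^esub>) xs \<one>\<^bsub>G\<^esub>"

lemma list_mult_simps [simp]:
  "list_mult G [] = \<one>\<^bsub>G\<^esub>" "list_mult G (x # xs) = x \<otimes>\<^bsub>G\<^esub> list_mult G xs"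
  by (simp_all add: list_mult_def)

context group
begin

lemma list_mult_closed [simp]: "set xs \<subseteq> carrier G \<Longrightarrow> list_mult G xs \<in> carrier G"
  by (induction xs) auto

lemma list_mult_append:
  "set xs \<subseteq> carrier G \<Longrightarrow> set ys \<subseteq> carrier G \<Longrightarrow> list_mult G (xs @ ys) = list_mult G xs \<otimes> list_mult G ys"
  by (induction xs) (auto simp: m_assoc)

text \<open>An equation \<open>a x b = x c\<close> confines \<open>x\<close> to one coset of the centralizer of \<open>a\<close>; hence \<open>x\<close> can be
  chosen to avoid all coincidences as long as all partial products \<open>a\<close> stay outside the FC-centre.\<close>
lemma exists_non_rewritable_list:
  assumes inf: "infinite (rcosets (fc_centre G))"
  shows "\<exists>xs. length xs = k \<and> set xs \<subseteq> carrier G \<and> distinct xs \<and>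
    (\<forall>ys. mset ys = mset xs \<and> list_mult G ys = list_mult G xs \<longrightarrow> ys = xs) \<and>
    (\<forall>ys. ys \<noteq> [] \<and> mset ys \<subseteq># mset xs \<longrightarrow> list_mult G ys \<notin> fc_centre G)"
proof (induction k)
  case 0
  show ?case by (intro exI[of _ "[]"]) auto
next
  case (Suc k)
  then obtain xs where len: "length xs = k" and xs: "set xs \<subseteq> carrier G" and dist: "distinct xs"
    and nrew: "\<And>ys. mset ys = mset xs \<Longrightarrow> list_mult G ys = list_mult G xs \<Longrightarrow> ys = xs"
    and nfc: "\<And>ys. ys \<noteq> [] \<Longrightarrow> mset ys \<subseteq># mset xs \<Longrightarrow> list_mult G ys \<notin> fc_centre G"
    by blast
  let ?D = "fc_centre G"
  define L where "L = {ys. mset ys \<subseteq># mset xs}"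
  have "L \<subseteq> {ys. set ys \<subseteq> set xs \<and> length ys \<le> length xs}"
    unfolding L_def using set_mset_mono size_mset_mono by fastforce
  then have finL: "finite L"
    by (rule finite_subset) (simp add: finite_lists_length_le)
  have Lc: "set ys \<subseteq> carrier G" if "ys \<in> L" for ys
    using that xs set_mset_mono unfolding L_def by fastforce
  define S where "S as bs = {x \<in> carrier G. list_mult G as \<otimes> x \<otimes> list_mult G bs = x \<otimes> list_mult G xs}" for as bs
  define T where "T as bs = {x \<in> carrier G. list_mult G as \<otimes> x \<otimes> list_mult G bs \<in> ?D}" for as bs
  \<comment> \<open>The bad values of the new element x. \<open>S\<close> collects those for which
    an ordering with a nonempty prefix before x has the same product as \<open>x # xs\<close>,
    \<open>T\<close> those that push a product containing x into the FC-centre, and the singletons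
    keep the list distinct. An ordering that starts with x needs no bad set: x cancels and the
    induction hypothesis applies.\<close>
  define \<C> where "\<C> = case_prod S ` ((L - {[]}) \<times> L) \<union> case_prod T ` (L \<times> L) \<union> (\<lambda>x. {x}) ` set xs"
  have Dsub: "subgroup ?D G" by (rule subgroup_fc_centre)
  have "\<exists>x\<in>carrier G. x \<notin> \<Union>\<C>"
  proof (rule exists_outside_cosets_infinite_index)
    show "finite \<C>" unfolding \<C>_def using finL by auto
    fix C assume "C \<in> \<C>"
    then consider (S) as bs where "as \<in> L" "as \<noteq> []" "bs \<in> L" "C = S as bs"
      | (T) as bs where "as \<in> L" "bs \<in> L" "C = T as bs"
      | (x) x where "x \<in> set xs" "C = {x}"
      unfolding \<C>_def by auto
    then show "\<exists>H g. subgroup H G \<and> infinite (rcosets H) \<and> g \<in> carrier G \<and> C \<subseteq> H #> g"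
    proof cases
      case S
      define a b where "a = list_mult G as" and "b = list_mult G bs"
      have ab: "a \<in> carrier G" "b \<in> carrier G" using Lc S unfolding a_def b_def by auto
      have "a \<notin> ?D" using nfc S unfolding a_def L_def by auto
      then have infc: "infinite (rcosets (centralizer G {a}))" using ab unfolding fc_centre_def by auto
      show ?thesis
      proof (cases "C = {}")
        case True
        then show ?thesis using Dsub inf by blast
      next
        case False
        then obtain x0 where x0: "x0 \<in> C" by auto
        \<comment> \<open>The equation a x b = x P, with P the product of \<open>xs\<close>, becomes
          x^-1 a x = w. Two solutions x and x0 conjugate a to the same element, so x x0^-1 commutes
          with a.\<close>
        define w where "w = list_mult G xs \<otimes> inv b"
        have wc: "w \<in> carrier G" using xs ab unfolding w_def by auto
        have eq: "x \<in> carrier G \<and> a \<otimes> x = x \<otimes> w" if "x \<in> C" for x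
        proof -
          have x: "x \<in> carrier G" "a \<otimes> x \<otimes> b = x \<otimes> list_mult G xs"
            using that S unfolding S_def a_def b_def by auto
          have "a \<otimes> x = a \<otimes> x \<otimes> b \<otimes> inv b" using x(1) ab by (simp add: m_assoc)
          then show ?thesis using x ab xs unfolding w_def by (simp add: m_assoc)
        qed
        have "C \<subseteq> centralizer G {a} #> x0"
        proof
          fix x assume x: "x \<in> C"
          have c: "x \<in> carrier G" "x0 \<in> carrier G" "a \<otimes> x = x \<otimes> w" "a \<otimes> x0 = x0 \<otimes> w"
            using eq x x0 by auto
          have "inv x0 \<otimes> a = w \<otimes> inv x0"
          proof -
            have "inv x0 \<otimes> (a \<otimes> x0) \<otimes> inv x0 = inv x0 \<otimes> (x0 \<otimes> w) \<otimes> inv x0" using c by simp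
            then show ?thesis using c(1,2) ab wc by (simp add: m_assoc inv_cancel_left)
          qed
          then have "(x \<otimes> inv x0) \<otimes> a = a \<otimes> (x \<otimes> inv x0)"
            using c ab wc by (metis inv_closed m_assoc)
          then have "x \<otimes> inv x0 \<in> centralizer G {a}" using c unfolding centralizer_def by auto
          moreover have "x = (x \<otimes> inv x0) \<otimes> x0" using c by (simp add: m_assoc)
          ultimately show "x \<in> centralizer G {a} #> x0" unfolding r_coset_def by blast
        qed
        then show ?thesis using infc eq[OF x0] subgroup_centralizer[of "{a}"] ab by blast
      qed
    next
      case T
      define a b where "a = list_mult G as" and "b = list_mult G bs"
      have ab: "a \<in> carrier G" "b \<in> carrier G" using Lc T unfolding a_def b_def by auto
      \<comment> \<open>Conjugating a x b by a gives x b a, which by normality is still in the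
        FC-centre. This puts x into the coset of (b a)^-1.\<close>
      have "C \<subseteq> ?D #> (inv a \<otimes> inv b)"
      proof
        fix x assume "x \<in> C"
        then have x: "x \<in> carrier G" "a \<otimes> x \<otimes> b \<in> ?D" using T unfolding T_def a_def b_def by auto
        then have "inv a \<otimes> (a \<otimes> x \<otimes> b) \<otimes> a \<in> ?D"
          using normal.inv_op_closed1[OF normal_fc_centre] ab by blast
        moreover have "x = (inv a \<otimes> (a \<otimes> x \<otimes> b) \<otimes> a) \<otimes> (inv a \<otimes> inv b)"
          using x ab by (simp add: m_assoc inv_cancel_left)
        ultimately show "x \<in> ?D #> (inv a \<otimes> inv b)" unfolding r_coset_def by blast
      qed
      then show ?thesis using inf Dsub ab by blast
    next
      case x
      then have "C \<subseteq> ?D #> x" using xs Dsub rcos_self by auto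
      then show ?thesis using inf Dsub x xs by blast
    qed
  qed
  then obtain x where x: "x \<in> carrier G" "x \<notin> \<Union>\<C>" by blast
  have split: "\<exists>as bs. ys = as @ x # bs \<and> mset (as @ bs) \<subseteq># mset xs \<and> as \<in> L \<and> bs \<in> L"
    if mem: "x \<in> set ys" and sub: "mset ys \<subseteq># mset (x # xs)" for ys
  proof -
    obtain as bs where ys: "ys = as @ x # bs" using split_list[OF mem] by blast
    then have "mset (as @ bs) \<subseteq># mset xs" using sub by auto
    moreover from this have "as \<in> L" "bs \<in> L" unfolding L_def
      by (auto intro: subset_mset.order_trans[rotated])
    ultimately show ?thesis using ys by blast
  qed
  show ?case
  proof (intro exI[of _ "x # xs"] conjI allI impI)
    show "length (x # xs) = Suc k" "set (x # xs) \<subseteq> carrier G" using len xs x by auto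
    show "distinct (x # xs)" using dist x unfolding \<C>_def by auto
  next
    fix ys assume "mset ys = mset (x # xs) \<and> list_mult G ys = list_mult G (x # xs)"
    then have ys: "mset ys = mset (x # xs)" "list_mult G ys = x \<otimes> list_mult G xs" by auto
    have "x \<in> set ys" using ys(1) by (metis list.set_intros(1) set_mset_mset)
    then obtain as bs where ab: "ys = as @ x # bs" "as \<in> L" "bs \<in> L" using split[of ys] ys(1) by auto
    have eq: "list_mult G as \<otimes> x \<otimes> list_mult G bs = x \<otimes> list_mult G xs"
      using ys(2) Lc[OF ab(2)] Lc[OF ab(3)] x(1) unfolding ab(1) by (simp add: list_mult_append m_assoc)
    show "ys = x # xs"
    proof (cases "as = []")
      case True
      have "x \<otimes> list_mult G bs = x \<otimes> list_mult G xs"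
        using eq True x(1) by simp
      then have "list_mult G bs = list_mult G xs"
        using x(1) Lc[OF ab(3)] xs by simp
      moreover have "mset bs = mset xs" using ys(1) ab(1) True by auto
      ultimately show ?thesis using nrew ab(1) True by auto
    next
      case False
      then have "x \<in> S as bs" using eq x(1) unfolding S_def by auto
      then show ?thesis using x(2) False ab unfolding \<C>_def by auto
    qed
  next
    fix ys assume ys: "ys \<noteq> [] \<and> mset ys \<subseteq># mset (x # xs)"
    show "list_mult G ys \<notin> ?D"
    proof (cases "x \<in> set ys")
      case False
      then have "mset ys \<subseteq># mset xs"
        using ys by (metis diff_subset_eq_self in_multiset_in_set insert_subset_eq_iff mset.simps(2) subset_mset.diff_add subset_mset_def diff_single_trivial subset_eq_diff_conv add_mset_add_single)
      then show ?thesis using nfc ys by auto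
    next
      case True
      then obtain as bs where ab: "ys = as @ x # bs" "as \<in> L" "bs \<in> L" using split[of ys] ys by auto
      have "x \<notin> T as bs" using x(2) ab unfolding \<C>_def by auto
      then show ?thesis using x(1) Lc[OF ab(2)] Lc[OF ab(3)] unfolding T_def ab(1)
        by (simp add: list_mult_append m_assoc)
    qed
  qed
qed

lemma finite_index_fc_centre_if_rewritable:
  assumes "\<And>xs. length xs = d \<Longrightarrow> set xs \<subseteq> carrier G \<Longrightarrow> distinct xs \<Longrightarrow>
    \<exists>ys. mset ys = mset xs \<and> ys \<noteq> xs \<and> list_mult G ys = list_mult G xs"
  shows "finite (rcosets (fc_centre G))"
  using exists_non_rewritable_list[of d] assms by blast

end


subsection \<open>Traces and spectra of complex matrices\<close>

definition mat_trace :: "'a :: comm_ring_1 mat \<Rightarrow> 'a" where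
  "mat_trace A = (\<Sum>i<dim_row A. A $$ (i, i))"

lemma mat_mult_index:
  assumes "A \<in> carrier_mat m k" "B \<in> carrier_mat k n" "i < m" "j < n"
  shows "(A * B) $$ (i, j) = (\<Sum>l<k. A $$ (i, l) * B $$ (l, j))"
  using assms by (simp add: scalar_prod_def atLeast0LessThan)

lemma mat_trace_mult:
  assumes "A \<in> carrier_mat m k" "B \<in> carrier_mat k m"
  shows "mat_trace (A * B) = (\<Sum>i<m. \<Sum>l<k. A $$ (i, l) * B $$ (l, i))"
  using assms by (simp add: mat_trace_def mat_mult_index del: index_mult_mat(1))

lemma mat_trace_mult_commute:
  assumes "A \<in> carrier_mat m k" "B \<in> carrier_mat k m"
  shows "mat_trace (A * B) = mat_trace (B * A)"
  unfolding mat_trace_mult[OF assms] mat_trace_mult[OF assms(2,1)]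
  by (subst sum.swap) (simp add: mult.commute)

lemma mat_trace_similar:
  assumes "similar_mat_wit A B P Q"
  shows "mat_trace A = mat_trace B"
proof -
  let ?n = "dim_row A"
  have c: "B \<in> carrier_mat ?n ?n" "P \<in> carrier_mat ?n ?n" "Q \<in> carrier_mat ?n ?n"
    "Q * P = 1\<^sub>m ?n" "A = P * B * Q" using similar_mat_witD[OF refl assms] by blast+
  have PB: "P * B \<in> carrier_mat ?n ?n" using c(1,2) by simp
  have "mat_trace A = mat_trace (P * B * Q)"
    using c(5) by (rule arg_cong)
  also have "\<dots> = mat_trace (Q * (P * B))"
    by (rule mat_trace_mult_commute[OF PB c(3)])
  also have "Q * (P * B) = Q * P * B"
    by (rule assoc_mult_mat[OF c(3,2,1), symmetric])
  also have "\<dots> = B" using c(1,4) by simp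
  finally show ?thesis .
qed

section \<open>Triangular form, eigenvalues and nilpotent matrices\<close>

lemma upper_triangular_pow:
  fixes B :: "'a :: comm_ring_1 mat"
  assumes B: "B \<in> carrier_mat n n" and ut: "upper_triangular B"
  shows "upper_triangular (B ^\<^sub>m k) \<and> (\<forall>i<n. (B ^\<^sub>m k) $$ (i, i) = B $$ (i, i) ^ k)"
proof (induction k)
  case 0
  then show ?case using B by auto
next
  case (Suc k)
  have Bk: "B ^\<^sub>m k \<in> carrier_mat n n" using B by simp
  have ut_k: "(B ^\<^sub>m k) $$ (i, j) = 0" if "j < i" "i < n" for i j
    using Suc Bk that by (auto elim: upper_triangularD)
  have ut_1: "B $$ (i, j) = 0" if "j < i" "i < n" for i j
    using ut B that by (auto elim: upper_triangularD)
  have idx: "(B ^\<^sub>m Suc k) $$ (i, j) = (\<Sum>l<n. (B ^\<^sub>m k) $$ (i, l) * B $$ (l, j))" if "i < n" "j < n" for i j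
    using mat_mult_index[OF Bk B that] by simp
  have "(B ^\<^sub>m Suc k) $$ (i, j) = 0" if "j < i" "i < n" for i j
  proof -
    have "(B ^\<^sub>m k) $$ (i, l) * B $$ (l, j) = 0" if "l < n" for l
      using ut_k[of l i] ut_1[of j l] \<open>j < i\<close> \<open>i < n\<close> that by (cases "l < i") auto
    then show ?thesis using idx that by simp
  qed
  then have "upper_triangular (B ^\<^sub>m Suc k)" using B by auto
  moreover have "(B ^\<^sub>m Suc k) $$ (i, i) = B $$ (i, i) ^ Suc k" if "i < n" for i
  proof -
    have "(B ^\<^sub>m k) $$ (i, l) * B $$ (l, i) = (if l = i then B $$ (i, i) ^ Suc k else 0)" if "l < n" for l
      using ut_k[of l i] ut_1[of i l] \<open>i < n\<close> that Suc
      by (cases "l < i"; cases "i < l") (auto simp: mult.commute)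
    then have "(\<Sum>l<n. (B ^\<^sub>m k) $$ (i, l) * B $$ (l, i)) = (\<Sum>l<n. if l = i then B $$ (i, i) ^ Suc k else 0)"
      by (intro sum.cong) auto
    then show ?thesis using idx[OF that that] that by simp
  qed
  ultimately show ?case by blast
qed

lemma strictly_upper_triangular_pow:
  fixes B :: "'a :: comm_ring_1 mat"
  assumes B: "B \<in> carrier_mat n n" and ut: "\<And>i j. i < n \<Longrightarrow> j < n \<Longrightarrow> j \<le> i \<Longrightarrow> B $$ (i, j) = 0"
  shows "i < n \<Longrightarrow> j < n \<Longrightarrow> j < i + k \<Longrightarrow> (B ^\<^sub>m k) $$ (i, j) = 0"
proof (induction k arbitrary: i j)
  case 0
  then show ?case using B by auto
next
  case (Suc k)
  have Bk: "B ^\<^sub>m k \<in> carrier_mat n n" using B by simp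
  have "(B ^\<^sub>m k) $$ (i, l) * B $$ (l, j) = 0" if "l < n" for l
    using Suc.IH[of i l] ut[of l j] Suc.prems that by (cases "l < i + k") auto
  then show ?case using mat_mult_index[OF Bk B Suc.prems(1,2)] by simp
qed

lemma complex_mat_triangularizable:
  assumes A: "(A :: complex mat) \<in> carrier_mat n n"
  obtains B P Q where "similar_mat_wit A B P Q" "B \<in> carrier_mat n n" "upper_triangular B"
    "char_poly A = (\<Prod>a\<leftarrow>diag_mat B. [:- a, 1:])"
proof -
  obtain as where as: "char_poly A = (\<Prod>a\<leftarrow>as. [:- a, 1:])" using char_poly_factorized[OF A] by blast
  obtain B P Q where S: "schur_decomposition A as = (B, P, Q)" by (cases "schur_decomposition A as")
  have "similar_mat_wit A B P Q" "upper_triangular B" "diag_mat B = as"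
    using schur_decomposition[OF A as S] by auto
  then show thesis using that as similar_mat_witD2(5)[OF A] by auto
qed

lemma root_char_poly_iff_diag:
  assumes "char_poly A = (\<Prod>a\<leftarrow>diag_mat (B :: complex mat). [:- a, 1:])"
  shows "poly (char_poly A) z = 0 \<longleftrightarrow> z \<in> set (diag_mat B)"
  unfolding assms by (auto simp: poly_prod_list prod_list_zero_iff)

text \<open>The list is the diagonal of a Schur form, that is, the eigenvalues with multiplicity.
  One list serves all exponents because the diagonal of a power of a triangular matrix consists of
  the powers of the diagonal entries.\<close>

lemma mat_trace_pow_eq_power_sum:
  assumes A: "(A :: complex mat) \<in> carrier_mat n n"
  obtains as where "length as = n" "\<And>z. poly (char_poly A) z = 0 \<longleftrightarrow> z \<in> set as"
    "\<And>k. mat_trace (A ^\<^sub>m k) = (\<Sum>a\<leftarrow>as. a ^ k)"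
proof -
  obtain B P Q where B: "similar_mat_wit A B P Q" "B \<in> carrier_mat n n" "upper_triangular B"
    "char_poly A = (\<Prod>a\<leftarrow>diag_mat B. [:- a, 1:])" using complex_mat_triangularizable[OF A] by blast
  have "mat_trace (A ^\<^sub>m k) = (\<Sum>a\<leftarrow>diag_mat B. a ^ k)" for k
  proof -
    have "mat_trace (A ^\<^sub>m k) = mat_trace (B ^\<^sub>m k)"
      using mat_trace_similar[OF similar_mat_wit_pow[OF B(1)]] .
    also have "\<dots> = (\<Sum>i<n. B $$ (i, i) ^ k)"
      using upper_triangular_pow[OF B(2,3), of k] B(2) by (simp add: mat_trace_def)
    also have "\<dots> = (\<Sum>a\<leftarrow>diag_mat B. a ^ k)"
      using B(2) by (simp add: diag_mat_def o_def sum_list_sum_nth atLeast0LessThan interv_sum_list_conv_sum_set_nat)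
    finally show ?thesis .
  qed
  moreover have "length (diag_mat B) = n" using B(2) by (simp add: diag_mat_def)
  ultimately show thesis using that root_char_poly_iff_diag[OF B(4)] by blast
qed

lemma nilpotent_if_only_root_0:
  assumes A: "(A :: complex mat) \<in> carrier_mat n n" and 0: "\<And>z. poly (char_poly A) z = 0 \<Longrightarrow> z = 0"
  shows "A ^\<^sub>m n = 0\<^sub>m n n"
proof -
  obtain B P Q where B: "similar_mat_wit A B P Q" "B \<in> carrier_mat n n" "upper_triangular B"
    "char_poly A = (\<Prod>a\<leftarrow>diag_mat B. [:- a, 1:])" using complex_mat_triangularizable[OF A] by blast
  have PQ: "P \<in> carrier_mat n n" "Q \<in> carrier_mat n n" using similar_mat_witD2[OF A B(1)] by auto
  have "B $$ (i, j) = 0" if "i < n" "j < n" "j \<le> i" for i j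
  proof (cases "j = i")
    case True
    have "B $$ (i, i) \<in> set (diag_mat B)" using that B(2) unfolding diag_mat_def by auto
    then show ?thesis using 0 root_char_poly_iff_diag[OF B(4)] True by blast
  next
    case False
    then show ?thesis using that B(2,3) by (auto elim: upper_triangularD)
  qed
  from strictly_upper_triangular_pow[OF B(2) this, of _ _ n] have "B ^\<^sub>m n = 0\<^sub>m n n"
    using B(2) by (intro eq_matI) auto
  then show ?thesis using similar_mat_wit_pow_id[OF B(1), of n] PQ by simp
qed

lemma pow_mat_mult_vec_eigen:
  fixes A :: "'a :: field mat"
  assumes A: "A \<in> carrier_mat n n" and v: "v \<in> carrier_vec n" and eig: "A *\<^sub>v v = z \<cdot>\<^sub>v v"
  shows "A ^\<^sub>m k *\<^sub>v v = z ^ k \<cdot>\<^sub>v v"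
proof (induction k)
  case 0
  then show ?case using A v by simp
next
  case (Suc k)
  have "A ^\<^sub>m Suc k *\<^sub>v v = A ^\<^sub>m k *\<^sub>v (A *\<^sub>v v)" using A v by (simp add: assoc_mult_mat_vec[of _ n n _ n])
  also have "\<dots> = z \<cdot>\<^sub>v (A ^\<^sub>m k *\<^sub>v v)" using A v by (simp add: eig mult_mat_vec[of "A ^\<^sub>m k" n n v])
  finally show ?case using Suc by (simp add: smult_smult_assoc)
qed

lemma root_char_polyE:
  assumes A: "(A :: complex mat) \<in> carrier_mat n n" and "poly (char_poly A) z = 0"
  obtains v where "v \<in> carrier_vec n" "v \<noteq> 0\<^sub>v n" "A *\<^sub>v v = z \<cdot>\<^sub>v v"
  using assms(2) unfolding eigenvalue_root_char_poly[OF A, symmetric] eigenvalue_def eigenvector_def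
  using A that by auto

lemma root_char_polyI:
  assumes A: "(A :: complex mat) \<in> carrier_mat n n" and "v \<in> carrier_vec n" "v \<noteq> 0\<^sub>v n" "A *\<^sub>v v = z \<cdot>\<^sub>v v"
  shows "poly (char_poly A) z = 0"
  unfolding eigenvalue_root_char_poly[OF A, symmetric] eigenvalue_def eigenvector_def
  using assms by auto

lemma nilpotent_root_0:
  assumes A: "(A :: complex mat) \<in> carrier_mat n n" and nil: "A ^\<^sub>m k = 0\<^sub>m n n"
    and z: "poly (char_poly A) z = 0"
  shows "z = 0"
proof -
  obtain v where v: "v \<in> carrier_vec n" "v \<noteq> 0\<^sub>v n" "A *\<^sub>v v = z \<cdot>\<^sub>v v" using root_char_polyE[OF A z] by blast
  have "0\<^sub>m n n *\<^sub>v v = 0\<^sub>v n" using v(1) by (intro eq_vecI) auto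
  then have "z ^ k \<cdot>\<^sub>v v = 0\<^sub>v n" using pow_mat_mult_vec_eigen[OF A v(1,3), of k] unfolding nil by simp
  moreover obtain i where "i < n" "v $ i \<noteq> 0" using v(1,2) by (metis carrier_vecD eq_vecI index_zero_vec(1,2))
  ultimately have "z ^ k * v $ i = 0" using v(1) by (metis carrier_vecD index_smult_vec(1) index_zero_vec(1))
  then show ?thesis using \<open>v $ i \<noteq> 0\<close> by auto
qed

lemma mat_trace_nilpotent:
  assumes A: "(A :: complex mat) \<in> carrier_mat n n" and nil: "A ^\<^sub>m k = 0\<^sub>m n n"
  shows "mat_trace A = 0"
proof -
  obtain as where as: "\<And>z. poly (char_poly A) z = 0 \<longleftrightarrow> z \<in> set as"
    "\<And>k. mat_trace (A ^\<^sub>m k) = (\<Sum>a\<leftarrow>as. a ^ k)" using mat_trace_pow_eq_power_sum[OF A] by metis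
  have "\<forall>a\<in>set as. a = 0" using as(1) nilpotent_root_0[OF A nil] by blast
  then have "(\<Sum>a\<leftarrow>as. a ^ 1) = 0" by (induction as) auto
  then show ?thesis using as(2)[of 1] A by simp
qed

lemma pow_mat_mult_commute:
  fixes A :: "'a :: comm_ring_1 mat"
  assumes A: "A \<in> carrier_mat n n" and T: "T \<in> carrier_mat n n" and comm: "A * T = T * A"
  shows "(A * T) ^\<^sub>m k = A ^\<^sub>m k * T ^\<^sub>m k"
proof -
  have Tk: "T ^\<^sub>m k * A = A * T ^\<^sub>m k" for k
  proof (induction k)
    case 0
    then show ?case using A T by simp
  next
    case (Suc k)
    have "T ^\<^sub>m Suc k * A = T ^\<^sub>m k * (T * A)" using A T by (simp add: assoc_mult_mat[of _ n n _ n _ n])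
    also have "\<dots> = (T ^\<^sub>m k * A) * T" using A T by (simp add: assoc_mult_mat[of _ n n _ n _ n] flip: comm)
    finally show ?case using A T by (simp add: Suc assoc_mult_mat[of _ n n _ n _ n])
  qed
  show ?thesis
  proof (induction k)
    case 0
    then show ?case using A T by simp
  next
    case (Suc k)
    have "(A * T) ^\<^sub>m Suc k = A ^\<^sub>m k * (T ^\<^sub>m k * A) * T"
      using assoc_mult_mat[of "A ^\<^sub>m k" n n "T ^\<^sub>m k" n "A * T" n] assoc_mult_mat[of "T ^\<^sub>m k" n n A n T n]
        assoc_mult_mat[of "A ^\<^sub>m k" n n "T ^\<^sub>m k * A" n T n] A T
        mult_carrier_mat[of "T ^\<^sub>m k" n n A n] by (simp add: Suc)
    also have "\<dots> = A ^\<^sub>m Suc k * T ^\<^sub>m Suc k"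
      unfolding Tk using A T assoc_mult_mat[of "A ^\<^sub>m k" n n A n "T ^\<^sub>m k" n]
        assoc_mult_mat[of "A ^\<^sub>m k * A" n n "T ^\<^sub>m k" n T n]
        mult_carrier_mat[of "A ^\<^sub>m k" n n A n] by simp
    finally show ?case .
  qed
qed

text \<open>Commutation gives (AT)^n = A^n T^n = 0. For a nilpotent A and an arbitrary T the trace
  of AT can be nonzero, which is why twisted characters are built from commuting matrices.\<close>

lemma mat_trace_nilpotent_commute:
  assumes A: "(A :: complex mat) \<in> carrier_mat n n" and T: "T \<in> carrier_mat n n" and comm: "A * T = T * A"
    and 0: "\<And>z. poly (char_poly A) z = 0 \<Longrightarrow> z = 0"
  shows "mat_trace (A * T) = 0"
proof (rule mat_trace_nilpotent)
  show "A * T \<in> carrier_mat n n" using A T by simp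
  show "(A * T) ^\<^sub>m n = 0\<^sub>m n n"
    using pow_mat_mult_commute[OF A T comm] nilpotent_if_only_root_0[OF A 0] T by simp
qed

text \<open>If the power sums of a list agree from exponent 1 on with those of \<open>L\<close> copies of \<open>c\<close>, evaluate at
  a polynomial that vanishes at \<open>0\<close>, at \<open>c\<close> and at all but one entry of the list.\<close>
lemma power_sums_eq_imp:
  fixes as :: "'f :: field_char_0 list"
  assumes sums: "\<And>k. k \<ge> 1 \<Longrightarrow> (\<Sum>a\<leftarrow>as. a ^ k) = L * c ^ k" and b: "b \<in> set as"
  shows "b = 0 \<or> b = c"
proof (rule ccontr)
  assume nb: "\<not> (b = 0 \<or> b = c)"
  \<comment> \<open>The hypothesis starts at exponent 1, so it extends by linearity exactly to
    polynomials without constant term.\<close>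
  have lin: "(\<Sum>a\<leftarrow>as. poly q a) = L * poly q c" if q0: "coeff q 0 = 0" for q
  proof -
    have "(\<Sum>a\<leftarrow>as. poly q a) = (\<Sum>a\<leftarrow>as. \<Sum>i\<le>degree q. coeff q i * a ^ i)"
      by (simp add: poly_altdef)
    also have "\<dots> = (\<Sum>i\<le>degree q. \<Sum>a\<leftarrow>as. coeff q i * a ^ i)"
      by (simp add: sum_list_sum_nth) (rule sum.swap)
    also have "\<dots> = (\<Sum>i\<le>degree q. coeff q i * (L * c ^ i))"
    proof (rule sum.cong)
      fix i
      show "(\<Sum>a\<leftarrow>as. coeff q i * a ^ i) = coeff q i * (L * c ^ i)"
        by (cases "i = 0") (simp_all add: q0 sum_list_const_mult sums)
    qed simp
    also have "\<dots> = L * poly q c" by (simp add: poly_altdef sum_distrib_left algebra_simps)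
    finally show ?thesis .
  qed
  define q where "q = [:0, 1:] * (\<Prod>w\<in>(insert c (set as)) - {b}. [:- w, 1:])"
  have "poly q c = 0" using nb by (auto simp: q_def poly_prod)
  then have "(\<Sum>a\<leftarrow>as. poly q a) = 0" using lin[of q] by (simp add: q_def)
  \<comment> \<open>All entries other than b are roots of \<open>q\<close>. What remains is the
    multiplicity of b times a nonzero value, and characteristic 0 keeps that multiplicity from
    vanishing.\<close>
  moreover have "(\<Sum>a\<leftarrow>as. poly q a) = of_nat (count_list as b) * poly q b"
  proof -
    have "(\<Sum>a\<leftarrow>xs. poly q a) = of_nat (count_list xs b) * poly q b" if "set xs \<subseteq> set as" for xs
      using that
    proof (induction xs)
      case (Cons x xs)
      then show ?case by (cases "x = b") (auto simp: q_def poly_prod algebra_simps)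
    qed simp
    then show ?thesis by blast
  qed
  moreover have "poly q b \<noteq> 0" using nb by (auto simp: q_def poly_prod)
  moreover have "count_list as b \<noteq> 0" using b by (simp add: count_list_0_iff)
  ultimately show False by simp
qed

lemma mat_trace_pow_zero_imp:
  assumes A: "(A :: complex mat) \<in> carrier_mat n n" and tr: "\<And>k. k \<ge> 1 \<Longrightarrow> mat_trace (A ^\<^sub>m k) = 0"
    and z: "poly (char_poly A) z = 0"
  shows "z = 0"
proof -
  obtain as where as: "\<And>z. poly (char_poly A) z = 0 \<longleftrightarrow> z \<in> set as"
    "\<And>k. mat_trace (A ^\<^sub>m k) = (\<Sum>a\<leftarrow>as. a ^ k)" using mat_trace_pow_eq_power_sum[OF A] by metis
  show ?thesis using power_sums_eq_imp[of as 0 0 z] as tr z by auto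
qed

text \<open>Eigenvalues 0 do not contribute to power sums with positive exponents, so
  \<open>power_sums_eq_imp\<close> leaves them open. In the application they are excluded by the
  invertibility of the matrix.\<close>

lemma mat_trace_pow_eq_dim_imp:
  assumes A: "(A :: complex mat) \<in> carrier_mat n n" and tr: "\<And>k. k \<ge> 1 \<Longrightarrow> mat_trace (A ^\<^sub>m k) = of_nat n"
    and z: "poly (char_poly A) z = 0"
  shows "z = 0 \<or> z = 1"
proof -
  obtain as where as: "\<And>z. poly (char_poly A) z = 0 \<longleftrightarrow> z \<in> set as"
    "\<And>k. mat_trace (A ^\<^sub>m k) = (\<Sum>a\<leftarrow>as. a ^ k)" using mat_trace_pow_eq_power_sum[OF A] by metis
  show ?thesis using power_sums_eq_imp[of as "of_nat n" 1 z] as tr z by auto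
qed

section \<open>Matrix powers that depend polynomially on the exponent\<close>

lemma poly_eq_if_eq_on_nats:
  fixes p q :: "complex poly"
  assumes "\<And>k::nat. poly p (of_nat k) = poly q (of_nat k)"
  shows "p = q"
proof (rule ccontr)
  assume "p \<noteq> q"
  then have "finite {x. poly (p - q) x = 0}" by (intro poly_roots_finite) simp
  moreover have "range (of_nat :: nat \<Rightarrow> complex) \<subseteq> {x. poly (p - q) x = 0}" using assms by auto
  ultimately have "finite (range (of_nat :: nat \<Rightarrow> complex))" by (rule rev_finite_subset)
  then show False by (simp add: finite_image_iff inj_of_nat)
qed

text \<open>The recursion z^(k+1) = z z^k becomes the polynomial identity p(x + 1) = z p(x). A shift
  of the argument preserves the leading coefficient, so z = 1.\<close>

lemma geometric_eq_poly_imp: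
  fixes z :: complex
  assumes "\<And>k::nat. z ^ k = poly p (of_nat k)"
  shows "z = 1"
proof -
  have "pcompose p [:1, 1:] = Polynomial.smult z p"
  proof (rule poly_eq_if_eq_on_nats)
    fix k :: nat
    have "poly p (of_nat (Suc k)) = z * poly p (of_nat k)" by (simp add: assms[symmetric] del: of_nat_Suc)
    then show "poly (pcompose p [:1, 1:]) (of_nat k) = poly (Polynomial.smult z p) (of_nat k)"
      by (simp add: poly_pcompose add.commute)
  qed
  then have "lead_coeff (Polynomial.smult z p) = lead_coeff p" using lead_coeff_comp[of "[:1, 1:]" p] by simp
  moreover have "p \<noteq> 0" using assms[of 0] by auto
  moreover from this have "z \<noteq> 0" using \<open>lead_coeff (Polynomial.smult z p) = lead_coeff p\<close> by auto
  ultimately show ?thesis by simp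
qed

lemma binomial_poly:
  "\<exists>q :: complex poly. degree q \<le> i \<and> (\<forall>k. poly q (of_nat k) = of_nat (k choose i))"
proof (intro exI conjI allI)
  let ?q = "Polynomial.smult (1 / fact i) (\<Prod>t<i. [:- of_nat t, 1:]) :: complex poly"
  have "degree (\<Prod>t<i. [:- of_nat t, 1:] :: complex poly) \<le> (\<Sum>t<i. degree ([:- of_nat t, 1:] :: complex poly))"
    using degree_prod_sum_le[of "{..<i}" "\<lambda>t. [:- of_nat t, 1:] :: complex poly"] by (simp add: o_def)
  then show "degree ?q \<le> i" by simp
  show "poly ?q (of_nat k) = of_nat (k choose i)" for k
    by (simp add: binomial_gbinomial gbinomial_prod_rev poly_prod atLeast0LessThan)
qed

text \<open>With A = 1 + N and N nilpotent, the binomial expansion of A^k stops before N^n, and k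
  choose i is a polynomial of degree i in k. The strict bound by the size of the matrix is what the
  degree comparison for tensor powers relies on.\<close>

lemma pow_mat_unipotent_poly:
  assumes A: "(A :: complex mat) \<in> carrier_mat n n" and 1: "\<And>z. poly (char_poly A) z = 0 \<Longrightarrow> z = 1"
    and ij: "i < n" "j < n"
  shows "\<exists>q. degree q < n \<and> (\<forall>k. (A ^\<^sub>m k) $$ (i, j) = poly q (of_nat k))"
proof -
  define N where "N = A - 1\<^sub>m n"
  have N: "N \<in> carrier_mat n n" unfolding N_def by (rule minus_carrier_mat[OF one_carrier_mat])
  have AN: "A = 1\<^sub>m n + N" using A unfolding N_def by (intro eq_matI) auto
  have "z = 0" if z: "poly (char_poly N) z = 0" for z
  proof -
    obtain v where v: "v \<in> carrier_vec n" "v \<noteq> 0\<^sub>v n" "N *\<^sub>v v = z \<cdot>\<^sub>v v" using root_char_polyE[OF N z] by blast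
    have "A *\<^sub>v v = (1 + z) \<cdot>\<^sub>v v"
      using add_mult_distrib_mat_vec[OF one_carrier_mat N v(1)] v(1,3)
      unfolding AN[symmetric] by (simp add: add_smult_distrib_vec)
    then have "1 + z = 1" by (rule 1[OF root_char_polyI[OF A v(1,2)]])
    then show ?thesis by simp
  qed
  then have Nn: "N ^\<^sub>m n = 0\<^sub>m n n" by (rule nilpotent_if_only_root_0[OF N])
  obtain m where m: "n = Suc m" using ij by (cases n) auto
  have expand: "(A ^\<^sub>m k) $$ (a, b) = (\<Sum>i<n. of_nat (k choose i) * (N ^\<^sub>m i) $$ (a, b))"
    if "a < n" "b < n" for a b k
    using that
  proof (induction k arbitrary: a b)
    case 0
    have "(\<Sum>i<n. of_nat (0 choose i) * (N ^\<^sub>m i) $$ (a, b)) = (N ^\<^sub>m 0) $$ (a, b)"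
      unfolding m sum.lessThan_Suc_shift by simp
    then show ?case using A N 0 by simp
  next
    case (Suc k)
    have Ak: "A ^\<^sub>m k \<in> carrier_mat n n" using A by simp
    have Ni: "N ^\<^sub>m i \<in> carrier_mat n n" for i using N by simp
    have "A ^\<^sub>m Suc k = A ^\<^sub>m k + A ^\<^sub>m k * N"
      using Ak N by (simp add: AN mult_add_distrib_mat[of _ n n _ n])
    then have "(A ^\<^sub>m Suc k) $$ (a, b) = (A ^\<^sub>m k) $$ (a, b) + (A ^\<^sub>m k * N) $$ (a, b)"
      using Suc.prems A N by (simp del: index_mult_mat(1))
    also have "(A ^\<^sub>m k * N) $$ (a, b) = (\<Sum>c<n. (A ^\<^sub>m k) $$ (a, c) * N $$ (c, b))"
      by (rule mat_mult_index[OF Ak N Suc.prems])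
    also have "(\<Sum>c<n. (A ^\<^sub>m k) $$ (a, c) * N $$ (c, b))
        = (\<Sum>c<n. \<Sum>i<n. of_nat (k choose i) * ((N ^\<^sub>m i) $$ (a, c) * N $$ (c, b)))"
      using Suc by (simp add: sum_distrib_right mult.assoc)
    also have "\<dots> = (\<Sum>i<n. of_nat (k choose i) * (N ^\<^sub>m Suc i) $$ (a, b))"
      using Suc.prems Ni N
      by (subst sum.swap) (simp add: sum_distrib_left mat_mult_index[of _ n n _ n] del: index_mult_mat(1))
    \<comment> \<open>The top term carries N^n = 0. Dropping it lets Pascal's rule reproduce the
      same range of summation.\<close>
    also have "\<dots> = (\<Sum>i<m. of_nat (k choose i) * (N ^\<^sub>m Suc i) $$ (a, b))"
      using Nn Suc.prems unfolding m by simp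
    also have "(A ^\<^sub>m k) $$ (a, b) = (N ^\<^sub>m 0) $$ (a, b) + (\<Sum>i<m. of_nat (k choose Suc i) * (N ^\<^sub>m Suc i) $$ (a, b))"
      using Suc unfolding m sum.lessThan_Suc_shift by simp
    finally show ?case
      unfolding m sum.lessThan_Suc_shift by (simp add: sum.distrib algebra_simps del: pow_mat.simps)
  qed
  obtain q where q: "\<And>i. degree (q i) \<le> i" "\<And>i k. poly (q i) (of_nat k) = (of_nat (k choose i) :: complex)"
    using binomial_poly by metis
  show ?thesis
  proof (intro exI conjI allI)
    let ?r = "\<Sum>l<n. Polynomial.smult ((N ^\<^sub>m l) $$ (i, j)) (q l)"
    show "degree ?r < n"
    proof (rule degree_sum_less)
      fix l assume "l \<in> {..<n}"
      then show "degree (Polynomial.smult ((N ^\<^sub>m l) $$ (i, j)) (q l)) < n"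
        using q(1)[of l] le_less_trans[OF degree_smult_le] by auto
    qed (use m in simp)
    show "(A ^\<^sub>m k) $$ (i, j) = poly ?r (of_nat k)" for k
      using expand[OF ij] by (simp add: poly_sum q(2) mult.commute)
  qed
qed

text \<open>Read off at a nonzero coordinate of an eigenvector, z^k is a fixed linear combination of
  entries of A^k, hence polynomial in k. This converse of the previous lemma shows that tensor
  powers of unipotent matrices are unipotent by looking at entries only.\<close>

lemma roots_eq_1_if_pow_mat_poly:
  assumes A: "(A :: complex mat) \<in> carrier_mat n n"
    and p: "\<And>i j. i < n \<Longrightarrow> j < n \<Longrightarrow> \<exists>q. \<forall>k. (A ^\<^sub>m k) $$ (i, j) = poly q (of_nat k)"
    and z: "poly (char_poly A) z = 0"
  shows "z = 1"
proof -
  obtain v where v: "v \<in> carrier_vec n" "v \<noteq> 0\<^sub>v n" "A *\<^sub>v v = z \<cdot>\<^sub>v v" using root_char_polyE[OF A z] by blast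
  obtain i where i: "i < n" "v $ i \<noteq> 0" using v(1,2) by (metis carrier_vecD eq_vecI index_zero_vec(1,2))
  obtain q where q: "\<And>j k. j < n \<Longrightarrow> (A ^\<^sub>m k) $$ (i, j) = poly (q j) (of_nat k)" using p[OF i(1)] by metis
  show ?thesis
  proof (rule geometric_eq_poly_imp)
    fix k
    have "z ^ k * v $ i = (A ^\<^sub>m k *\<^sub>v v) $ i"
      using pow_mat_mult_vec_eigen[OF A v(1,3), of k] v(1) i by simp
    also have "\<dots> = (\<Sum>j<n. poly (q j) (of_nat k) * v $ j)"
      using A v(1) i(1) q by (simp add: scalar_prod_def atLeast0LessThan)
    finally have "z ^ k = (\<Sum>j<n. poly (q j) (of_nat k) * v $ j) / v $ i"
      using i(2) by (simp add: nonzero_eq_divide_eq)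
    then have "z ^ k = (\<Sum>j<n. poly (q j) (of_nat k) * (v $ j / v $ i))"
      by (simp add: sum_divide_distrib)
    then show "z ^ k = poly (\<Sum>j<n. Polynomial.smult (v $ j / v $ i) (q j)) (of_nat k)"
      by (simp add: poly_sum mult.commute)
  qed
qed

subsection \<open>Centralizers in linear groups\<close>

text \<open>A finite subset with the same span as S would do; it is found by Gaussian elimination,
  one coordinate at a time. The coefficient vectors \<open>c\<close> play the role of linear
  forms.\<close>

lemma finite_subset_same_annihilator:
  fixes S :: "('i \<Rightarrow> 'f :: field) set"
  assumes "finite I"
  shows "\<exists>F\<subseteq>S. finite F \<and> (\<forall>c. (\<forall>v\<in>F. (\<Sum>i\<in>I. c i * v i) = 0) \<longrightarrow> (\<forall>v\<in>S. (\<Sum>i\<in>I. c i * v i) = 0))"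
  using assms
proof (induction I arbitrary: S rule: finite_induct)
  case empty
  show ?case by auto
next
  case (insert j I)
  show ?case
  proof (cases "\<forall>v\<in>S. v j = 0")
    case True
    obtain F where F: "F \<subseteq> S" "finite F"
      "\<And>c. (\<forall>v\<in>F. (\<Sum>i\<in>I. c i * v i) = 0) \<Longrightarrow> (\<forall>v\<in>S. (\<Sum>i\<in>I. c i * v i) = 0)"
      using insert.IH[of S] by blast
    have "(\<Sum>i\<in>insert j I. c i * v i) = (\<Sum>i\<in>I. c i * v i)" if "v \<in> S" for c v
      using True that insert.hyps by simp
    then show ?thesis using F by (intro exI[of _ F]) (auto simp: subset_iff)
  next
    case False
    then obtain w where w: "w \<in> S" "w j \<noteq> 0" by auto
    \<comment> \<open>\<open>r v\<close> is v with coordinate j cleared by means of the pivot w. A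
      linear form that vanishes at w takes the same value at v and at \<open>r v\<close>, so adding
      w to the finite set compensates for the elimination.\<close>
    define r where "r v = (\<lambda>i. v i - v j / w j * w i)" for v
    obtain F' where F': "F' \<subseteq> r ` S" "finite F'"
      "\<And>c. (\<forall>v\<in>F'. (\<Sum>i\<in>I. c i * v i) = 0) \<Longrightarrow> (\<forall>v\<in>r ` S. (\<Sum>i\<in>I. c i * v i) = 0)"
      using insert.IH[of "r ` S"] by blast
    obtain F where F: "F \<subseteq> S" "finite F" "F' = r ` F"
      using F'(1,2) finite_subset_image by metis
    have r: "(\<Sum>i\<in>I. c i * r v i) = (\<Sum>i\<in>insert j I. c i * v i) - v j / w j * (\<Sum>i\<in>insert j I. c i * w i)"
      for c v
      using w insert.hyps
      by (simp add: r_def algebra_simps sum_subtractf sum_distrib_left)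
    show ?thesis
    proof (intro exI[of _ "insert w F"] conjI allI impI ballI)
      show "insert w F \<subseteq> S" "finite (insert w F)" using w F by auto
    next
      fix c v assume c: "\<forall>v\<in>insert w F. (\<Sum>i\<in>insert j I. c i * v i) = 0" and v: "v \<in> S"
      then have "\<forall>v\<in>F'. (\<Sum>i\<in>I. c i * v i) = 0" unfolding F(3) by (simp add: r del: sum.insert)
      then have "(\<Sum>i\<in>I. c i * r v i) = 0" using F'(3) v by blast
      then show "(\<Sum>i\<in>insert j I. c i * v i) = 0" using c by (simp add: r del: sum.insert)
    qed
  qed
qed

lemma cont_repD:
  assumes "cont_rep G X m \<pi>"
  shows "g \<in> carrier G \<Longrightarrow> \<pi> g \<in> carrier_mat m m"
    "g \<in> carrier G \<Longrightarrow> h \<in> carrier G \<Longrightarrow> \<pi> (g \<otimes>\<^bsub>G\<^esub> h) = \<pi> g * \<pi> h"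
    "\<pi> \<one>\<^bsub>G\<^esub> = 1\<^sub>m m"
    "i < m \<Longrightarrow> j < m \<Longrightarrow> continuous_map X euclidean (\<lambda>g. \<pi> g $$ (i, j))"
  using assms unfolding cont_rep_def by auto

text \<open>For fixed x, commuting with a is a system of linear equations in the entries of
  \<pi>(a). It holds for all a in \<open>S\<close> as soon as it holds on a finite subset whose
  matrices have the same linear consequences, and this subset does not depend on x.\<close>

lemma (in group) centralizer_eq_finite_if_faithful:
  assumes rep: "cont_rep G X m \<pi>" and inj: "inj_on \<pi> (carrier G)" and S: "S \<subseteq> carrier G"
  shows "\<exists>F\<subseteq>S. finite F \<and> centralizer G F = centralizer G S"
proof -
  note R = cont_repD[OF rep]
  define I where "I = {..<m} \<times> {..<m}"
  define v where "v a = (\<lambda>p. \<pi> a $$ p)" for a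
  \<comment> \<open>The coefficients of the (i, j) entry of the commutator \<pi>(x) \<pi>(a) -
    \<pi>(a) \<pi>(x), seen as a linear form in the entries of \<pi>(a).\<close>
  define c where "c x i j = (\<lambda>(k, l). (if l = j then \<pi> x $$ (i, k) else 0) - (if k = i then \<pi> x $$ (l, j) else 0))"
    for x i j
  have c: "(\<Sum>p\<in>I. c x i j p * v a p) = (\<pi> x * \<pi> a) $$ (i, j) - (\<pi> a * \<pi> x) $$ (i, j)"
    if "x \<in> carrier G" "a \<in> carrier G" "i < m" "j < m" for x a i j
  proof -
    have "(\<Sum>p\<in>I. c x i j p * v a p) = (\<Sum>k<m. \<Sum>l<m. (if l = j then \<pi> x $$ (i, k) * \<pi> a $$ (k, l) else 0))
      - (\<Sum>k<m. \<Sum>l<m. (if k = i then \<pi> x $$ (l, j) * \<pi> a $$ (k, l) else 0))"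
      unfolding I_def sum.cartesian_product' sum_subtractf[symmetric]
      by (intro sum.cong refl) (simp add: c_def v_def left_diff_distrib)
    also have "(\<Sum>k<m. \<Sum>l<m. (if l = j then \<pi> x $$ (i, k) * \<pi> a $$ (k, l) else 0)) = (\<pi> x * \<pi> a) $$ (i, j)"
      using that R(1) by (simp add: mat_mult_index[of _ m m _ m])
    also have "(\<Sum>k<m. \<Sum>l<m. (if k = i then \<pi> x $$ (l, j) * \<pi> a $$ (k, l) else 0)) = (\<pi> a * \<pi> x) $$ (i, j)"
      using that R(1) by (subst sum.swap) (simp add: mat_mult_index[of _ m m _ m] mult.commute)
    finally show ?thesis .
  qed
  have comm: "x \<otimes> a = a \<otimes> x \<longleftrightarrow> (\<forall>i<m. \<forall>j<m. (\<Sum>p\<in>I. c x i j p * v a p) = 0)"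
    if "x \<in> carrier G" "a \<in> carrier G" for x a
  proof -
    have "x \<otimes> a = a \<otimes> x \<longleftrightarrow> \<pi> (x \<otimes> a) = \<pi> (a \<otimes> x)"
      using inj that by (auto simp: inj_on_def)
    also have "\<dots> \<longleftrightarrow> (\<forall>i<m. \<forall>j<m. (\<pi> x * \<pi> a) $$ (i, j) = (\<pi> a * \<pi> x) $$ (i, j))"
      unfolding R(2)[OF that] R(2)[OF that(2,1)]
      using R(1)[OF that(1)] R(1)[OF that(2)] by (auto simp del: index_mult_mat(1) intro!: eq_matI)
    finally show ?thesis using c that by simp
  qed
  have "finite I" unfolding I_def by simp
  from finite_subset_same_annihilator[OF this, of "v ` S"] obtain F' where F': "F' \<subseteq> v ` S" "finite F'"
    "\<And>c. (\<forall>v\<in>F'. (\<Sum>i\<in>I. c i * v i) = 0) \<Longrightarrow> (\<forall>v\<in>v ` S. (\<Sum>i\<in>I. c i * v i) = 0)" by blast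
  obtain F where F: "F \<subseteq> S" "finite F" "F' = v ` F"
    using F'(1,2) finite_subset_image by metis
  have "centralizer G F \<subseteq> centralizer G S"
  proof
    fix x assume x: "x \<in> centralizer G F"
    then have xc: "x \<in> carrier G" unfolding centralizer_def by auto
    have "(\<Sum>p\<in>I. c x i j p * v a p) = 0" if "i < m" "j < m" "a \<in> S" for i j a
    proof -
      have "(\<Sum>p\<in>I. c x i j p * v b p) = 0" if b: "b \<in> F" for b
      proof -
        have "x \<otimes> b = b \<otimes> x" "b \<in> carrier G" using x b F(1) S unfolding centralizer_def by auto
        then show ?thesis using comm xc \<open>i < m\<close> \<open>j < m\<close> by blast
      qed
      then have "\<forall>w\<in>F'. (\<Sum>p\<in>I. c x i j p * w p) = 0" unfolding F(3) by simp
      then show ?thesis using F'(3)[of "c x i j"] that(3) by blast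
    qed
    then show "x \<in> centralizer G S" using comm xc S unfolding centralizer_def by auto
  qed
  moreover have "centralizer G S \<subseteq> centralizer G F" using F(1) unfolding centralizer_def by auto
  ultimately show ?thesis using F by blast
qed

text \<open>The centre of K is an intersection of two centralizers, and centralizers are closed
  because they are equalizers of continuous maps into a Hausdorff space. This is the gain over D
  \<inter> K, which serves only to bound the index.\<close>

lemma (in group) virtually_abelian_if_finite_index_fc_centre:
  assumes fin: "finite (rcosets (fc_centre G))"
    and rep: "cont_rep G X m \<pi>" and inj: "inj_on \<pi> (carrier G)"
    and top: "topspace X = carrier G" "Hausdorff_space X"
      "continuous_map (prod_topology X X) X (\<lambda>(x, y). x \<otimes> y)"
  shows "\<exists>A. A \<lhd> G \<and> closedin X A \<and> (\<forall>a\<in>A. \<forall>b\<in>A. a \<otimes> b = b \<otimes> a) \<and> finite (rcosets A)"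
proof -
  let ?D = "fc_centre G"
  have Dc: "?D \<subseteq> carrier G" unfolding fc_centre_def by auto
  have Dsub: "subgroup ?D G" by (rule subgroup_fc_centre)
  define K where "K = centralizer G ?D"
  have Ksub: "subgroup K G" unfolding K_def by (rule subgroup_centralizer[OF Dc])
  have Kc: "K \<subseteq> carrier G" unfolding K_def centralizer_def by auto
  obtain F where F: "F \<subseteq> ?D" "finite F" "centralizer G F = K"
    using centralizer_eq_finite_if_faithful[OF rep inj Dc] unfolding K_def by blast
  have "finite (rcosets (centralizer G F))"
    using F(2,1)
  proof (induction F rule: finite_induct)
    case empty
    have "centralizer G {} = carrier G" unfolding centralizer_def by auto
    moreover have "rcosets (carrier G) \<subseteq> {carrier G}"
      unfolding RCOSETS_def by (auto simp: coset_join2 subgroup_self)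
    ultimately show ?case using finite_subset by auto
  next
    case (insert a F)
    have "centralizer G (insert a F) = centralizer G {a} \<inter> centralizer G F"
      unfolding centralizer_def by auto
    moreover have "finite (rcosets (centralizer G {a}))" using insert.prems unfolding fc_centre_def by auto
    ultimately show ?case
      using insert Dc by (auto intro!: finite_index_Int subgroup_centralizer)
  qed
  then have finK: "finite (rcosets K)" unfolding F(3) .
  define A where "A = K \<inter> centralizer G K"
  have Asub: "subgroup A G" unfolding A_def using Ksub subgroup_centralizer[OF Kc] by (rule subgroups_Inter_pair)
  \<comment> \<open>The centralizer of a conjugation-invariant set is conjugation-invariant. This is
    applied to D, which gives the invariance of K, and then to K itself.\<close>
  have normal_cent: "x \<otimes> a \<otimes> inv x \<in> centralizer G S"
    if S: "S \<subseteq> carrier G" "\<And>x s. x \<in> carrier G \<Longrightarrow> s \<in> S \<Longrightarrow> x \<otimes> s \<otimes> inv x \<in> S"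
      and x: "x \<in> carrier G" and a: "a \<in> centralizer G S" for S x a
  proof -
    have ac: "a \<in> carrier G" using a unfolding centralizer_def by auto
    have "(x \<otimes> a \<otimes> inv x) \<otimes> s = s \<otimes> (x \<otimes> a \<otimes> inv x)" if s: "s \<in> S" for s
    proof -
      have sc: "s \<in> carrier G" using s S by auto
      define t where "t = inv x \<otimes> s \<otimes> x"
      have "t \<in> S" using S(2)[of "inv x" s] x s unfolding t_def by simp
      then have t: "a \<otimes> t = t \<otimes> a" "t \<in> carrier G" using a S(1) unfolding centralizer_def by auto
      have "(x \<otimes> a \<otimes> inv x) \<otimes> s = x \<otimes> (a \<otimes> t) \<otimes> inv x"
        unfolding t_def using x ac sc by (simp add: m_assoc)
      also have "\<dots> = s \<otimes> (x \<otimes> a \<otimes> inv x)"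
        unfolding t(1) unfolding t_def using x ac sc by (simp add: m_assoc inv_cancel_left)
      finally show ?thesis .
    qed
    then show ?thesis using x ac unfolding centralizer_def by auto
  qed
  have K_conj: "x \<otimes> k \<otimes> inv x \<in> K" if "x \<in> carrier G" "k \<in> K" for x k
    using normal_cent[OF Dc _ that(1)] that(2) normal_fc_centre unfolding K_def normal_inv_iff by blast
  have "A \<lhd> G"
    unfolding normal_inv_iff A_def
    using Asub K_conj normal_cent[OF Kc K_conj] unfolding A_def by auto
  moreover have "closedin X A"
  proof -
    have "closedin X (centralizer G S)" if "S \<subseteq> carrier G" for S
    proof -
      have eq: "centralizer G S = topspace X \<inter> (\<Inter>a\<in>S. {x \<in> topspace X. x \<otimes> a = a \<otimes> x})"
        unfolding centralizer_def top(1) by auto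
      have "closedin X {x \<in> topspace X. x \<otimes> a = a \<otimes> x}" if a: "a \<in> S" for a
      proof -
        have ac: "a \<in> topspace X" using a \<open>S \<subseteq> carrier G\<close> top(1) by auto
        have "continuous_map X X (\<lambda>x. x \<otimes> a)"
          using continuous_map_compose[OF _ top(3), of X "\<lambda>x. (x, a)"] ac
          by (simp add: o_def continuous_map_paired)
        moreover have "continuous_map X X (\<lambda>x. a \<otimes> x)"
          using continuous_map_compose[OF _ top(3), of X "\<lambda>x. (a, x)"] ac
          by (simp add: o_def continuous_map_paired)
        ultimately show ?thesis using top(2) by (intro closedin_continuous_maps_eq)
      qed
      then have "closedin X (\<Inter>a\<in>S. {x \<in> topspace X. x \<otimes> a = a \<otimes> x})" if "S \<noteq> {}"
        using that by (intro closedin_Inter) auto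
      then show ?thesis unfolding eq
        by (cases "S = {}") (simp_all add: closedin_Int)
    qed
    then show ?thesis unfolding A_def K_def using Dc Kc unfolding K_def by (intro closedin_Int) auto
  qed
  moreover have "\<forall>a\<in>A. \<forall>b\<in>A. a \<otimes> b = b \<otimes> a" unfolding A_def centralizer_def by blast
  moreover have "finite (rcosets A)"
  proof -
    have "?D \<inter> K \<subseteq> A" unfolding A_def K_def centralizer_def by auto
    then show ?thesis
      using finite_index_mono[OF subgroups_Inter_pair[OF Dsub Ksub] Asub] finite_index_Int[OF Dsub Ksub fin finK]
      by blast
  qed
  ultimately show ?thesis by blast
qed

subsection \<open>Composition factors\<close>

lemma sum_lessThan_add:
  fixes f :: "nat \<Rightarrow> 'a :: comm_monoid_add"
  shows "(\<Sum>l<a + b. f l) = (\<Sum>l<a. f l) + (\<Sum>l<b. f (a + l))"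
  by (induction b) (simp_all add: add.assoc)

lemma exists_inverse_mat:
  fixes E :: "'a :: field mat"
  assumes E: "E \<in> carrier_mat m m" and ker: "\<And>x. x \<in> carrier_vec m \<Longrightarrow> E *\<^sub>v x = 0\<^sub>v m \<Longrightarrow> x = 0\<^sub>v m"
  obtains E' where "E' \<in> carrier_mat m m" "E * E' = 1\<^sub>m m" "E' * E = 1\<^sub>m m"
proof -
  have "det E \<noteq> 0" using ker det_0_iff_vec_prod_zero_field[OF E] by blast
  then have "E \<in> Units (ring_mat TYPE('a) m ())" by (rule det_non_zero_imp_unit[OF E])
  then show thesis using that unfolding Units_def ring_mat_def by auto
qed

lemma inverse_mat_mult:
  assumes "A \<in> carrier_mat m m" "A' \<in> carrier_mat m m" "B \<in> carrier_mat m m" "B' \<in> carrier_mat m m"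
    and "A * A' = 1\<^sub>m m" "B * B' = 1\<^sub>m m"
  shows "A * B * (B' * A') = (1\<^sub>m m :: 'a :: comm_ring_1 mat)"
proof -
  have "B * (B' * A') = B * B' * A'"
    by (rule assoc_mult_mat[OF assms(3,4,2), symmetric])
  then show ?thesis
    using assms assoc_mult_mat[of A m m B m "B' * A'" m] by simp
qed

lemma mult_conj_inverse_mat:
  fixes A :: "'a :: comm_ring_1 mat"
  assumes S: "S \<in> carrier_mat m m" "S' \<in> carrier_mat m m" and A: "A \<in> carrier_mat m m" and inv: "S * S' = 1\<^sub>m m"
  shows "S * (S' * A * S) = A * S"
proof -
  have AS: "A * S \<in> carrier_mat m m" using A S by simp
  have "S' * A * S = S' * (A * S)" by (rule assoc_mult_mat[OF S(2) A S(1)])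
  moreover have "S * (S' * (A * S)) = S * S' * (A * S)" by (rule assoc_mult_mat[OF S AS, symmetric])
  ultimately show ?thesis using inv left_mult_one_mat[OF AS] by simp
qed

text \<open>Among the invertible matrices choose one with the largest number \<open>a\<close> of
  leading columns in \<open>W\<close>. If a vector of \<open>W\<close> had a nonzero coordinate at
  or beyond \<open>a\<close>, it could be exchanged into column \<open>a\<close>, against
  maximality.\<close>

lemma exists_adapted_basis:
  fixes W :: "'a :: field vec set"
  assumes W: "W \<subseteq> carrier_vec m" "0\<^sub>v m \<in> W" "\<And>v w. v \<in> W \<Longrightarrow> w \<in> W \<Longrightarrow> v + w \<in> W"
    "\<And>c v. v \<in> W \<Longrightarrow> c \<cdot>\<^sub>v v \<in> W"
  obtains a S S' where "a \<le> m" "S \<in> carrier_mat m m" "S' \<in> carrier_mat m m" "S * S' = 1\<^sub>m m" "S' * S = 1\<^sub>m m"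
    "\<And>v. v \<in> carrier_vec m \<Longrightarrow> S *\<^sub>v v \<in> W \<longleftrightarrow> (\<forall>i. a \<le> i \<and> i < m \<longrightarrow> v $ i = 0)"
proof -
  define P where "P a \<longleftrightarrow> a \<le> m \<and> (\<exists>S S'. S \<in> carrier_mat m m \<and> S' \<in> carrier_mat m m \<and>
    S * S' = 1\<^sub>m m \<and> S' * S = 1\<^sub>m m \<and> (\<forall>i<a. col S i \<in> W))" for a
  have "P 0" unfolding P_def by (auto intro!: exI[of _ "1\<^sub>m m"])
  moreover have "\<forall>b. P b \<longrightarrow> b \<le> m" unfolding P_def by blast
  ultimately obtain a where a: "P a" "\<And>b. P b \<Longrightarrow> b \<le> a"
    using GreatestI_nat[of P 0 m] Greatest_le_nat[of P _ m] by blast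
  obtain S S' where S: "S \<in> carrier_mat m m" "S' \<in> carrier_mat m m" "S * S' = 1\<^sub>m m" "S' * S = 1\<^sub>m m"
    "\<And>i. i < a \<Longrightarrow> col S i \<in> W" and am: "a \<le> m" using a(1) unfolding P_def by blast
  have fwd: "S *\<^sub>v v \<in> W" if v: "v \<in> carrier_vec m" "\<And>i. a \<le> i \<Longrightarrow> i < m \<Longrightarrow> v $ i = 0" for v
  proof -
    have "S *\<^sub>v vec m (\<lambda>i. if i < b then v $ i else 0) \<in> W" if "b \<le> a" for b
      using that
    proof (induction b)
      case 0
      have "S *\<^sub>v vec m (\<lambda>i. if i < 0 then v $ i else 0) = 0\<^sub>v m"
        using S(1) by (intro eq_vecI) (auto simp: scalar_prod_def)
      then show ?case using W(2) by simp
    next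
      case (Suc b)
      have b: "b < m" using Suc am by simp
      have "S *\<^sub>v vec m (\<lambda>i. if i < Suc b then v $ i else 0)
        = S *\<^sub>v vec m (\<lambda>i. if i < b then v $ i else 0) + v $ b \<cdot>\<^sub>v col S b"
      proof (rule eq_vecI)
        fix r assume "r < dim_vec (S *\<^sub>v vec m (\<lambda>i. if i < b then v $ i else 0) + v $ b \<cdot>\<^sub>v col S b)"
        then have r: "r < m" using S(1) by simp
        have "(\<Sum>i<m. S $$ (r, i) * (if i < Suc b then v $ i else 0))
          = (\<Sum>i<m. S $$ (r, i) * (if i < b then v $ i else 0) + (if i = b then S $$ (r, b) * v $ b else 0))"
          by (intro sum.cong) (auto simp: less_Suc_eq)
        then show "(S *\<^sub>v vec m (\<lambda>i. if i < Suc b then v $ i else 0)) $ r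
          = (S *\<^sub>v vec m (\<lambda>i. if i < b then v $ i else 0) + v $ b \<cdot>\<^sub>v col S b) $ r"
          using S(1) r b by (simp add: scalar_prod_def atLeast0LessThan sum.distrib mult.commute)
      qed (use S(1) in auto)
      then show ?case using W(3)[OF _ W(4)] Suc S(5)[of b] by simp
    qed
    from this[of a] have "S *\<^sub>v vec m (\<lambda>i. if i < a then v $ i else 0) \<in> W" by simp
    also have "vec m (\<lambda>i. if i < a then v $ i else 0) = v" using v by (intro eq_vecI) auto
    finally show ?thesis .
  qed
  have bwd: "v $ j = 0" if v: "v \<in> carrier_vec m" "S *\<^sub>v v \<in> W" and j: "a \<le> j" "j < m" for v j
  proof (rule ccontr)
    assume vj: "v $ j \<noteq> 0"
    \<comment> \<open>The exchange matrix: column a is v and, if j differs from a, column j is the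
      unit vector of index a; the other columns are those of the identity. It is invertible because
      v has a nonzero entry at j, and \<open>S * E\<close> keeps the first a columns of
      \<open>S\<close> and has S v in column a.\<close>
    define E where "E = mat m m (\<lambda>(r, c). if c = a then v $ r else if c = j then (if r = a then 1 else 0)
      else (if r = c then 1 else 0))"
    have E: "E \<in> carrier_mat m m" unfolding E_def by simp
    have Ex: "(E *\<^sub>v x) $ r = v $ r * x $ a + (if r = a \<and> j \<noteq> a then x $ j else 0) + (if r \<noteq> a \<and> r \<noteq> j then x $ r else 0)"
      if "r < m" "x \<in> carrier_vec m" for x r
    proof -
      have "(E *\<^sub>v x) $ r = (\<Sum>c<m. E $$ (r, c) * x $ c)"
        using that E by (simp add: scalar_prod_def atLeast0LessThan)
      also have "\<dots> = (\<Sum>c<m. (if c = a then v $ r * x $ a else 0) + (if c = j then (if r = a \<and> j \<noteq> a then x $ j else 0) else 0)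
         + (if c = r then (if r \<noteq> a \<and> r \<noteq> j then x $ r else 0) else 0))"
        using that by (intro sum.cong) (auto simp: E_def)
      also have "\<dots> = v $ r * x $ a + (if r = a \<and> j \<noteq> a then x $ j else 0) + (if r \<noteq> a \<and> r \<noteq> j then x $ r else 0)"
        using that j am by (simp add: sum.distrib)
      finally show ?thesis .
    qed
    obtain E' where E': "E' \<in> carrier_mat m m" "E * E' = 1\<^sub>m m" "E' * E = 1\<^sub>m m"
    proof (rule exists_inverse_mat[OF E])
      fix x assume x: "x \<in> carrier_vec m" "E *\<^sub>v x = 0\<^sub>v m"
      have e: "v $ r * x $ a + (if r = a \<and> j \<noteq> a then x $ j else 0) + (if r \<noteq> a \<and> r \<noteq> j then x $ r else 0) = 0"
        if "r < m" for r
        using Ex[OF that x(1)] x(2) that by simp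
      have xa: "x $ a = 0" using e[of j] j vj by (cases "j = a") auto
      show "x = 0\<^sub>v m"
      proof (rule eq_vecI)
        fix r assume "r < dim_vec (0\<^sub>v m :: 'a vec)"
        then have r: "r < m" by simp
        show "x $ r = 0\<^sub>v m $ r"
          using xa e[OF r] e[of a] r j am by (cases "r = a"; cases "r = j") auto
      qed (use x in simp)
    qed
    have SE: "col (S * E) i \<in> W" if "i < Suc a" for i
    proof (cases "i = a")
      case True
      have "col (S * E) a = S *\<^sub>v v"
        using S(1) E v(1) j by (intro eq_vecI) (auto simp: scalar_prod_def E_def)
      then show ?thesis using True v(2) by simp
    next
      case False
      then have i: "i < a" "i < m" "i \<noteq> j" using that j am by auto
      have "col E i = unit_vec m i" using i by (intro eq_vecI) (auto simp: E_def unit_vec_def)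
      then have "col (S * E) i = col S i"
        using S(1) E i by (intro eq_vecI) auto
      then show ?thesis using S(5) i by simp
    qed
    have "P (Suc a)"
      unfolding P_def
    proof (intro conjI exI allI impI)
      show "Suc a \<le> m" using j by simp
      show "S * E \<in> carrier_mat m m" "E' * S' \<in> carrier_mat m m" using S E E' by auto
      show "S * E * (E' * S') = 1\<^sub>m m"
        by (rule inverse_mat_mult[OF S(1,2) E E'(1) S(3) E'(2)])
      show "E' * S' * (S * E) = 1\<^sub>m m"
        by (rule inverse_mat_mult[OF E'(1) E S(2,1) E'(3) S(4)])
    qed (use SE in auto)
    then show False using a(2)[of "Suc a"] by simp
  qed
  show thesis using that[OF am S(1-4)] fwd bwd by blast
qed

section \<open>Continuity of matrix products and block triangular representations\<close>

lemma continuous_map_mult_complex: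
  fixes f g :: "'a \<Rightarrow> complex"
  assumes "continuous_map X euclidean f" "continuous_map X euclidean g"
  shows "continuous_map X euclidean (\<lambda>x. f x * g x)"
proof -
  have "continuous_map X (prod_topology euclidean euclidean) (\<lambda>x. (f x, g x))"
    using assms by (simp add: continuous_map_paired del: prod_topology_euclidean)
  moreover have "continuous_map euclidean euclidean (\<lambda>p :: complex \<times> complex. fst p * snd p)"
    by (simp add: continuous_on_mult continuous_on_fst continuous_on_snd)
  ultimately show ?thesis
    using continuous_map_compose[of X "prod_topology euclidean euclidean" "\<lambda>x. (f x, g x)" euclidean "\<lambda>p. fst p * snd p"]
    by (simp add: o_def)
qed

lemma continuous_map_prod_complex:
  fixes f :: "'i \<Rightarrow> 'a \<Rightarrow> complex"
  assumes "\<And>i. i \<in> I \<Longrightarrow> continuous_map X euclidean (f i)"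
  shows "continuous_map X euclidean (\<lambda>x. \<Prod>i\<in>I. f i x)"
  using assms
proof (induction I rule: infinite_finite_induct)
  case (insert i I)
  then show ?case by (simp add: continuous_map_mult_complex)
qed simp_all

lemma continuous_map_mult_mat:
  assumes A: "\<And>x. x \<in> topspace X \<Longrightarrow> A x \<in> carrier_mat m k" "\<And>i j. i < m \<Longrightarrow> j < k \<Longrightarrow> continuous_map X euclidean (\<lambda>x. A x $$ (i, j) :: complex)"
    and B: "\<And>x. x \<in> topspace X \<Longrightarrow> B x \<in> carrier_mat k n" "\<And>i j. i < k \<Longrightarrow> j < n \<Longrightarrow> continuous_map X euclidean (\<lambda>x. B x $$ (i, j) :: complex)"
    and ij: "i < m" "j < n"
  shows "continuous_map X euclidean (\<lambda>x. (A x * B x) $$ (i, j))"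
proof -
  have "continuous_map X euclidean (\<lambda>x. \<Sum>l<k. A x $$ (i, l) * B x $$ (l, j))"
    using A(2) B(2) ij by (intro continuous_map_sum continuous_map_mult_complex) auto
  then show ?thesis
    by (rule continuous_map_eq) (use A(1) B(1) ij in \<open>simp add: mat_mult_index[of _ m k _ n] del: index_mult_mat(1)\<close>)
qed

text \<open>In a basis adapted to \<open>W\<close> the lower left block vanishes, so the diagonal
  blocks are the subrepresentation and the quotient. The pair \<open>S\<close>, \<open>S'\<close> is
  the same for all g, which later allows linear combinations of the matrices to be conjugated at
  once.\<close>

lemma (in group) rep_blocks_if_invariant_subspace:
  assumes top: "topspace X = carrier G" and rep: "cont_rep G X m \<pi>" and inv: "invariant_subspace G m \<pi> W"
    and proper: "W \<noteq> {0\<^sub>v m}" "W \<noteq> carrier_vec m"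
  obtains a b A B D S S' where "0 < a" "0 < b" "a + b = m" "cont_rep G X a A" "cont_rep G X b D"
    "\<And>g. g \<in> carrier G \<Longrightarrow> B g \<in> carrier_mat a b"
    "\<And>g. g \<in> carrier G \<Longrightarrow> similar_mat_wit (\<pi> g) (four_block_mat (A g) (B g) (0\<^sub>m b a) (D g)) S S'"
proof -
  note R = cont_repD[OF rep]
  note W = inv[unfolded invariant_subspace_def]
  obtain a S S' where S: "a \<le> m" "S \<in> carrier_mat m m" "S' \<in> carrier_mat m m" "S * S' = 1\<^sub>m m" "S' * S = 1\<^sub>m m"
    "\<And>v. v \<in> carrier_vec m \<Longrightarrow> S *\<^sub>v v \<in> W \<longleftrightarrow> (\<forall>i. a \<le> i \<and> i < m \<longrightarrow> v $ i = 0)"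
    by (rule exists_adapted_basis[of W m]) (use W in blast)+
  have SS'v: "S *\<^sub>v (S' *\<^sub>v w) = w" if "w \<in> carrier_vec m" for w
  proof -
    have "S *\<^sub>v (S' *\<^sub>v w) = (S * S') *\<^sub>v w" by (rule assoc_mult_mat_vec[OF S(2,3) that, symmetric])
    then show ?thesis using S(4) that by simp
  qed
  have "a \<noteq> 0"
  proof
    assume a0: "a = 0"
    have "w = 0\<^sub>v m" if w: "w \<in> W" for w
    proof -
      have wc: "w \<in> carrier_vec m" using w W by auto
      have "S' *\<^sub>v w \<in> carrier_vec m" using S(3) wc by simp
      then have "S' *\<^sub>v w = 0\<^sub>v m" using S(6)[of "S' *\<^sub>v w"] SS'v[OF wc] w a0 S(3) by (intro eq_vecI) auto
      then have "S *\<^sub>v 0\<^sub>v m = w" using SS'v[OF wc] by simp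
      moreover have "S *\<^sub>v 0\<^sub>v m = 0\<^sub>v m" using S(2) by (intro eq_vecI) auto
      ultimately show ?thesis by simp
    qed
    then show False using proper(1) W by auto
  qed
  have "a \<noteq> m"
  proof
    assume am: "a = m"
    have "w \<in> W" if w: "w \<in> carrier_vec m" for w
      using S(6)[OF mult_mat_vec_carrier[OF S(3) w]] SS'v[OF w] am by auto
    then show False using proper(2) W by auto
  qed
  define b where "b = m - a"
  have ab: "a + b = m" "0 < a" "0 < b" using S(1) \<open>a \<noteq> 0\<close> \<open>a \<noteq> m\<close> unfolding b_def by auto
  define M where "M g = S' * \<pi> g * S" for g
  have Mc: "M g \<in> carrier_mat m m" if "g \<in> carrier G" for g
    using S R(1)[OF that] unfolding M_def by auto
  have Mmult: "M (g \<otimes> h) = M g * M h" if "g \<in> carrier G" "h \<in> carrier G" for g h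
  proof -
    note [simp] = R(1)[OF that(1)] R(1)[OF that(2)] S(2,3)
    have "M g * M h = S' * \<pi> g * (S * (S' * \<pi> h * S))"
      unfolding M_def by (rule assoc_mult_mat[of _ m m _ m _ m]) (auto intro!: mult_carrier_mat[of _ m m])
    also have "S * (S' * \<pi> h * S) = \<pi> h * S"
      by (rule mult_conj_inverse_mat[OF S(2,3) R(1)[OF that(2)] S(4)])
    also have "S' * \<pi> g * (\<pi> h * S) = S' * \<pi> g * \<pi> h * S"
      by (rule assoc_mult_mat[of _ m m _ m _ m, symmetric]) (auto intro!: mult_carrier_mat[of _ m m])
    also have "S' * \<pi> g * \<pi> h = S' * (\<pi> g * \<pi> h)"
      by (rule assoc_mult_mat[of _ m m _ m _ m]) auto
    finally show ?thesis unfolding M_def R(2)[OF that] by simp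
  qed
  have M1: "M \<one> = 1\<^sub>m m" unfolding M_def R(3) using S by simp
  have Mcont: "continuous_map X euclidean (\<lambda>g. M g $$ (i, j))" if "i < m" "j < m" for i j
    unfolding M_def using that S R top
    by (intro continuous_map_mult_mat[where k = m and m = m and n = m]) auto
  have pi_M: "\<pi> g = S * M g * S'" if "g \<in> carrier G" for g
  proof -
    note [simp] = R(1)[OF that] S(2,3)
    have "S * M g * S' = \<pi> g * S * S'"
      unfolding M_def mult_conj_inverse_mat[OF S(2,3) R(1)[OF that] S(4)] ..
    also have "\<dots> = \<pi> g * (S * S')"
      by (rule assoc_mult_mat[of _ m m _ m _ m]) auto
    finally show ?thesis using S(4) right_mult_one_mat[OF R(1)[OF that]] by simp
  qed
  have M0: "M g $$ (i, j) = 0" if g: "g \<in> carrier G" and ij: "a \<le> i" "i < m" "j < a" for g i j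
  proof -
    note [simp] = R(1)[OF g] S(2,3) Mc[OF g]
    let ?u = "unit_vec m j :: complex vec"
    have j: "j < m" using ij by simp
    have "S *\<^sub>v ?u \<in> W" using S(6)[of ?u] ij by auto
    then have "\<pi> g *\<^sub>v (S *\<^sub>v ?u) \<in> W" using W g by blast
    also have "\<pi> g *\<^sub>v (S *\<^sub>v ?u) = S *\<^sub>v (M g *\<^sub>v ?u)"
    proof -
      have "\<pi> g * S = S * M g"
        unfolding M_def mult_conj_inverse_mat[OF S(2,3) R(1)[OF g] S(4)] ..
      then show ?thesis by (simp flip: assoc_mult_mat_vec[of _ m m _ m])
    qed
    finally have "(M g *\<^sub>v ?u) $ i = 0" using S(6)[OF mult_mat_vec_carrier[OF Mc[OF g] unit_vec_carrier]] ij by blast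
    then show ?thesis using ij j carrier_matD[OF Mc[OF g]] by simp
  qed
  define A where "A g = mat a a (\<lambda>(i, j). M g $$ (i, j))" for g
  define B where "B g = mat a b (\<lambda>(i, j). M g $$ (i, a + j))" for g
  define D where "D g = mat b b (\<lambda>(i, j). M g $$ (a + i, a + j))" for g
  have Mblock: "M g = four_block_mat (A g) (B g) (0\<^sub>m b a) (D g)" if "g \<in> carrier G" for g
    using Mc[OF that] M0[OF that] ab by (intro eq_matI) (auto simp: A_def B_def D_def)
  have Midx: "M (g \<otimes> h) $$ (i, j) = (\<Sum>l<a. M g $$ (i, l) * M h $$ (l, j)) + (\<Sum>l<b. M g $$ (i, a + l) * M h $$ (a + l, j))"
    if "g \<in> carrier G" "h \<in> carrier G" "i < m" "j < m" for g h i j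
    unfolding Mmult[OF that(1,2)] using mat_mult_index[OF Mc[OF that(1)] Mc[OF that(2)] that(3,4)]
    by (simp add: sum_lessThan_add ab(1)[symmetric])
  have "cont_rep G X a A"
    unfolding cont_rep_def
  proof (intro conjI ballI allI impI)
    show "A \<one> = 1\<^sub>m a" using ab by (intro eq_matI) (auto simp: A_def M1)
    fix g h assume gh: "g \<in> carrier G" "h \<in> carrier G"
    show "A (g \<otimes> h) = A g * A h"
      using ab Midx[OF gh] M0[OF gh(2)] by (intro eq_matI) (auto simp: A_def scalar_prod_def atLeast0LessThan)
  next
    fix i j assume "i < a" "j < a"
    then show "continuous_map X euclidean (\<lambda>g. A g $$ (i, j))" using Mcont[of i j] ab by (simp add: A_def)
  qed (simp add: A_def)
  moreover have "cont_rep G X b D"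
    unfolding cont_rep_def
  proof (intro conjI ballI allI impI)
    show "D \<one> = 1\<^sub>m b" using ab by (intro eq_matI) (auto simp: D_def M1)
    fix g h assume gh: "g \<in> carrier G" "h \<in> carrier G"
    show "D (g \<otimes> h) = D g * D h"
      using ab Midx[OF gh] M0[OF gh(1)] by (intro eq_matI) (auto simp: D_def scalar_prod_def atLeast0LessThan)
  next
    fix i j assume "i < b" "j < b"
    then show "continuous_map X euclidean (\<lambda>g. D g $$ (i, j))" using Mcont[of "a + i" "a + j"] ab by (simp add: D_def)
  qed (simp add: D_def)
  moreover have "B g \<in> carrier_mat a b" for g unfolding B_def by simp
  moreover have "similar_mat_wit (\<pi> g) (four_block_mat (A g) (B g) (0\<^sub>m b a) (D g)) S S'" if "g \<in> carrier G" for g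
    using S R(1)[OF that] Mc[OF that] pi_M[OF that] unfolding Mblock[OF that, symmetric]
    by (intro similar_mat_witI[where n = m]) auto
  ultimately show thesis using that ab by blast
qed

text \<open>The image under \<pi> of the group algebra element with coefficient \<open>c s\<close>
  at \<open>y s\<close>. The separate index set admits repetitions, as different orderings of a
  tuple may have equal products.\<close>

definition group_alg_mat :: "nat \<Rightarrow> ('a \<Rightarrow> complex mat) \<Rightarrow> 'i set \<Rightarrow> ('i \<Rightarrow> complex) \<Rightarrow> ('i \<Rightarrow> 'a) \<Rightarrow> complex mat" where
  "group_alg_mat m \<pi> I c y = mat m m (\<lambda>(i, j). \<Sum>s\<in>I. c s * \<pi> (y s) $$ (i, j))"

lemma group_alg_mat_carrier [simp]: "group_alg_mat m \<pi> I c y \<in> carrier_mat m m"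
  unfolding group_alg_mat_def by simp

text \<open>Repeated splitting along invariant subspaces. Two shadows of a composition series are
  recorded: the characteristic polynomial, for every element of the group algebra at once, and the
  character. The index type is fixed for each use of the lemma: the one-point type for single group
  elements, a general type for alternating sums.\<close>

lemma (in group) exists_composition_factors:
  assumes top: "topspace X = carrier G" and rep: "cont_rep G X m \<pi>"
  shows "\<exists>Es. (\<forall>(e, E) \<in> set Es. irreducible_rep G X e E) \<and>
    (\<forall>(I :: 'i set) c y. y ` I \<subseteq> carrier G \<longrightarrow>
      char_poly (group_alg_mat m \<pi> I c y) = (\<Prod>(e, E)\<leftarrow>Es. char_poly (group_alg_mat e E I c y))) \<and>
    (\<forall>g\<in>carrier G. mat_trace (\<pi> g) = (\<Sum>(e, E)\<leftarrow>Es. mat_trace (E g)))"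
  using rep
proof (induction m arbitrary: \<pi> rule: less_induct)
  case (less m)
  note R = cont_repD[OF less.prems]
  consider "m = 0" | "m > 0" "irreducible_rep G X m \<pi>" | "m > 0" "\<not> irreducible_rep G X m \<pi>" by blast
  then show ?case
  proof cases
    case 1
    have "char_poly (group_alg_mat m \<pi> I c y) = 1" for I c and y :: "'i \<Rightarrow> 'a"
      using char_poly_factorized[OF group_alg_mat_carrier[of m \<pi> I c y]] 1 by auto
    moreover have "mat_trace (\<pi> g) = 0" if "g \<in> carrier G" for g
      using R(1)[OF that] 1 by (simp add: mat_trace_def)
    ultimately show ?thesis by (intro exI[of _ "[]"]) auto
  next
    case 2
    then show ?thesis by (intro exI[of _ "[(m, \<pi>)]"]) auto
  next
    case 3
    then obtain W where W: "invariant_subspace G m \<pi> W" "W \<noteq> {0\<^sub>v m}" "W \<noteq> carrier_vec m"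
      using less.prems unfolding irreducible_rep_def by blast
    obtain a b A B D S S' where ab: "0 < a" "0 < b" "a + b = m" and AD: "cont_rep G X a A" "cont_rep G X b D"
      and B: "\<And>g. g \<in> carrier G \<Longrightarrow> B g \<in> carrier_mat a b"
      and sim: "\<And>g. g \<in> carrier G \<Longrightarrow> similar_mat_wit (\<pi> g) (four_block_mat (A g) (B g) (0\<^sub>m b a) (D g)) S S'"
      using rep_blocks_if_invariant_subspace[OF top less.prems W] by metis
    note RA = cont_repD[OF AD(1)] and RD = cont_repD[OF AD(2)]
    obtain Es1 where E1: "\<forall>(e, E) \<in> set Es1. irreducible_rep G X e E"
      "\<And>(I :: 'i set) c y. y ` I \<subseteq> carrier G \<Longrightarrow>
        char_poly (group_alg_mat a A I c y) = (\<Prod>(e, E)\<leftarrow>Es1. char_poly (group_alg_mat e E I c y))"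
      "\<And>g. g \<in> carrier G \<Longrightarrow> mat_trace (A g) = (\<Sum>(e, E)\<leftarrow>Es1. mat_trace (E g))"
      using less.IH[of a A] ab AD by auto
    obtain Es2 where E2: "\<forall>(e, E) \<in> set Es2. irreducible_rep G X e E"
      "\<And>(I :: 'i set) c y. y ` I \<subseteq> carrier G \<Longrightarrow>
        char_poly (group_alg_mat b D I c y) = (\<Prod>(e, E)\<leftarrow>Es2. char_poly (group_alg_mat e E I c y))"
      "\<And>g. g \<in> carrier G \<Longrightarrow> mat_trace (D g) = (\<Sum>(e, E)\<leftarrow>Es2. mat_trace (E g))"
      using less.IH[of b D] ab AD by auto
    define M where "M g = four_block_mat (A g) (B g) (0\<^sub>m b a) (D g)" for g
    have Mc: "M g \<in> carrier_mat m m" if "g \<in> carrier G" for g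
      using four_block_carrier_mat[OF RA(1)[OF that] RD(1)[OF that]] ab unfolding M_def by auto
    have S: "S \<in> carrier_mat m m" "S' \<in> carrier_mat m m" "S * S' = 1\<^sub>m m" "S' * S = 1\<^sub>m m"
      using similar_mat_witD2[OF R(1)[OF one_closed] sim[OF one_closed]] by auto
    have piM: "\<pi> g = S * M g * S'" if "g \<in> carrier G" for g
      using similar_mat_witD2[OF R(1)[OF that] sim[OF that]] unfolding M_def by auto
    have cp: "char_poly (group_alg_mat m \<pi> I c y) = char_poly (group_alg_mat a A I c y) * char_poly (group_alg_mat b D I c y)"
      if y: "y ` I \<subseteq> carrier G" for I :: "'i set" and c y
    proof -
      \<comment> \<open>The conjugating matrices do not depend on the group element, so they pass
        through the linear combination.\<close>
      have "group_alg_mat m \<pi> I c y = S * group_alg_mat m M I c y * S'" (is "_ = S * ?N * S'")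
      proof (rule eq_matI)
        fix i j assume "i < dim_row (S * ?N * S')" "j < dim_col (S * ?N * S')"
        then have ij: "i < m" "j < m" using S by auto
        have idx: "(S * N * S') $$ (i, j) = (\<Sum>l<m. \<Sum>k<m. S $$ (i, k) * N $$ (k, l) * S' $$ (l, j))"
          if N: "N \<in> carrier_mat m m" for N
        proof -
          have "S * N \<in> carrier_mat m m" using S N by simp
          then have "(S * N * S') $$ (i, j) = (\<Sum>l<m. (S * N) $$ (i, l) * S' $$ (l, j))"
            using S ij by (intro mat_mult_index)
          also have "\<dots> = (\<Sum>l<m. (\<Sum>k<m. S $$ (i, k) * N $$ (k, l)) * S' $$ (l, j))"
            using S N ij by (intro sum.cong) (simp_all add: mat_mult_index[of _ m m _ m] del: index_mult_mat(1))
          finally show ?thesis by (simp add: sum_distrib_right)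
        qed
        have "group_alg_mat m \<pi> I c y $$ (i, j) = (\<Sum>s\<in>I. c s * (S * M (y s) * S') $$ (i, j))"
          using ij y piM by (auto simp: group_alg_mat_def intro!: sum.cong)
        also have "\<dots> = (\<Sum>s\<in>I. c s * (\<Sum>l<m. \<Sum>k<m. S $$ (i, k) * M (y s) $$ (k, l) * S' $$ (l, j)))"
          using y Mc idx by (intro sum.cong) auto
        also have "\<dots> = (\<Sum>s\<in>I. \<Sum>l<m. \<Sum>k<m. S $$ (i, k) * (c s * M (y s) $$ (k, l)) * S' $$ (l, j))"
          by (simp add: sum_distrib_left mult_ac)
        also have "\<dots> = (\<Sum>l<m. \<Sum>k<m. \<Sum>s\<in>I. S $$ (i, k) * (c s * M (y s) $$ (k, l)) * S' $$ (l, j))"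
          by (subst sum.swap, rule sum.cong[OF refl], subst sum.swap) simp
        also have "\<dots> = (\<Sum>l<m. \<Sum>k<m. S $$ (i, k) * ?N $$ (k, l) * S' $$ (l, j))"
          by (simp add: group_alg_mat_def sum_distrib_left sum_distrib_right)
        finally show "group_alg_mat m \<pi> I c y $$ (i, j) = (S * ?N * S') $$ (i, j)"
          by (simp add: idx)
      qed (use S in \<open>auto simp: group_alg_mat_def\<close>)
      then have "similar_mat_wit (group_alg_mat m \<pi> I c y) ?N S S'"
        using S by (intro similar_mat_witI[where n = m]) auto
      then have "char_poly (group_alg_mat m \<pi> I c y) = char_poly ?N"
        by (intro char_poly_similar) (auto simp: similar_mat_def)
      also have "?N = four_block_mat (group_alg_mat a A I c y) (mat a b (\<lambda>(i, j). \<Sum>s\<in>I. c s * B (y s) $$ (i, j)))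
        (0\<^sub>m b a) (group_alg_mat b D I c y)" (is "_ = ?F")
      proof (rule eq_matI)
        fix i j assume "i < dim_row ?F" "j < dim_col ?F"
        then have ij: "i < a + b" "j < a + b" by (auto simp: group_alg_mat_def)
        have *: "A (y s) \<in> carrier_mat a a" "B (y s) \<in> carrier_mat a b" "D (y s) \<in> carrier_mat b b" if "s \<in> I" for s
          using that y RA(1) RD(1) B by auto
        have "?N $$ (i, j) = (\<Sum>s\<in>I. c s * (if i < a then if j < a then A (y s) $$ (i, j) else B (y s) $$ (i, j - a)
            else if j < a then 0 else D (y s) $$ (i - a, j - a)))"
          using ij ab(3) unfolding group_alg_mat_def M_def
          by (simp, intro sum.cong refl) (use * in \<open>force simp: index_mat_four_block\<close>)
        then show "?N $$ (i, j) = ?F $$ (i, j)"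
          using ij by (auto simp: group_alg_mat_def)
      qed (use ab in \<open>auto simp: group_alg_mat_def\<close>)
      also have "char_poly \<dots> = char_poly (group_alg_mat a A I c y) * char_poly (group_alg_mat b D I c y)"
        by (rule char_poly_0_block[OF refl _ _ group_alg_mat_carrier _ group_alg_mat_carrier])
          (use char_poly_factorized[OF group_alg_mat_carrier] in blast, use char_poly_factorized[OF group_alg_mat_carrier] in blast, simp)
      finally show ?thesis .
    qed
    have tr: "mat_trace (\<pi> g) = mat_trace (A g) + mat_trace (D g)" if g: "g \<in> carrier G" for g
    proof -
      have "mat_trace (\<pi> g) = mat_trace (M g)"
        using mat_trace_similar[OF sim[OF g]] unfolding M_def .
      also have "\<dots> = mat_trace (A g) + mat_trace (D g)"
        using RA(1)[OF g] RD(1)[OF g] unfolding M_def mat_trace_def by (simp add: sum_lessThan_add)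
      finally show ?thesis .
    qed
    show ?thesis
      using E1 E2 cp tr by (intro exI[of _ "Es1 @ Es2"]) auto
  qed
qed

subsection \<open>Tensor powers and twisted characters\<close>

text \<open>Tensor products have bases indexed by pairs or by functions, while representations are
  matrices indexed by numbers; an enumeration \<open>b\<close> of the basis mediates.\<close>

lemma (in group) cont_rep_of_finite_index_set:
  fixes R :: "'a \<Rightarrow> 'i \<Rightarrow> 'i \<Rightarrow> complex"
  assumes fin: "finite I" and bij: "bij_betw b {..<card I} I"
    and mult: "\<And>g h p q. g \<in> carrier G \<Longrightarrow> h \<in> carrier G \<Longrightarrow> p \<in> I \<Longrightarrow> q \<in> I \<Longrightarrow>
      R (g \<otimes> h) p q = (\<Sum>r\<in>I. R g p r * R h r q)"
    and one: "\<And>p q. p \<in> I \<Longrightarrow> q \<in> I \<Longrightarrow> R \<one> p q = (if p = q then 1 else 0)"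
    and cont: "\<And>p q. p \<in> I \<Longrightarrow> q \<in> I \<Longrightarrow> continuous_map X euclidean (\<lambda>g. R g p q)"
  shows "cont_rep G X (card I) (\<lambda>g. mat (card I) (card I) (\<lambda>(i, j). R g (b i) (b j)))"
proof -
  have b: "b i \<in> I" if "i < card I" for i using bij that by (auto simp: bij_betw_def)
  have beq: "b i = b j \<longleftrightarrow> i = j" if "i < card I" "j < card I" for i j
    using bij that by (auto simp: bij_betw_def inj_on_def)
  show ?thesis
    unfolding cont_rep_def
  proof (intro conjI ballI allI impI)
    fix g h assume gh: "g \<in> carrier G" "h \<in> carrier G"
    show "mat (card I) (card I) (\<lambda>(i, j). R (g \<otimes> h) (b i) (b j)) =
      mat (card I) (card I) (\<lambda>(i, j). R g (b i) (b j)) * mat (card I) (card I) (\<lambda>(i, j). R h (b i) (b j))"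
    proof (rule eq_matI)
      fix i j assume "i < dim_row (mat (card I) (card I) (\<lambda>(i, j). R g (b i) (b j)) * mat (card I) (card I) (\<lambda>(i, j). R h (b i) (b j)))"
        "j < dim_col (mat (card I) (card I) (\<lambda>(i, j). R g (b i) (b j)) * mat (card I) (card I) (\<lambda>(i, j). R h (b i) (b j)))"
      then have ij: "i < card I" "j < card I" by auto
      have "R (g \<otimes> h) (b i) (b j) = (\<Sum>l<card I. R g (b i) (b l) * R h (b l) (b j))"
        using mult[OF gh b[OF ij(1)] b[OF ij(2)]] sum.reindex_bij_betw[OF bij, of "\<lambda>r. R g (b i) r * R h r (b j)"]
        by simp
      then show "mat (card I) (card I) (\<lambda>(i, j). R (g \<otimes> h) (b i) (b j)) $$ (i, j) =
        (mat (card I) (card I) (\<lambda>(i, j). R g (b i) (b j)) * mat (card I) (card I) (\<lambda>(i, j). R h (b i) (b j))) $$ (i, j)"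
        using ij by (simp add: scalar_prod_def atLeast0LessThan)
    qed simp_all
  next
    show "mat (card I) (card I) (\<lambda>(i, j). R \<one> (b i) (b j)) = 1\<^sub>m (card I)"
      using one b beq by (intro eq_matI) auto
  qed (use b cont in auto)
qed

text \<open>The trace of g weighted by an endomorphism \<open>T\<close> of the representation. With
  \<open>T\<close> the identity this is an ordinary character; with a cyclic shift of tensor factors
  it is the trace of a power.\<close>

definition twisted_char :: "('a, 'b) monoid_scheme \<Rightarrow> 'a topology \<Rightarrow> ('a \<Rightarrow> complex) \<Rightarrow> bool" where
  "twisted_char G X f \<longleftrightarrow> (\<exists>m \<pi> T. cont_rep G X m \<pi> \<and> T \<in> carrier_mat m m \<and>
    (\<forall>g\<in>carrier G. \<pi> g * T = T * \<pi> g \<and> f g = mat_trace (\<pi> g * T)))"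

lemma (in group) twisted_char_of_finite_index_set:
  fixes R :: "'a \<Rightarrow> 'i \<Rightarrow> 'i \<Rightarrow> complex"
  assumes fin: "finite I"
    and mult: "\<And>g h p q. g \<in> carrier G \<Longrightarrow> h \<in> carrier G \<Longrightarrow> p \<in> I \<Longrightarrow> q \<in> I \<Longrightarrow>
      R (g \<otimes> h) p q = (\<Sum>r\<in>I. R g p r * R h r q)"
    and one: "\<And>p q. p \<in> I \<Longrightarrow> q \<in> I \<Longrightarrow> R \<one> p q = (if p = q then 1 else 0)"
    and cont: "\<And>p q. p \<in> I \<Longrightarrow> q \<in> I \<Longrightarrow> continuous_map X euclidean (\<lambda>g. R g p q)"
    and T: "\<And>g p q. g \<in> carrier G \<Longrightarrow> p \<in> I \<Longrightarrow> q \<in> I \<Longrightarrow> (\<Sum>r\<in>I. R g p r * T r q) = (\<Sum>r\<in>I. T p r * R g r q)"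
    and f: "\<And>g. g \<in> carrier G \<Longrightarrow> f g = (\<Sum>p\<in>I. \<Sum>r\<in>I. R g p r * T r p)"
  shows "twisted_char G X f"
proof -
  obtain b where bij: "bij_betw b {..<card I} I"
    using ex_bij_betw_nat_finite[OF fin] by (auto simp: atLeast0LessThan)
  have b: "b i \<in> I" if "i < card I" for i using bij that by (auto simp: bij_betw_def)
  let ?\<pi> = "\<lambda>g. mat (card I) (card I) (\<lambda>(i, j). R g (b i) (b j))"
  let ?T = "mat (card I) (card I) (\<lambda>(i, j). T (b i) (b j))"
  note re = sum.reindex_bij_betw[OF bij]
  have idx1: "(?\<pi> g * ?T) $$ (i, j) = (\<Sum>r\<in>I. R g (b i) r * T r (b j))" if "i < card I" "j < card I" for g i j
    using that re[of "\<lambda>r. R g (b i) r * T r (b j)"] by (simp add: scalar_prod_def atLeast0LessThan)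
  have idx2: "(?T * ?\<pi> g) $$ (i, j) = (\<Sum>r\<in>I. T (b i) r * R g r (b j))" if "i < card I" "j < card I" for g i j
    using that re[of "\<lambda>r. T (b i) r * R g r (b j)"] by (simp add: scalar_prod_def atLeast0LessThan)
  show ?thesis
    unfolding twisted_char_def
  proof (intro exI conjI ballI)
    show "cont_rep G X (card I) ?\<pi>" by (rule cont_rep_of_finite_index_set[OF fin bij mult one cont])
    show "?T \<in> carrier_mat (card I) (card I)" by simp
    fix g assume g: "g \<in> carrier G"
    show "?\<pi> g * ?T = ?T * ?\<pi> g"
      using T[OF g b b] by (intro eq_matI) (simp_all add: idx1 idx2 del: index_mult_mat(1))
    have "mat_trace (?\<pi> g * ?T) = (\<Sum>i<card I. \<Sum>r\<in>I. R g (b i) r * T r (b i))"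
      unfolding mat_trace_def by (simp add: idx1 del: index_mult_mat(1))
    also have "\<dots> = f g" unfolding f[OF g] using re[of "\<lambda>p. \<Sum>r\<in>I. R g p r * T r p"] by simp
    finally show "f g = mat_trace (?\<pi> g * ?T)" by simp
  qed
qed

lemma (in group) twisted_char_one: "twisted_char G X (\<lambda>_. 1)"
proof -
  have "cont_rep G X 1 (\<lambda>_. 1\<^sub>m 1)" unfolding cont_rep_def by auto
  then show ?thesis
    unfolding twisted_char_def
    by (intro exI[of _ "1 :: nat"] exI[of _ "\<lambda>_. 1\<^sub>m 1"] exI[of _ "1\<^sub>m 1"]) (auto simp: mat_trace_def)
qed

text \<open>The product is realized on the tensor product of the two representations, with the
  Kronecker product of \<open>S\<close> and \<open>T\<close> as the commuting matrix.\<close>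

lemma (in group) twisted_char_mult:
  assumes "twisted_char G X f1" "twisted_char G X f2"
  shows "twisted_char G X (\<lambda>g. f1 g * f2 g)"
proof -
  obtain m \<pi> S where 1: "cont_rep G X m \<pi>" "S \<in> carrier_mat m m"
    "\<And>g. g \<in> carrier G \<Longrightarrow> \<pi> g * S = S * \<pi> g" "\<And>g. g \<in> carrier G \<Longrightarrow> f1 g = mat_trace (\<pi> g * S)"
    using assms(1) unfolding twisted_char_def by blast
  obtain n \<rho> T where 2: "cont_rep G X n \<rho>" "T \<in> carrier_mat n n"
    "\<And>g. g \<in> carrier G \<Longrightarrow> \<rho> g * T = T * \<rho> g" "\<And>g. g \<in> carrier G \<Longrightarrow> f2 g = mat_trace (\<rho> g * T)"
    using assms(2) unfolding twisted_char_def by blast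
  note P = cont_repD[OF 1(1)] and Q = cont_repD[OF 2(1)]
  define I where "I = {..<m} \<times> {..<n}"
  \<comment> \<open>The mixed product rule in coordinates: a product of Kronecker products is the
    Kronecker product of the products.\<close>
  have split: "(\<Sum>r\<in>I. (A $$ (i, fst r) * B $$ (j, snd r)) * (A' $$ (fst r, k) * B' $$ (snd r, l)))
      = (A * A') $$ (i, k) * (B * B') $$ (j, l)"
    if "A \<in> carrier_mat m m" "A' \<in> carrier_mat m m" "B \<in> carrier_mat n n" "B' \<in> carrier_mat n n"
      "i < m" "k < m" "j < n" "l < n" for A A' B B' :: "complex mat" and i j k l
    unfolding mat_mult_index[OF that(1,2,5,6)] mat_mult_index[OF that(3,4,7,8)] I_def sum_product
      sum.cartesian_product'
    by (simp add: mult_ac)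
  show ?thesis
  proof (rule twisted_char_of_finite_index_set[of I "\<lambda>g p q. \<pi> g $$ (fst p, fst q) * \<rho> g $$ (snd p, snd q)" X
      "\<lambda>p q. S $$ (fst p, fst q) * T $$ (snd p, snd q)"])
    show "finite I" unfolding I_def by simp
  next
    fix g h p q assume "g \<in> carrier G" "h \<in> carrier G" "p \<in> I" "q \<in> I"
    then show "\<pi> (g \<otimes> h) $$ (fst p, fst q) * \<rho> (g \<otimes> h) $$ (snd p, snd q) =
      (\<Sum>r\<in>I. \<pi> g $$ (fst p, fst r) * \<rho> g $$ (snd p, snd r) * (\<pi> h $$ (fst r, fst q) * \<rho> h $$ (snd r, snd q)))"
      by (subst split) (auto simp: P Q I_def simp del: index_mult_mat(1))
  next
    fix p q assume "p \<in> I" "q \<in> I"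
    then show "\<pi> \<one> $$ (fst p, fst q) * \<rho> \<one> $$ (snd p, snd q) = (if p = q then 1 else 0)"
      by (auto simp: P Q I_def prod_eq_iff)
  next
    fix p q assume "p \<in> I" "q \<in> I"
    then show "continuous_map X euclidean (\<lambda>g. \<pi> g $$ (fst p, fst q) * \<rho> g $$ (snd p, snd q))"
      using P(4) Q(4) by (intro continuous_map_mult_complex) (auto simp: I_def)
  next
    fix g p q assume g: "g \<in> carrier G" and pq: "p \<in> I" "q \<in> I"
    have pq': "fst p < m" "fst q < m" "snd p < n" "snd q < n" using pq unfolding I_def by auto
    show "(\<Sum>r\<in>I. \<pi> g $$ (fst p, fst r) * \<rho> g $$ (snd p, snd r) * (S $$ (fst r, fst q) * T $$ (snd r, snd q))) =
      (\<Sum>r\<in>I. S $$ (fst p, fst r) * T $$ (snd p, snd r) * (\<pi> g $$ (fst r, fst q) * \<rho> g $$ (snd r, snd q)))"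
      unfolding split[OF P(1)[OF g] 1(2) Q(1)[OF g] 2(2) pq'] split[OF 1(2) P(1)[OF g] 2(2) Q(1)[OF g] pq']
      unfolding 1(3)[OF g] 2(3)[OF g] ..
  next
    fix g assume g: "g \<in> carrier G"
    have "(\<Sum>p\<in>I. \<Sum>r\<in>I. \<pi> g $$ (fst p, fst r) * \<rho> g $$ (snd p, snd r) * (S $$ (fst r, fst p) * T $$ (snd r, snd p)))
      = (\<Sum>p\<in>I. (\<pi> g * S) $$ (fst p, fst p) * (\<rho> g * T) $$ (snd p, snd p))"
      using P(1)[OF g] Q(1)[OF g] 1(2) 2(2) by (intro sum.cong refl split) (auto simp: I_def)
    also have "\<dots> = f1 g * f2 g"
      using P(1)[OF g] Q(1)[OF g] 1(2) 2(2) unfolding 1(4)[OF g] 2(4)[OF g] mat_trace_def I_def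
      by (simp add: sum_product sum.cartesian_product' del: index_mult_mat(1))
    finally show "f1 g * f2 g = (\<Sum>p\<in>I. \<Sum>r\<in>I. \<pi> g $$ (fst p, fst r) * \<rho> g $$ (snd p, snd r) *
      (S $$ (fst r, fst p) * T $$ (snd r, snd p)))" by simp
  qed
qed

section \<open>Tensor powers in coordinates\<close>

definition tensor_index :: "nat \<Rightarrow> nat \<Rightarrow> (nat \<Rightarrow> nat) set" where
  "tensor_index m k = PiE {..<k} (\<lambda>_. {..<m})"

text \<open>An entry of the k-th Kronecker power of \<open>A\<close>; p and q name basis tensors by
  listing the basis vector in each factor.\<close>

definition tensor_entry :: "nat \<Rightarrow> complex mat \<Rightarrow> (nat \<Rightarrow> nat) \<Rightarrow> (nat \<Rightarrow> nat) \<Rightarrow> complex" where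
  "tensor_entry k A p q = (\<Prod>t<k. A $$ (p t, q t))"

lemma finite_tensor_index [simp]: "finite (tensor_index m k)"
  unfolding tensor_index_def by (simp add: finite_PiE)

lemma tensor_indexD: "p \<in> tensor_index m k \<Longrightarrow> t < k \<Longrightarrow> p t < m"
  unfolding tensor_index_def by auto

lemma tensor_entry_mult:
  assumes "A \<in> carrier_mat m m" "B \<in> carrier_mat m m" "p \<in> tensor_index m k" "q \<in> tensor_index m k"
  shows "tensor_entry k (A * B) p q = (\<Sum>r\<in>tensor_index m k. tensor_entry k A p r * tensor_entry k B r q)"
proof -
  have "tensor_entry k (A * B) p q = (\<Prod>t<k. \<Sum>l<m. A $$ (p t, l) * B $$ (l, q t))"
    using assms(3,4) unfolding tensor_entry_def
    by (intro prod.cong refl mat_mult_index[OF assms(1,2)]) (auto dest: tensor_indexD)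
  also have "\<dots> = (\<Sum>r\<in>tensor_index m k. \<Prod>t<k. A $$ (p t, r t) * B $$ (r t, q t))"
    unfolding tensor_index_def by (rule prod_sum_PiE) auto
  finally show ?thesis by (simp add: tensor_entry_def prod.distrib)
qed

lemma tensor_entry_one:
  assumes "p \<in> tensor_index m k" "q \<in> tensor_index m k"
  shows "tensor_entry k (1\<^sub>m m) p q = (if p = q then 1 else 0)"
proof -
  have "tensor_entry k (1\<^sub>m m) p q = (\<Prod>t<k. if p t = q t then 1 else 0)"
    using tensor_indexD[OF assms(1)] tensor_indexD[OF assms(2)]
    unfolding tensor_entry_def by (intro prod.cong) auto
  moreover have "p = q" if "\<forall>t<k. p t = q t"
    using assms that unfolding tensor_index_def by (intro PiE_ext) auto
  ultimately show ?thesis by (auto simp: prod_zero_iff)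
qed

lemma sum_tensor_entry_diag: "(\<Sum>p\<in>tensor_index m k. tensor_entry k A p p) = (\<Sum>i<m. A $$ (i, i)) ^ k"
  using prod_sum_PiE[of "{..<k}" "\<lambda>_. {..<m}" "\<lambda>_ i. A $$ (i, i)"]
  unfolding tensor_index_def tensor_entry_def by simp

lemma continuous_map_tensor_entry:
  assumes "cont_rep G X m \<pi>" "p \<in> tensor_index m k" "q \<in> tensor_index m k"
  shows "continuous_map X euclidean (\<lambda>g. tensor_entry k (\<pi> g) p q)"
  unfolding tensor_entry_def
  using assms(2,3) by (intro continuous_map_prod_complex cont_repD(4)[OF assms(1)]) (auto dest: tensor_indexD)

text \<open>The enumeration \<open>b\<close> is exported along with the representation because
  unipotency on the tensor power is checked entry by entry.\<close>

lemma (in group) tensor_power_rep: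
  assumes rep: "cont_rep G X m \<pi>"
  obtains M \<tau> b where "cont_rep G X M \<tau>" "\<And>i. i < M \<Longrightarrow> b i \<in> tensor_index m k"
    "\<And>g i j. i < M \<Longrightarrow> j < M \<Longrightarrow> \<tau> g $$ (i, j) = tensor_entry k (\<pi> g) (b i) (b j)"
    "\<And>g. g \<in> carrier G \<Longrightarrow> mat_trace (\<tau> g) = mat_trace (\<pi> g) ^ k"
proof -
  let ?I = "tensor_index m k"
  obtain b where bij: "bij_betw b {..<card ?I} ?I"
    using ex_bij_betw_nat_finite[of ?I] by (auto simp: atLeast0LessThan)
  define \<tau> where "\<tau> = (\<lambda>g. mat (card ?I) (card ?I) (\<lambda>(i, j). tensor_entry k (\<pi> g) (b i) (b j)))"
  note R = cont_repD[OF rep]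
  have "cont_rep G X (card ?I) \<tau>"
    unfolding \<tau>_def
  proof (rule cont_rep_of_finite_index_set[OF _ bij])
    show "tensor_entry k (\<pi> (g \<otimes> h)) p q = (\<Sum>r\<in>?I. tensor_entry k (\<pi> g) p r * tensor_entry k (\<pi> h) r q)"
      if "g \<in> carrier G" "h \<in> carrier G" "p \<in> ?I" "q \<in> ?I" for g h p q
      using that R by (simp add: tensor_entry_mult)
  qed (use R tensor_entry_one continuous_map_tensor_entry[OF rep] in auto)
  moreover have "mat_trace (\<tau> g) = mat_trace (\<pi> g) ^ k" if "g \<in> carrier G" for g
    using sum_tensor_entry_diag[where m = m and k = k and A = "\<pi> g"] R(1)[OF that] sum.reindex_bij_betw[OF bij, of "\<lambda>p. tensor_entry k (\<pi> g) p p"]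
    by (simp add: mat_trace_def \<tau>_def)
  ultimately show thesis
    using that[of "card ?I" \<tau> b] bij unfolding \<tau>_def bij_betw_def by auto
qed

lemma sum_PiE_insert:
  assumes "x \<notin> S"
  shows "(\<Sum>p\<in>PiE (insert x S) (\<lambda>_. B). f p) = (\<Sum>p\<in>PiE S (\<lambda>_. B). \<Sum>j\<in>B. f (p(x := j)))"
proof -
  have inj: "inj_on (\<lambda>(y, g). g(x := y)) (B \<times> PiE S (\<lambda>_. B))"
    using inj_combinator[OF assms, of "\<lambda>_. B"] by simp
  have "(\<Sum>p\<in>PiE (insert x S) (\<lambda>_. B). f p) = (\<Sum>(y, g)\<in>B \<times> PiE S (\<lambda>_. B). f (g(x := y)))"
    unfolding PiE_insert_eq using sum.reindex[OF inj, of f] by (simp add: case_prod_unfold o_def)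
  also have "\<dots> = (\<Sum>y\<in>B. \<Sum>g\<in>PiE S (\<lambda>_. B). f (g(x := y)))"
    by (rule sum.cartesian_product[symmetric])
  also have "\<dots> = (\<Sum>p\<in>PiE S (\<lambda>_. B). \<Sum>j\<in>B. f (p(x := j)))"
    by (rule sum.swap)
  finally show ?thesis .
qed

text \<open>The entries of a product of k matrices are sums over paths with k steps. The weight
  \<open>f\<close> on the end points has two uses: it closes the path to a cycle for the trace of a
  power, and it selects a single entry for the standard identity.\<close>

lemma sum_mat_product_eq_sum_paths:
  fixes A P :: "nat \<Rightarrow> complex mat"
  assumes A: "\<And>t. t < k \<Longrightarrow> A t \<in> carrier_mat m m" and P: "P 0 = 1\<^sub>m m" "\<And>t. t < k \<Longrightarrow> P (Suc t) = P t * A t"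
  shows "(\<Sum>i<m. \<Sum>j<m. f i j * P k $$ (i, j)) =
    (\<Sum>p\<in>PiE {..k} (\<lambda>_. {..<m}). f (p 0) (p k) * (\<Prod>t<k. A t $$ (p t, p (Suc t))))"
  using assms
proof (induction k arbitrary: f)
  case 0
  have "(\<Sum>p\<in>PiE {..0 :: nat} (\<lambda>_. {..<m}). f (p 0) (p 0)) = (\<Sum>j<m. f j j)"
    unfolding atMost_0 using sum_PiE_insert[of "0 :: nat" "{}" "\<lambda>p. f (p 0) (p 0)" "{..<m}"] by simp
  moreover have "(\<Sum>i<m. \<Sum>j<m. f i j * 1\<^sub>m m $$ (i, j)) = (\<Sum>i<m. \<Sum>j<m. if j = i then f i i else 0)"
    by (intro sum.cong) auto
  ultimately show ?case using 0 by simp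
next
  case (Suc k)
  have Pk: "P t \<in> carrier_mat m m" if "t \<le> Suc k" for t
    using that
  proof (induction t)
    case (Suc t)
    then show ?case using Suc.prems Suc.IH \<open>\<And>t. t < Suc k \<Longrightarrow> A t \<in> carrier_mat m m\<close>
        \<open>\<And>t. t < Suc k \<Longrightarrow> P (Suc t) = P t * A t\<close> by simp
  qed (simp add: Suc.prems)
  have "(\<Sum>i<m. \<Sum>j<m. f i j * P (Suc k) $$ (i, j))
      = (\<Sum>i<m. \<Sum>j<m. \<Sum>l<m. f i j * (P k $$ (i, l) * A k $$ (l, j)))"
    using Suc.prems Pk[of k] by (simp add: mat_mult_index[of _ m m _ m] sum_distrib_left del: index_mult_mat(1))
  \<comment> \<open>The last factor is absorbed into a new weight on the end points, to which the
    induction hypothesis applies.\<close>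
  also have "\<dots> = (\<Sum>i<m. \<Sum>l<m. (\<Sum>j<m. f i j * A k $$ (l, j)) * P k $$ (i, l))"
    by (rule sum.cong[OF refl], subst sum.swap) (simp add: sum_distrib_left sum_distrib_right mult_ac)
  also have "\<dots> = (\<Sum>p\<in>PiE {..k} (\<lambda>_. {..<m}). (\<Sum>j<m. f (p 0) j * A k $$ (p k, j)) * (\<Prod>t<k. A t $$ (p t, p (Suc t))))"
    by (rule Suc.IH) (use Suc.prems in auto)
  also have "\<dots> = (\<Sum>p\<in>PiE {..k} (\<lambda>_. {..<m}). \<Sum>j<m. (\<lambda>p. f (p 0) (p (Suc k)) * (\<Prod>t<Suc k. A t $$ (p t, p (Suc t)))) (p(Suc k := j)))"
    by (intro sum.cong refl) (simp add: sum_distrib_left sum_distrib_right mult_ac)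
  also have "\<dots> = (\<Sum>p\<in>PiE {..Suc k} (\<lambda>_. {..<m}). f (p 0) (p (Suc k)) * (\<Prod>t<Suc k. A t $$ (p t, p (Suc t))))"
    unfolding atMost_Suc by (rule sum_PiE_insert[symmetric]) simp
  finally show ?case .
qed

text \<open>Permuting the tensor factors cyclically commutes with the tensor power and turns the trace of
  \<open>A \<otimes> \<dots> \<otimes> A\<close> into the trace of the \<open>k\<close>-th power of \<open>A\<close>.\<close>
lemma (in group) twisted_char_mat_trace_pow:
  assumes rep: "cont_rep G X m \<pi>" and k: "k \<ge> 1"
  shows "twisted_char G X (\<lambda>g. mat_trace (\<pi> g ^\<^sub>m k))"
proof -
  note R = cont_repD[OF rep]
  let ?I = "tensor_index m k"
  obtain k' where k': "k = Suc k'" using k by (cases k) auto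
  define cyc where "cyc t = Suc t mod k" for t
  define sh where "sh p = restrict (\<lambda>t. p (cyc t)) {..<k}" for p :: "nat \<Rightarrow> nat"
  have cyc_less: "cyc t < k" for t using k unfolding cyc_def by simp
  have cyc_inj: "inj_on cyc {..<k}"
  proof (rule inj_onI)
    fix s t assume "s \<in> {..<k}" "t \<in> {..<k}" "cyc s = cyc t"
    then show "s = t" unfolding cyc_def mod_Suc by (auto split: if_splits)
  qed
  then have cyc: "bij_betw cyc {..<k} {..<k}"
    using endo_inj_surj[of "{..<k}" cyc] cyc_less unfolding bij_betw_def by auto
  have sh_mem: "sh p \<in> ?I" if "p \<in> ?I" for p
    using that cyc_less unfolding sh_def tensor_index_def by auto
  have sh_inj: "inj_on sh ?I"
  proof (rule inj_onI)
    fix p q assume pq: "p \<in> ?I" "q \<in> ?I" "sh p = sh q"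
    have "p (cyc t) = q (cyc t)" if "t < k" for t
      using fun_cong[OF pq(3), of t] that unfolding sh_def by simp
    then have "p t = q t" if "t < k" for t
      using cyc that unfolding bij_betw_def by (metis imageE lessThan_iff)
    then show "p = q" using pq(1,2) unfolding tensor_index_def by (intro PiE_ext) auto
  qed
  then have sh: "bij_betw sh ?I ?I"
    using endo_inj_surj[of ?I sh] sh_mem unfolding bij_betw_def by auto
  \<comment> \<open>Shifting both indices only permutes the factors of the product. This is the
    commutation of the cyclic shift with the tensor power.\<close>
  have te_sh: "tensor_entry k A (sh p) (sh q) = tensor_entry k A p q" for A p q
  proof -
    have "tensor_entry k A (sh p) (sh q) = (\<Prod>t<k. A $$ (p (cyc t), q (cyc t)))"
      unfolding tensor_entry_def sh_def by (intro prod.cong) auto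
    also have "\<dots> = tensor_entry k A p q"
      unfolding tensor_entry_def using prod.reindex_bij_betw[OF cyc, of "\<lambda>t. A $$ (p t, q t)"] .
    finally show ?thesis .
  qed
  define T :: "(nat \<Rightarrow> nat) \<Rightarrow> (nat \<Rightarrow> nat) \<Rightarrow> complex" where "T p q = (if p = sh q then 1 else 0)" for p q
  have RT: "(\<Sum>r\<in>?I. tensor_entry k A p r * T r q) = tensor_entry k A p (sh q)" if "q \<in> ?I" for A p q
  proof -
    have "(\<Sum>r\<in>?I. tensor_entry k A p r * T r q) = (\<Sum>r\<in>?I. if r = sh q then tensor_entry k A p (sh q) else 0)"
      unfolding T_def by (intro sum.cong) auto
    then show ?thesis using sh_mem[OF that] by simp
  qed
  show ?thesis
  proof (rule twisted_char_of_finite_index_set[of ?I "\<lambda>g. tensor_entry k (\<pi> g)" X T])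
    show "tensor_entry k (\<pi> (g \<otimes> h)) p q = (\<Sum>r\<in>?I. tensor_entry k (\<pi> g) p r * tensor_entry k (\<pi> h) r q)"
      if "g \<in> carrier G" "h \<in> carrier G" "p \<in> ?I" "q \<in> ?I" for g h p q
      using that R by (simp add: tensor_entry_mult)
  next
    fix g p q assume g: "g \<in> carrier G" and pq: "p \<in> ?I" "q \<in> ?I"
    have "(\<Sum>r\<in>?I. T p r * tensor_entry k (\<pi> g) r q) = (\<Sum>r\<in>?I. (if p = sh r then 1 else 0) * tensor_entry k (\<pi> g) (sh r) (sh q))"
      unfolding T_def te_sh ..
    also have "\<dots> = (\<Sum>r\<in>?I. (if p = r then 1 else 0) * tensor_entry k (\<pi> g) r (sh q))"
      by (rule sum.reindex_bij_betw[OF sh])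
    also have "\<dots> = tensor_entry k (\<pi> g) p (sh q)"
      using pq by (simp add: if_distrib[of "\<lambda>x. x * _"] cong: if_cong)
    finally show "(\<Sum>r\<in>?I. tensor_entry k (\<pi> g) p r * T r q) = (\<Sum>r\<in>?I. T p r * tensor_entry k (\<pi> g) r q)"
      using RT pq by simp
  next
    fix g assume g: "g \<in> carrier G"
    let ?A = "\<pi> g"
    have A: "?A \<in> carrier_mat m m" using R(1)[OF g] .
    \<comment> \<open>One of the k factors is split off: the other k' form a path, and the split-off
      entry leads from its end back to its start.\<close>
    have "mat_trace (?A ^\<^sub>m k) = (\<Sum>i<m. \<Sum>j<m. ?A $$ (j, i) * (?A ^\<^sub>m k') $$ (i, j))"
      using mat_trace_mult[of "?A ^\<^sub>m k'" m m ?A] A k' by (simp add: mult.commute)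
    also have "\<dots> = (\<Sum>p\<in>PiE {..k'} (\<lambda>_. {..<m}). ?A $$ (p k', p 0) * (\<Prod>t<k'. ?A $$ (p t, p (Suc t))))"
      by (rule sum_mat_product_eq_sum_paths[of k' "\<lambda>_. ?A" m "\<lambda>t. ?A ^\<^sub>m t" "\<lambda>i j. ?A $$ (j, i)"])
        (use A in auto)
    also have "\<dots> = (\<Sum>p\<in>?I. tensor_entry k ?A p (sh p))"
    proof (rule sum.cong)
      show "PiE {..k'} (\<lambda>_. {..<m}) = ?I" unfolding tensor_index_def k' lessThan_Suc_atMost ..
      fix p assume "p \<in> ?I"
      have "tensor_entry k ?A p (sh p) = (\<Prod>t<k. ?A $$ (p t, p (cyc t)))"
        unfolding tensor_entry_def sh_def by (intro prod.cong) auto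
      also have "\<dots> = (\<Prod>t<k'. ?A $$ (p t, p (Suc t))) * ?A $$ (p k', p 0)"
        unfolding k' cyc_def by simp
      finally show "?A $$ (p k', p 0) * (\<Prod>t<k'. ?A $$ (p t, p (Suc t))) = tensor_entry k ?A p (sh p)"
        by (simp add: mult.commute)
    qed
    also have "\<dots> = (\<Sum>p\<in>?I. \<Sum>r\<in>?I. tensor_entry k ?A p r * T r p)"
      using RT by simp
    finally show "mat_trace (?A ^\<^sub>m k) = (\<Sum>p\<in>?I. \<Sum>r\<in>?I. tensor_entry k ?A p r * T r p)" .
  qed (use R tensor_entry_one continuous_map_tensor_entry[OF rep] in auto)
qed

subsection \<open>Unipotent elements in bounded dimension\<close>

context group
begin

lemma rep_pow:
  assumes "cont_rep G X m \<pi>" "u \<in> carrier G"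
  shows "\<pi> (u [^] (k :: nat)) = \<pi> u ^\<^sub>m k"
proof (induction k)
  case 0
  then show ?case using cont_repD[OF assms(1)] assms(2) by auto
next
  case (Suc k)
  then show ?case using cont_repD(2)[OF assms(1), of "u [^] k" u] assms(2) by simp
qed

text \<open>The two-sided ideal generated by \<open>N\<close> in the linear span of \<pi>(G), built
  by adding one multiple of a generator at a time.\<close>

inductive_set rep_ideal :: "nat \<Rightarrow> ('a \<Rightarrow> complex mat) \<Rightarrow> complex mat \<Rightarrow> complex mat set"
  for m \<pi> N where
  zero: "0\<^sub>m m m \<in> rep_ideal m \<pi> N"
| step: "A \<in> rep_ideal m \<pi> N \<Longrightarrow> g \<in> carrier G \<Longrightarrow> h \<in> carrier G \<Longrightarrow>
    A + c \<cdot>\<^sub>m (\<pi> g * N * \<pi> h) \<in> rep_ideal m \<pi> N"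

text \<open>If \<open>\<pi> u - 1\<close> is nonzero, irreducibility yields \<open>B\<close> in the ideal and \<open>v \<noteq> 0\<close> with \<open>B v = v\<close>,
  while all powers of \<open>B\<close> have trace \<open>0\<close>.\<close>
lemma irreducible_rep_trivial_if_traces_eq:
  assumes irr: "irreducible_rep G X m \<pi>" and u: "u \<in> carrier G"
    and tr: "\<And>h. h \<in> carrier G \<Longrightarrow> mat_trace (\<pi> (u \<otimes> h)) = mat_trace (\<pi> h)"
  shows "\<pi> u = 1\<^sub>m m"
proof -
  have rep: "cont_rep G X m \<pi>" and m: "m > 0"
    and inv: "\<And>W. invariant_subspace G m \<pi> W \<Longrightarrow> W = {0\<^sub>v m} \<or> W = carrier_vec m"
    using irr unfolding irreducible_rep_def by auto
  note R = cont_repD[OF rep]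
  define N where "N = \<pi> u - 1\<^sub>m m"
  have N: "N \<in> carrier_mat m m" unfolding N_def by (rule minus_carrier_mat[OF one_carrier_mat])
  have gen_c: "\<pi> g * N * \<pi> h \<in> carrier_mat m m" if "g \<in> carrier G" "h \<in> carrier G" for g h
    using R(1)[OF that(1)] R(1)[OF that(2)] N by simp
  let ?J = "rep_ideal m \<pi> N"
  have Jc: "A \<in> carrier_mat m m" if "A \<in> ?J" for A
    using that
  proof induction
    case (step A g h c)
    then show ?case using gen_c[OF step(2,3)] by (intro add_carrier_mat smult_carrier_mat)
  qed simp
  have J_add: "A + B \<in> ?J" if "A \<in> ?J" "B \<in> ?J" for A B
    using that(2)
  proof induction
    case zero
    then show ?case using that(1) Jc by simp
  next
    case (step B g h c)
    have "A + (B + c \<cdot>\<^sub>m (\<pi> g * N * \<pi> h)) = (A + B) + c \<cdot>\<^sub>m (\<pi> g * N * \<pi> h)"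
      using Jc[OF that(1)] Jc[OF step(1)] gen_c[OF step(2,3)] by (intro assoc_add_mat[symmetric]) auto
    then show ?case using rep_ideal.step[OF step(4,2,3)] by simp
  qed
  have smult_add: "d \<cdot>\<^sub>m (A + c \<cdot>\<^sub>m B) = d \<cdot>\<^sub>m A + (d * c) \<cdot>\<^sub>m B"
    if "A \<in> carrier_mat m m" "B \<in> carrier_mat m m" for A B :: "complex mat" and c d
    using that by (intro eq_matI) (auto simp: algebra_simps)
  have J_smult: "d \<cdot>\<^sub>m A \<in> ?J" if "A \<in> ?J" for A d
    using that
  proof induction
    case zero
    have "d \<cdot>\<^sub>m 0\<^sub>m m m = 0\<^sub>m m m" by (intro eq_matI) auto
    then show ?case using rep_ideal.zero by simp
  next
    case (step A g h c)
    have "d \<cdot>\<^sub>m (A + c \<cdot>\<^sub>m (\<pi> g * N * \<pi> h)) = d \<cdot>\<^sub>m A + (d * c) \<cdot>\<^sub>m (\<pi> g * N * \<pi> h)"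
      by (rule smult_add[OF Jc[OF step(1)] gen_c[OF step(2,3)]])
    then show ?case using rep_ideal.step[OF step(4,2,3)] by simp
  qed
  have J_left: "\<pi> x * A \<in> ?J" if x: "x \<in> carrier G" and "A \<in> ?J" for A x
    using that(2)
  proof induction
    case zero
    then show ?case using R(1)[OF x] rep_ideal.zero by simp
  next
    case (step A g h c)
    have "\<pi> x * (A + c \<cdot>\<^sub>m (\<pi> g * N * \<pi> h)) = \<pi> x * A + c \<cdot>\<^sub>m (\<pi> x * (\<pi> g * N * \<pi> h))"
      using R(1)[OF x] Jc[OF step(1)] gen_c[OF step(2,3)]
      by (subst mult_add_distrib_mat[of _ m m _ m]) (auto simp: mult_smult_distrib[of _ m m _ m])
    also have "\<pi> x * (\<pi> g * N * \<pi> h) = \<pi> (x \<otimes> g) * N * \<pi> h"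
      using R(1)[OF x] R(1)[OF step(2)] R(1)[OF step(3)] N R(2)[OF x step(2)]
      by (simp add: assoc_mult_mat[of _ m m _ m _ m])
    finally show ?case using rep_ideal.step[OF step(4) _ step(3)] x step(2) by simp
  qed
  have J_right: "A * \<pi> x \<in> ?J" if x: "x \<in> carrier G" and "A \<in> ?J" for A x
    using that(2)
  proof induction
    case zero
    then show ?case using R(1)[OF x] rep_ideal.zero by simp
  next
    case (step A g h c)
    have "(A + c \<cdot>\<^sub>m (\<pi> g * N * \<pi> h)) * \<pi> x = A * \<pi> x + c \<cdot>\<^sub>m (\<pi> g * N * \<pi> h * \<pi> x)"
      using R(1)[OF x] Jc[OF step(1)] gen_c[OF step(2,3)]
      by (subst add_mult_distrib_mat[of _ m m _ _ m]) (auto simp: mult_smult_assoc_mat[of _ m m _ m])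
    also have "\<pi> g * N * \<pi> h * \<pi> x = \<pi> g * N * \<pi> (h \<otimes> x)"
      using R(1)[OF x] R(1)[OF step(2)] R(1)[OF step(3)] N R(2)[OF step(3) x]
      by (simp add: assoc_mult_mat[of _ m m _ m _ m])
    finally show ?case using rep_ideal.step[OF step(4,2)] x step(3) by simp
  qed
  have J_mult: "A * B \<in> ?J" if A: "A \<in> ?J" and "B \<in> ?J" for A B
    using that(2)
  proof induction
    case zero
    then show ?case using Jc[OF A] rep_ideal.zero by simp
  next
    case (step B g h c)
    have Ac: "A \<in> carrier_mat m m" using Jc[OF A] .
    have g: "\<pi> g \<in> carrier_mat m m" and h: "\<pi> h \<in> carrier_mat m m" and uc: "\<pi> u \<in> carrier_mat m m"
      using R(1) step u by auto
    \<comment> \<open>Since N is \<pi>(u) - 1, each generator is a difference of two group elements.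
      Multiplication inside the ideal thus reduces to right multiplication by the group.\<close>
    have "\<pi> g * N * \<pi> h = \<pi> (g \<otimes> u \<otimes> h) + (- 1) \<cdot>\<^sub>m \<pi> (g \<otimes> h)"
    proof -
      have "\<pi> g * N = \<pi> g * \<pi> u - \<pi> g"
        unfolding N_def using mult_minus_distrib_mat[OF g uc one_carrier_mat] g by simp
      then have "\<pi> g * N * \<pi> h = \<pi> g * \<pi> u * \<pi> h - \<pi> g * \<pi> h"
        using minus_mult_distrib_mat[of "\<pi> g * \<pi> u" m m "\<pi> g" "\<pi> h" m] g h uc by simp
      also have "\<dots> = \<pi> (g \<otimes> u \<otimes> h) + (- 1) \<cdot>\<^sub>m \<pi> (g \<otimes> h)"
        using g h uc step(2,3) u by (intro eq_matI) (simp_all add: R(2) del: index_mult_mat(1))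
      finally show ?thesis .
    qed
    moreover have "\<pi> (g \<otimes> u \<otimes> h) \<in> carrier_mat m m" "\<pi> (g \<otimes> h) \<in> carrier_mat m m"
      using step u R(1) by auto
    ultimately have "A * (\<pi> g * N * \<pi> h) = A * \<pi> (g \<otimes> u \<otimes> h) + (- 1) \<cdot>\<^sub>m (A * \<pi> (g \<otimes> h))"
      using Ac by (simp add: mult_add_distrib_mat[of _ m m _ m] mult_smult_distrib[of _ m m _ m])
    then have "A * (\<pi> g * N * \<pi> h) \<in> ?J"
      using J_add[OF J_right[OF _ A] J_smult[OF J_right[OF _ A]]] step(2,3) u by simp
    moreover have "A * (B + c \<cdot>\<^sub>m (\<pi> g * N * \<pi> h)) = A * B + c \<cdot>\<^sub>m (A * (\<pi> g * N * \<pi> h))"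
      using Ac Jc[OF step(1)] gen_c[OF step(2,3)]
      by (subst mult_add_distrib_mat[of _ m m _ m]) (auto simp: mult_smult_distrib[of _ m m _ m])
    ultimately show ?case using J_add[OF step(4) J_smult] by simp
  qed
  have J_pow: "A ^\<^sub>m Suc k \<in> ?J" if "A \<in> ?J" for A k
  proof (induction k)
    case 0
    then show ?case using that Jc[OF that] by simp
  next
    case (Suc k)
    then show ?case using J_mult[OF Suc that] by simp
  qed
  have trace_add: "mat_trace (A + c \<cdot>\<^sub>m B) = mat_trace A + c * mat_trace B"
    if "A \<in> carrier_mat m m" "B \<in> carrier_mat m m" for A B :: "complex mat" and c
    using that by (simp add: mat_trace_def sum.distrib sum_distrib_left)
  \<comment> \<open>By cyclicity, the trace of a generator is the character at u h g minus the
    character at h g, which is 0 by hypothesis.\<close>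
  have J_trace: "mat_trace A = 0" if "A \<in> ?J" for A
    using that
  proof induction
    case zero
    then show ?case by (simp add: mat_trace_def)
  next
    case (step A g h c)
    have g: "\<pi> g \<in> carrier_mat m m" and h: "\<pi> h \<in> carrier_mat m m" and uc: "\<pi> u \<in> carrier_mat m m"
      and hgc: "\<pi> (h \<otimes> g) \<in> carrier_mat m m" and uhgc: "\<pi> (u \<otimes> (h \<otimes> g)) \<in> carrier_mat m m"
      using R(1) step u by auto
    have "mat_trace (A + c \<cdot>\<^sub>m (\<pi> g * N * \<pi> h)) = mat_trace A + c * mat_trace (\<pi> g * N * \<pi> h)"
      by (rule trace_add[OF Jc[OF step(1)] gen_c[OF step(2,3)]])
    also have "mat_trace (\<pi> g * N * \<pi> h) = mat_trace (\<pi> h * (\<pi> g * N))"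
      using g h N by (intro mat_trace_mult_commute[of _ m m]) auto
    also have "\<pi> h * (\<pi> g * N) = \<pi> (h \<otimes> g) * N"
      using g h N R(2)[OF step(3,2)] by (simp add: assoc_mult_mat[of _ m m _ m _ m])
    also have "mat_trace (\<pi> (h \<otimes> g) * N) = mat_trace (N * \<pi> (h \<otimes> g))"
      using hgc N by (intro mat_trace_mult_commute[of _ m m]) auto
    also have "N * \<pi> (h \<otimes> g) = \<pi> (u \<otimes> (h \<otimes> g)) - \<pi> (h \<otimes> g)"
      unfolding N_def using minus_mult_distrib_mat[OF uc one_carrier_mat hgc] hgc R(2)[OF u] step by simp
    also have "mat_trace \<dots> = 0"
      using tr[of "h \<otimes> g"] hgc uhgc step by (simp add: mat_trace_def sum_subtractf)
    finally show ?case using step by simp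
  qed
  \<comment> \<open>The common kernel of the ideal is invariant. If it is everything, N itself acts
    as 0. If it is zero, the ideal applied to a nonzero v gives a nonzero invariant subspace, which
    must contain v.\<close>
  define K where "K = {v \<in> carrier_vec m. \<forall>A\<in>?J. A *\<^sub>v v = 0\<^sub>v m}"
  have "invariant_subspace G m \<pi> K"
    unfolding invariant_subspace_def
  proof (intro conjI ballI allI)
    show "K \<subseteq> carrier_vec m" unfolding K_def by auto
    have "A *\<^sub>v 0\<^sub>v m = 0\<^sub>v m" if "A \<in> ?J" for A using Jc[OF that] by (intro eq_vecI) auto
    then show "0\<^sub>v m \<in> K" unfolding K_def by auto
  next
    fix v w assume "v \<in> K" "w \<in> K"
    then show "v + w \<in> K" unfolding K_def using Jc by (auto simp: mult_add_distrib_mat_vec[of _ m m])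
  next
    fix c v assume "v \<in> K"
    then show "c \<cdot>\<^sub>v v \<in> K" unfolding K_def using Jc by (auto simp: mult_mat_vec[of _ m m])
  next
    fix g v assume g: "g \<in> carrier G" and v: "v \<in> K"
    have vc: "v \<in> carrier_vec m" using v unfolding K_def by auto
    have "A *\<^sub>v (\<pi> g *\<^sub>v v) = 0\<^sub>v m" if A: "A \<in> ?J" for A
    proof -
      have "A *\<^sub>v (\<pi> g *\<^sub>v v) = (A * \<pi> g) *\<^sub>v v"
        by (rule assoc_mult_mat_vec[OF Jc[OF A] R(1)[OF g] vc, symmetric])
      then show ?thesis using v J_right[OF g A] unfolding K_def by auto
    qed
    then show "\<pi> g *\<^sub>v v \<in> K" using mult_mat_vec_carrier[OF R(1)[OF g] vc] unfolding K_def by auto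
  qed
  then consider "K = carrier_vec m" | "K = {0\<^sub>v m}" using inv by blast
  then show ?thesis
  proof cases
    case 1
    have "\<pi> \<one> * N * \<pi> \<one> \<in> ?J"
    proof -
      have "0\<^sub>m m m + 1 \<cdot>\<^sub>m B = B" if "B \<in> carrier_mat m m" for B :: "complex mat"
        using that by (intro eq_matI) auto
      from this[OF gen_c[OF one_closed one_closed]] show ?thesis
        using rep_ideal.step[where m = m and \<pi> = \<pi> and N = N and c = 1, OF rep_ideal.zero one_closed one_closed]
        by (simp only:)
    qed
    then have NJ: "N \<in> ?J" using R(3) N by simp
    have "N = 0\<^sub>m m m"
    proof (rule eq_matI)
      fix i j assume "i < dim_row (0\<^sub>m m m :: complex mat)" "j < dim_col (0\<^sub>m m m :: complex mat)"
      then have ij: "i < m" "j < m" by auto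
      have "unit_vec m j \<in> K" using 1 by simp
      then have "N *\<^sub>v unit_vec m j = 0\<^sub>v m" using NJ unfolding K_def by auto
      then have "(N *\<^sub>v unit_vec m j) $ i = 0" using ij by simp
      then show "N $$ (i, j) = 0\<^sub>m m m $$ (i, j)" using ij N by simp
    qed (use N in auto)
    have "\<pi> u $$ (i, j) = 1\<^sub>m m $$ (i, j)" if "i < m" "j < m" for i j
      using arg_cong[OF \<open>N = 0\<^sub>m m m\<close>, of "\<lambda>A. A $$ (i, j)"] that R(1)[OF u] unfolding N_def by simp
    then show ?thesis using R(1)[OF u] by (intro eq_matI) auto
  next
    case 2
    define v where "v = (unit_vec m 0 :: complex vec)"
    have v: "v \<in> carrier_vec m" "v \<noteq> 0\<^sub>v m"
      using m unfolding v_def by (auto dest!: arg_cong[where f = "\<lambda>v. v $ 0"])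
    define W where "W = (\<lambda>A. A *\<^sub>v v) ` ?J"
    have "invariant_subspace G m \<pi> W"
      unfolding invariant_subspace_def
    proof (intro conjI ballI allI)
      show "W \<subseteq> carrier_vec m" unfolding W_def using Jc v mult_mat_vec_carrier by blast
      have "0\<^sub>v m = 0\<^sub>m m m *\<^sub>v v" using v by (intro eq_vecI) auto
      then show "0\<^sub>v m \<in> W" unfolding W_def using rep_ideal.zero by blast
    next
      fix w1 w2 assume "w1 \<in> W" "w2 \<in> W"
      then obtain A B where AB: "A \<in> ?J" "B \<in> ?J" "w1 = A *\<^sub>v v" "w2 = B *\<^sub>v v" unfolding W_def by blast
      then have "w1 + w2 = (A + B) *\<^sub>v v" using add_mult_distrib_mat_vec[OF Jc Jc v(1)] by simp
      then show "w1 + w2 \<in> W" unfolding W_def using J_add AB by blast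
    next
      fix c w assume "w \<in> W"
      then obtain A where A: "A \<in> ?J" "w = A *\<^sub>v v" unfolding W_def by blast
      then have "c \<cdot>\<^sub>v w = (c \<cdot>\<^sub>m A) *\<^sub>v v" using Jc[OF A(1)] v(1) by (intro eq_vecI) auto
      then show "c \<cdot>\<^sub>v w \<in> W" unfolding W_def using J_smult A by blast
    next
      fix g w assume g: "g \<in> carrier G" and "w \<in> W"
      then obtain A where A: "A \<in> ?J" "w = A *\<^sub>v v" unfolding W_def by blast
      have "\<pi> g *\<^sub>v w = (\<pi> g * A) *\<^sub>v v"
        unfolding A(2) by (rule assoc_mult_mat_vec[OF R(1)[OF g] Jc[OF A(1)] v(1), symmetric])
      then show "\<pi> g *\<^sub>v w \<in> W" unfolding W_def using J_left[OF g A(1)] by blast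
    qed
    moreover have "W \<noteq> {0\<^sub>v m}"
    proof
      assume "W = {0\<^sub>v m}"
      then have "v \<in> K" unfolding K_def W_def using v(1) by auto
      then show False using 2 v(2) by simp
    qed
    ultimately have "v \<in> W" using inv v(1) by blast
    then obtain B where B: "B \<in> ?J" "B *\<^sub>v v = v" unfolding W_def by auto
    then have "poly (char_poly B) 1 = 0"
      using root_char_polyI[OF Jc[OF B(1)] v] v(1) by simp
    moreover have "mat_trace (B ^\<^sub>m k) = 0" if "k \<ge> 1" for k
      using J_trace[OF J_pow[OF B(1), of "k - 1"]] that by simp
    ultimately show ?thesis using mat_trace_pow_zero_imp[OF Jc[OF B(1)]] by force
  qed
qed

lemma mat_trace_mult_poly_sequence:
  assumes M: "\<And>k. M k \<in> carrier_mat m m" and B: "B \<in> carrier_mat m m"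
    and q: "\<And>i j. i < m \<Longrightarrow> j < m \<Longrightarrow> \<exists>q. degree q < n \<and> (\<forall>k. M k $$ (i, j) = poly q (of_nat k))"
    and "0 < (n :: nat)"
  shows "\<exists>q. degree q < n \<and> (\<forall>k. mat_trace (M k * B) = poly q (of_nat k :: complex))"
proof -
  obtain q where q: "\<And>i j. i < m \<Longrightarrow> j < m \<Longrightarrow> degree (q i j) < n \<and> (\<forall>k. M k $$ (i, j) = poly (q i j) (of_nat k))"
    using q by metis
  let ?r = "\<Sum>i<m. \<Sum>j<m. Polynomial.smult (B $$ (j, i)) (q i j)"
  have "degree ?r < n"
    using q \<open>0 < n\<close> by (intro degree_sum_less le_less_trans[OF degree_smult_le]) auto
  moreover have "mat_trace (M k * B) = poly ?r (of_nat k)" for k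
    using q by (simp add: mat_trace_mult[OF M B] poly_sum mult.commute)
  ultimately show ?thesis by blast
qed

text \<open>Along \<open>u\<^sup>k h\<close> the character of the \<open>n\<close>-th tensor power is the \<open>n\<close>-th power of a polynomial in \<open>k\<close>, while
  its composition factors, of dimension at most \<open>n\<close>, only contribute polynomials of degree less than \<open>n\<close>.\<close>
lemma unipotent_trivial_if_bounded_dim:
  assumes top: "topspace X = carrier G"
    and bound: "\<And>e E. irreducible_rep G X e E \<Longrightarrow> e \<le> n"
    and irr: "irreducible_rep G X m \<pi>" and u: "u \<in> carrier G"
    and uni: "\<And>z. poly (char_poly (\<pi> u)) z = 0 \<Longrightarrow> z = 1"
  shows "\<pi> u = 1\<^sub>m m"
proof (rule irreducible_rep_trivial_if_traces_eq[OF irr u])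
  fix h assume h: "h \<in> carrier G"
  have rep: "cont_rep G X m \<pi>" and m: "m > 0"
    using irr unfolding irreducible_rep_def by auto
  have n: "n > 0" using bound[OF irr] m by simp
  have uk: "u [^] k \<in> carrier G" for k :: nat using u by simp
  note R = cont_repD[OF rep]
  have seq: "\<exists>q. degree q < e \<and> (\<forall>k. mat_trace (E (u [^] k \<otimes> h)) = poly q (of_nat k))"
    if E: "cont_rep G X e E" "e > 0" "\<And>z. poly (char_poly (E u)) z = 0 \<Longrightarrow> z = 1" for e E
  proof -
    note RE = cont_repD[OF E(1)]
    have "\<exists>q. degree q < e \<and> (\<forall>k. mat_trace (E u ^\<^sub>m k * E h) = poly q (of_nat k))"
      using RE(1) u h E(2,3) by (intro mat_trace_mult_poly_sequence[of _ e] pow_mat_unipotent_poly[of _ e]) auto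
    then show ?thesis using RE(2)[OF uk h] rep_pow[OF E(1) u] by simp
  qed
  obtain p where p: "\<And>k. mat_trace (\<pi> (u [^] k \<otimes> h)) = poly p (of_nat k)"
    using seq[OF rep m uni] by blast
  obtain M \<tau> b where \<tau>: "cont_rep G X M \<tau>" and b: "\<And>i. i < M \<Longrightarrow> b i \<in> tensor_index m n"
    and \<tau>_idx: "\<And>g i j. i < M \<Longrightarrow> j < M \<Longrightarrow> \<tau> g $$ (i, j) = tensor_entry n (\<pi> g) (b i) (b j)"
    and \<tau>_tr: "\<And>g. g \<in> carrier G \<Longrightarrow> mat_trace (\<tau> g) = mat_trace (\<pi> g) ^ n"
    using tensor_power_rep[OF rep, of n] by blast
  \<comment> \<open>Each entry of \<tau>(u)^k is a product of entries of \<pi>(u)^k, hence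
    polynomial in k.\<close>
  have \<tau>_uni: "z = 1" if "poly (char_poly (\<tau> u)) z = 0" for z
  proof (rule roots_eq_1_if_pow_mat_poly[OF cont_repD(1)[OF \<tau> u] _ that])
    fix i j assume ij: "i < M" "j < M"
    have "\<exists>q. \<forall>k. (\<pi> u ^\<^sub>m k) $$ (b i t, b j t) = poly q (of_nat k)" if "t < n" for t
      using pow_mat_unipotent_poly[OF R(1)[OF u] uni tensor_indexD[OF b[OF ij(1)] that] tensor_indexD[OF b[OF ij(2)] that]]
      by blast
    then obtain q where q: "\<And>t k. t < n \<Longrightarrow> (\<pi> u ^\<^sub>m k) $$ (b i t, b j t) = poly (q t) (of_nat k)" by metis
    have "(\<tau> u ^\<^sub>m k) $$ (i, j) = poly (\<Prod>t<n. q t) (of_nat k)" for k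
      unfolding rep_pow[OF \<tau> u, symmetric] \<tau>_idx[OF ij] rep_pow[OF rep u] tensor_entry_def
      using q by (simp add: poly_prod)
    then show "\<exists>q. \<forall>k. (\<tau> u ^\<^sub>m k) $$ (i, j) = poly q (of_nat k)" by blast
  qed
  obtain Es where Es': "(\<forall>(e, E) \<in> set Es. irreducible_rep G X e E) \<and>
    (\<forall>(I :: unit set) c y. y ` I \<subseteq> carrier G \<longrightarrow>
      char_poly (group_alg_mat M \<tau> I c y) = (\<Prod>(e, E)\<leftarrow>Es. char_poly (group_alg_mat e E I c y))) \<and>
    (\<forall>g\<in>carrier G. mat_trace (\<tau> g) = (\<Sum>(e, E)\<leftarrow>Es. mat_trace (E g)))"
    using exists_composition_factors[OF top \<tau>] by (rule exE)
  note Es = Es'[THEN conjunct1] Es'[THEN conjunct2, THEN conjunct1, rule_format]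
    Es'[THEN conjunct2, THEN conjunct2, rule_format]
  \<comment> \<open>A single group element is a one-term combination, so the factorization of
    characteristic polynomials shows that u acts unipotently on every composition factor as
    well.\<close>
  have single: "group_alg_mat e E {()} (\<lambda>_. 1) (\<lambda>_. u) = E u" if "cont_rep G X e E" for e E
    using cont_repD(1)[OF that u] unfolding group_alg_mat_def by (intro eq_matI) auto
  have "\<exists>q. degree q < n \<and> (\<forall>k. mat_trace (E (u [^] k \<otimes> h)) = poly q (of_nat k))" if E: "(e, E) \<in> set Es" for e E
  proof -
    have irrE: "irreducible_rep G X e E" using Es(1) E by auto
    then have repE: "cont_rep G X e E" "e > 0" unfolding irreducible_rep_def by auto
    have "z = 1" if z: "poly (char_poly (E u)) z = 0" for z
    proof -
      have "char_poly (\<tau> u) = (\<Prod>(e, E)\<leftarrow>Es. char_poly (group_alg_mat e E {()} (\<lambda>_. 1) (\<lambda>_. u)))"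
        using Es(2)[of "\<lambda>_. u" "{()}" "\<lambda>_. 1", OF image_subsetI] u single[OF \<tau>] by simp
      moreover have "\<exists>x\<in>set Es. poly (case x of (e, E) \<Rightarrow> char_poly (group_alg_mat e E {()} (\<lambda>_. 1) (\<lambda>_. u))) z = 0"
        using E z single[OF repE(1)] by (intro bexI[of _ "(e, E)"]) auto
      ultimately have "poly (char_poly (\<tau> u)) z = 0"
        by (force simp: poly_prod_list prod_list_zero_iff image_iff)
      then show ?thesis by (rule \<tau>_uni)
    qed
    from seq[OF repE this] show ?thesis using bound[OF irrE] by (meson less_le_trans)
  qed
  then obtain Q where Q: "\<And>e E. (e, E) \<in> set Es \<Longrightarrow> degree (Q e E) < n"
    "\<And>e E k. (e, E) \<in> set Es \<Longrightarrow> mat_trace (E (u [^] k \<otimes> h)) = poly (Q e E) (of_nat k)" by metis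
  define r where "r = (\<Sum>(e, E)\<leftarrow>Es. Q e E)"
  have "degree (\<Sum>(e, E)\<leftarrow>Fs. Q e E) < n" if "set Fs \<subseteq> set Es" for Fs
    using that
  proof (induction Fs)
    case (Cons F Fs)
    then show ?case using Q(1) by (cases F) (auto intro: degree_add_less)
  qed (use n in simp)
  then have deg_r: "degree r < n" unfolding r_def by blast
  have "p ^ n = r"
  proof (rule poly_eq_if_eq_on_nats)
    fix k :: nat
    have "poly (p ^ n) (of_nat k) = mat_trace (\<tau> (u [^] k \<otimes> h))"
      using \<tau>_tr[of "u [^] k \<otimes> h"] p[of k] uk h by simp
    also have "\<dots> = (\<Sum>(e, E)\<leftarrow>Es. mat_trace (E (u [^] k \<otimes> h)))" using Es(3)[of "u [^] k \<otimes> h"] uk h by simp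
    also have "\<dots> = (\<Sum>(e, E)\<leftarrow>Es. poly (Q e E) (of_nat k))"
      using Q(2) by (intro arg_cong[where f = sum_list] map_cong) auto
    also have "\<dots> = poly r (of_nat k)"
      unfolding r_def by (induction Es) auto
    finally show "poly (p ^ n) (of_nat k) = poly r (of_nat k)" .
  qed
  \<comment> \<open>This forces degree 0, and comparing k = 1 with k = 0 gives the trace
    equality.\<close>
  then have "n * degree p < n" using deg_r degree_power_eq[of p n] n by (cases "p = 0") auto
  then have "degree p = 0" by (cases "degree p") auto
  then obtain a where "p = [:a:]" by (meson degree_eq_zeroE)
  then show "mat_trace (\<pi> (u \<otimes> h)) = mat_trace (\<pi> h)" using p[of 1] p[of 0] u h by simp
qed

text \<open>If all power traces equalled the dimension, the eigenvalues would lie in {0, 1}.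
  Invertibility excludes 0, so y would act unipotently and therefore trivially. This turns
  separation by representations into separation by power traces.\<close>

lemma exists_mat_trace_pow_neq_dim:
  assumes top: "topspace X = carrier G"
    and bound: "\<And>e E. irreducible_rep G X e E \<Longrightarrow> e \<le> n"
    and irr: "irreducible_rep G X m \<pi>" and y: "y \<in> carrier G" and neq: "\<pi> y \<noteq> 1\<^sub>m m"
  shows "\<exists>k\<ge>1. mat_trace (\<pi> y ^\<^sub>m k) \<noteq> of_nat m"
proof (rule ccontr)
  assume "\<not> ?thesis"
  then have tr: "mat_trace (\<pi> y ^\<^sub>m k) = of_nat m" if "k \<ge> 1" for k using that by blast
  have rep: "cont_rep G X m \<pi>" using irr unfolding irreducible_rep_def by auto
  note R = cont_repD[OF rep]
  have "z = 1" if z: "poly (char_poly (\<pi> y)) z = 0" for z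
  proof -
    have "z \<noteq> 0"
    proof
      assume "z = 0"
      obtain v where v: "v \<in> carrier_vec m" "v \<noteq> 0\<^sub>v m" "\<pi> y *\<^sub>v v = z \<cdot>\<^sub>v v"
        using root_char_polyE[OF R(1)[OF y] z] by blast
      have "v = \<pi> (inv y \<otimes> y) *\<^sub>v v" using y v(1) R(3) by simp
      also have "\<dots> = \<pi> (inv y) *\<^sub>v (\<pi> y *\<^sub>v v)"
        unfolding R(2)[OF inv_closed[OF y] y]
        by (rule assoc_mult_mat_vec[OF R(1)[OF inv_closed[OF y]] R(1)[OF y] v(1)])
      also have "\<pi> y *\<^sub>v v = 0\<^sub>v m" using v \<open>z = 0\<close> by (intro eq_vecI) auto
      also have "\<pi> (inv y) *\<^sub>v 0\<^sub>v m = 0\<^sub>v m" using R(1)[OF inv_closed[OF y]] by (intro eq_vecI) auto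
      finally show False using v(2) by simp
    qed
    then show ?thesis using mat_trace_pow_eq_dim_imp[OF R(1)[OF y] tr z] by blast
  qed
  then have "\<pi> y = 1\<^sub>m m" using unipotent_trivial_if_bounded_dim[OF top _ irr y, of n] bound by blast
  then show False using neq by simp
qed

end

subsection \<open>The standard identity\<close>

text \<open>Expanding the alternating sum along index paths gives determinants with two equal rows, because a path
  of length exceeding \<open>e\<^sup>2\<close> uses some index pair twice.\<close>
lemma (in group) standard_identity:
  assumes rep: "cont_rep G X e E" and d: "e\<^sup>2 < d" and xs: "length xs = d" "set xs \<subseteq> carrier G"
    and ij: "i < e" "j < e"
  shows "(\<Sum>s | s permutes {..<d}. signof s * E (list_mult G (permute_list s xs)) $$ (i, j)) = 0"
proof -
  note R = cont_repD[OF rep]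
  have x: "xs ! t \<in> carrier G" if "t < d" for t using that xs by auto
  define PP where "PP = PiE {..d} (\<lambda>_. {..<e})"
  \<comment> \<open>The end-point weight that keeps only paths from i to j.\<close>
  define \<delta> :: "nat \<Rightarrow> nat \<Rightarrow> complex" where "\<delta> a b = (if a = i \<and> b = j then 1 else 0)" for a b
  have path: "E (list_mult G (permute_list s xs)) $$ (i, j) =
    (\<Sum>p\<in>PP. \<delta> (p 0) (p d) * (\<Prod>t<d. E (xs ! s t) $$ (p t, p (Suc t))))" if s: "s permutes {..<d}" for s
  proof -
    define ys where "ys = permute_list s xs"
    have ys: "length ys = d" "set ys \<subseteq> carrier G" "\<And>t. t < d \<Longrightarrow> ys ! t = xs ! s t"
      using s xs unfolding ys_def by (auto simp: permute_list_nth)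
    have "\<delta> a b * M $$ (a, b) = (if b = j then if a = i then M $$ (i, j) else 0 else 0)" for a b and M :: "complex mat"
      unfolding \<delta>_def by auto
    then have "E (list_mult G ys) $$ (i, j) = (\<Sum>a<e. \<Sum>b<e. \<delta> a b * E (list_mult G (take d ys)) $$ (a, b))"
      using ij ys(1) by simp
    also have "\<dots> = (\<Sum>p\<in>PP. \<delta> (p 0) (p d) * (\<Prod>t<d. E (ys ! t) $$ (p t, p (Suc t))))"
      unfolding PP_def
    proof (rule sum_mat_product_eq_sum_paths)
      show "E (list_mult G (take 0 ys)) = 1\<^sub>m e" using R(3) by simp
      fix t assume t: "t < d"
      then have yt: "ys ! t \<in> carrier G" using ys(1,2) nth_mem[of t ys] by auto
      then show "E (ys ! t) \<in> carrier_mat e e" using R(1) by simp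
      have tk: "set (take t ys) \<subseteq> carrier G" using ys(2) set_take_subset by fast
      have "list_mult G (take (Suc t) ys) = list_mult G (take t ys) \<otimes> ys ! t"
        using t ys(1) yt tk by (simp add: take_Suc_conv_app_nth list_mult_append)
      then show "E (list_mult G (take (Suc t) ys)) = E (list_mult G (take t ys)) * E (ys ! t)"
        using R(2)[OF list_mult_closed[OF tk] yt] by simp
    qed
    also have "\<dots> = (\<Sum>p\<in>PP. \<delta> (p 0) (p d) * (\<Prod>t<d. E (xs ! s t) $$ (p t, p (Suc t))))"
      using ys(3) by simp
    finally show ?thesis unfolding ys_def .
  qed
  have zero: "(\<Sum>s | s permutes {..<d}. signof s * (\<Prod>t<d. E (xs ! s t) $$ (p t, p (Suc t)))) = 0" if p: "p \<in> PP" for p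
  proof -
    \<comment> \<open>Rows are steps of the path, columns are the factors. A permutation assigns
      factors to steps, so the signed sum for one path is the determinant of this matrix.\<close>
    define M where "M = mat d d (\<lambda>(t, r). E (xs ! r) $$ (p t, p (Suc t)))"
    have M: "M \<in> carrier_mat d d" unfolding M_def by simp
    have "(\<lambda>t. (p t, p (Suc t))) ` {..<d} \<subseteq> {..<e} \<times> {..<e}"
    proof
      fix z assume "z \<in> (\<lambda>t. (p t, p (Suc t))) ` {..<d}"
      then obtain t where t: "t < d" "z = (p t, p (Suc t))" by auto
      have "p t < e" "p (Suc t) < e" using p t(1) unfolding PP_def PiE_iff by (auto simp: Ball_def)
      then show "z \<in> {..<e} \<times> {..<e}" using t by simp
    qed
    then have "card ((\<lambda>t. (p t, p (Suc t))) ` {..<d}) \<le> card ({..<e} \<times> {..<e})"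
      by (intro card_mono) auto
    also have "\<dots> < card {..<d}" using d by (simp add: power2_eq_square)
    finally have "\<not> inj_on (\<lambda>t. (p t, p (Suc t))) {..<d}" by (rule pigeonhole)
    then obtain a b where ab: "a < d" "b < d" "a \<noteq> b" "p a = p b" "p (Suc a) = p (Suc b)"
      unfolding inj_on_def by auto
    have "det M = 0"
      by (rule det_identical_rows[OF M ab(3,1,2)]) (use ab in \<open>auto simp: M_def row_def\<close>)
    moreover have "det M = (\<Sum>s | s permutes {..<d}. signof s * (\<Prod>t<d. E (xs ! s t) $$ (p t, p (Suc t))))"
      unfolding det_def'[OF M] atLeast0LessThan
    proof (intro sum.cong refl)
      fix s assume "s \<in> {s. s permutes {..<d}}"
      then have "s t < d" if "t < d" for t using that permutes_in_image[of s "{..<d}" t] by auto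
      then show "signof s * (\<Prod>t<d. M $$ (t, s t)) = signof s * (\<Prod>t<d. E (xs ! s t) $$ (p t, p (Suc t)))"
        unfolding M_def by simp
    qed
    ultimately show ?thesis by simp
  qed
  have "(\<Sum>s | s permutes {..<d}. signof s * E (list_mult G (permute_list s xs)) $$ (i, j))
      = (\<Sum>s | s permutes {..<d}. \<Sum>p\<in>PP. \<delta> (p 0) (p d) * (signof s * (\<Prod>t<d. E (xs ! s t) $$ (p t, p (Suc t)))))"
    by (intro sum.cong refl) (simp add: path sum_distrib_left mult_ac)
  also have "\<dots> = (\<Sum>p\<in>PP. \<delta> (p 0) (p d) * (\<Sum>s | s permutes {..<d}. signof s * (\<Prod>t<d. E (xs ! s t) $$ (p t, p (Suc t)))))"
    by (subst sum.swap) (simp add: sum_distrib_left)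
  also have "\<dots> = 0" using zero by simp
  finally show ?thesis .
qed

text \<open>A group algebra element killed by all irreducible representations acts nilpotently on every representation,
  hence its trace stays \<open>0\<close> after multiplication with a commuting matrix.\<close>
lemma (in group) twisted_char_annihilated:
  fixes I :: "'i set"
  assumes top: "topspace X = carrier G" and f: "twisted_char G X f"
    and y: "\<And>s. s \<in> I \<Longrightarrow> y s \<in> carrier G"
    and kill: "\<And>e E i j. irreducible_rep G X e E \<Longrightarrow> i < e \<Longrightarrow> j < e \<Longrightarrow> (\<Sum>s\<in>I. c s * E (y s) $$ (i, j)) = 0"
  shows "(\<Sum>s\<in>I. c s * f (y s)) = 0"
proof -
  obtain m \<pi> T where rep: "cont_rep G X m \<pi>" and T: "T \<in> carrier_mat m m"
    and comm: "\<And>g. g \<in> carrier G \<Longrightarrow> \<pi> g * T = T * \<pi> g"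
    and tr: "\<And>g. g \<in> carrier G \<Longrightarrow> f g = mat_trace (\<pi> g * T)"
    using f unfolding twisted_char_def by blast
  note R = cont_repD[OF rep]
  obtain Es where Es': "(\<forall>(e, E) \<in> set Es. irreducible_rep G X e E) \<and>
    (\<forall>(I :: 'i set) c y. y ` I \<subseteq> carrier G \<longrightarrow>
      char_poly (group_alg_mat m \<pi> I c y) = (\<Prod>(e, E)\<leftarrow>Es. char_poly (group_alg_mat e E I c y))) \<and>
    (\<forall>g\<in>carrier G. mat_trace (\<pi> g) = (\<Sum>(e, E)\<leftarrow>Es. mat_trace (E g)))"
    using exists_composition_factors[OF top rep] by (rule exE)
  note irrE = Es'[THEN conjunct1] and cpE = Es'[THEN conjunct2, THEN conjunct1, rule_format, OF image_subsetI]
  define A where "A = group_alg_mat m \<pi> I c y"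
  have A: "A \<in> carrier_mat m m" unfolding A_def by simp
  have Aidx: "A $$ (i, j) = (\<Sum>s\<in>I. c s * \<pi> (y s) $$ (i, j))" if "i < m" "j < m" for i j
    using that unfolding A_def group_alg_mat_def by simp
  \<comment> \<open>A root belongs to the characteristic polynomial of some composition factor, on
    which the combination acts as the zero matrix.\<close>
  have root: "z = 0" if z: "poly (char_poly A) z = 0" for z
  proof -
    have "poly (\<Prod>(e, E)\<leftarrow>Es. char_poly (group_alg_mat e E I c y)) z = 0"
      using z cpE[of I y c] y unfolding A_def by simp
    then obtain e E where E: "(e, E) \<in> set Es" "poly (char_poly (group_alg_mat e E I c y)) z = 0"
      by (force simp: poly_prod_list prod_list_zero_iff)
    have "irreducible_rep G X e E" using irrE E(1) by auto
    then have "group_alg_mat e E I c y = 0\<^sub>m e e"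
      unfolding group_alg_mat_def by (intro eq_matI) (auto simp: kill)
    then show ?thesis
      using nilpotent_root_0[of "0\<^sub>m e e" e 1 z] E(2) by simp
  qed
  have AT: "(A * T) $$ (i, j) = (\<Sum>s\<in>I. c s * (\<pi> (y s) * T) $$ (i, j))" if "i < m" "j < m" for i j
  proof -
    have "(A * T) $$ (i, j) = (\<Sum>l<m. \<Sum>s\<in>I. c s * (\<pi> (y s) $$ (i, l) * T $$ (l, j)))"
      using that by (simp add: mat_mult_index[OF A T] Aidx sum_distrib_left sum_distrib_right mult_ac)
    also have "\<dots> = (\<Sum>s\<in>I. c s * (\<Sum>l<m. \<pi> (y s) $$ (i, l) * T $$ (l, j)))"
      by (subst sum.swap) (simp add: sum_distrib_left)
    also have "\<dots> = (\<Sum>s\<in>I. c s * (\<pi> (y s) * T) $$ (i, j))"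
      using that R(1)[OF y] by (intro sum.cong refl) (simp add: mat_mult_index[of _ m m T m] T del: index_mult_mat(1))
    finally show ?thesis .
  qed
  have TA: "(T * A) $$ (i, j) = (\<Sum>s\<in>I. c s * (T * \<pi> (y s)) $$ (i, j))" if "i < m" "j < m" for i j
  proof -
    have "(T * A) $$ (i, j) = (\<Sum>l<m. \<Sum>s\<in>I. c s * (T $$ (i, l) * \<pi> (y s) $$ (l, j)))"
      using that by (simp add: mat_mult_index[OF T A] Aidx sum_distrib_left mult_ac)
    also have "\<dots> = (\<Sum>s\<in>I. c s * (\<Sum>l<m. T $$ (i, l) * \<pi> (y s) $$ (l, j)))"
      by (subst sum.swap) (simp add: sum_distrib_left)
    also have "\<dots> = (\<Sum>s\<in>I. c s * (T * \<pi> (y s)) $$ (i, j))"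
      using that R(1)[OF y] by (intro sum.cong refl) (simp add: mat_mult_index[of T m m _ m] T del: index_mult_mat(1))
    finally show ?thesis .
  qed
  have "A * T = T * A"
    using A T comm[OF y] by (intro eq_matI) (auto simp: AT TA simp del: index_mult_mat(1))
  then have "mat_trace (A * T) = 0" using root by (rule mat_trace_nilpotent_commute[OF A T])
  moreover have "mat_trace (A * T) = (\<Sum>s\<in>I. c s * f (y s))"
  proof -
    have "mat_trace (A * T) = (\<Sum>i<m. \<Sum>s\<in>I. c s * (\<pi> (y s) * T) $$ (i, i))"
      using A T by (simp add: mat_trace_def AT del: index_mult_mat(1))
    also have "\<dots> = (\<Sum>s\<in>I. c s * (\<Sum>i<m. (\<pi> (y s) * T) $$ (i, i)))"
      by (subst sum.swap) (simp add: sum_distrib_left)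
    also have "\<dots> = (\<Sum>s\<in>I. c s * f (y s))"
    proof (intro sum.cong refl)
      fix s assume s: "s \<in> I"
      show "c s * (\<Sum>i<m. (\<pi> (y s) * T) $$ (i, i)) = c s * f (y s)"
        unfolding tr[OF y[OF s]] mat_trace_def using R(1)[OF y[OF s]] by (simp del: index_mult_mat(1))
    qed
    finally show ?thesis .
  qed
  ultimately show ?thesis by simp
qed

text \<open>If no other ordering had the product of \<open>xs\<close>, a product of separating
  functions would vanish at every permutation except the identity. The alternating sum against it
  would reduce to one nonzero term, although it must be 0. The length is the least number exceeding
  e^2 for all e up to n.\<close>

lemma (in group) rewritable_if_bounded_dim:
  assumes top: "topspace X = carrier G"
    and bound: "\<And>e E. irreducible_rep G X e E \<Longrightarrow> e \<le> n"
    and sep: "\<And>g. g \<in> carrier G \<Longrightarrow> g \<noteq> \<one> \<Longrightarrow> \<exists>m \<pi>. irreducible_rep G X m \<pi> \<and> \<pi> g \<noteq> 1\<^sub>m m"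
    and xs: "length xs = Suc (n\<^sup>2)" "set xs \<subseteq> carrier G" "distinct xs"
  shows "\<exists>ys. mset ys = mset xs \<and> ys \<noteq> xs \<and> list_mult G ys = list_mult G xs"
proof (rule ccontr)
  assume neg: "\<not> ?thesis"
  define d where "d = Suc (n\<^sup>2)"
  define S where "S = {s. s permutes {..<d}}"
  have finS: "finite S" unfolding S_def by (rule finite_permutations) simp
  have idS: "id \<in> S" unfolding S_def by (simp add: permutes_id)
  \<comment> \<open>Multiplying by this inverse moves the product of \<open>xs\<close> to 1, the
    point from which the separation hypothesis distinguishes other elements. The standard identity
    survives, since E(h) factors out on the right.\<close>
  define h where "h = inv (list_mult G xs)"
  have h: "h \<in> carrier G" using xs unfolding h_def by simp
  define y where "y s = list_mult G (permute_list s xs)" for s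
  have yc: "y s \<in> carrier G" if "s \<in> S" for s
    using that xs unfolding y_def S_def d_def by simp
  define w where "w s = y s \<otimes> h" for s
  have wc: "w s \<in> carrier G" if "s \<in> S" for s using yc[OF that] h unfolding w_def by simp
  have w_id: "w id = \<one>" using xs unfolding w_def y_def h_def by simp
  have w_neq: "w s \<noteq> \<one>" if s: "s \<in> S" "s \<noteq> id" for s
  proof
    assume "w s = \<one>"
    then have "y s = list_mult G xs"
      using yc[OF s(1)] xs unfolding w_def h_def by (metis inv_closed inv_equality inv_inv list_mult_closed)
    moreover have "mset (permute_list s xs) = mset xs" using s xs unfolding S_def d_def by simp
    moreover have "permute_list s xs \<noteq> xs"
    proof
      assume eq: "permute_list s xs = xs"
      have perm: "s permutes {..<length xs}" using s xs unfolding S_def d_def by simp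
      have "s t = t" for t
      proof (cases "t < length xs")
        case True
        then have "s t < length xs" using permutes_in_image[OF perm, of t] by simp
        moreover have "xs ! s t = xs ! t" using permute_list_nth[OF perm True] eq by simp
        ultimately show ?thesis using True xs(3) by (simp add: nth_eq_iff_index_eq)
      next
        case False
        then show ?thesis using permutes_not_in[OF perm, of t] by simp
      qed
      then show False using s(2) by auto
    qed
    ultimately show False using neg unfolding y_def by blast
  qed
  have ann: "(\<Sum>s\<in>S. signof s * f (w s)) = 0" if f: "twisted_char G X f" for f
  proof (rule twisted_char_annihilated[OF top f wc])
    fix e E i j assume irr: "irreducible_rep G X e E" and ij: "i < e" "j < e"
    have rep: "cont_rep G X e E" using irr unfolding irreducible_rep_def by auto
    note R = cont_repD[OF rep]
    have "e\<^sup>2 < d" using bound[OF irr] unfolding d_def by (simp add: power_mono less_Suc_eq_le)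
    then have std: "(\<Sum>s\<in>S. signof s * E (y s) $$ (i, l)) = 0" if "l < e" for l
      using standard_identity[OF rep _ _ xs(2) ij(1) that, of d] xs(1) unfolding S_def y_def d_def by simp
    have "(\<Sum>s\<in>S. signof s * E (w s) $$ (i, j)) = (\<Sum>s\<in>S. \<Sum>l<e. signof s * E (y s) $$ (i, l) * E h $$ (l, j))"
    proof (intro sum.cong refl)
      fix s assume s: "s \<in> S"
      have "E (w s) $$ (i, j) = (\<Sum>l<e. E (y s) $$ (i, l) * E h $$ (l, j))"
        unfolding w_def R(2)[OF yc[OF s] h] by (rule mat_mult_index[OF R(1)[OF yc[OF s]] R(1)[OF h] ij])
      then show "signof s * E (w s) $$ (i, j) = (\<Sum>l<e. signof s * E (y s) $$ (i, l) * E h $$ (l, j))"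
        by (simp add: sum_distrib_left mult.assoc)
    qed
    also have "\<dots> = (\<Sum>l<e. (\<Sum>s\<in>S. signof s * E (y s) $$ (i, l)) * E h $$ (l, j))"
      by (subst sum.swap) (simp add: sum_distrib_right)
    also have "\<dots> = 0" using std by simp
    finally show "(\<Sum>s\<in>S. signof s * E (w s) $$ (i, j)) = 0" .
  qed
  have "\<exists>f. twisted_char G X f \<and> f \<one> \<noteq> f (w s)" if s: "s \<in> S - {id}" for s
  proof -
    obtain m \<pi> where \<pi>: "irreducible_rep G X m \<pi>" "\<pi> (w s) \<noteq> 1\<^sub>m m"
      using sep[OF wc w_neq] s by blast
    then have rep: "cont_rep G X m \<pi>" unfolding irreducible_rep_def by auto
    obtain k where k: "k \<ge> 1" "mat_trace (\<pi> (w s) ^\<^sub>m k) \<noteq> of_nat m"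
      using exists_mat_trace_pow_neq_dim[OF top _ \<pi>(1) wc \<pi>(2), of n] bound s by blast
    have "1\<^sub>m m ^\<^sub>m k = (1\<^sub>m m :: complex mat)" by (induction k) auto
    then have "mat_trace (\<pi> \<one> ^\<^sub>m k) = of_nat m"
      using cont_repD(3)[OF rep] by (simp add: mat_trace_def)
    then show ?thesis using twisted_char_mat_trace_pow[OF rep k(1)] k(2) by (intro exI[of _ "\<lambda>g. mat_trace (\<pi> g ^\<^sub>m k)"]) auto
  qed
  then obtain F where F: "\<And>s. s \<in> S - {id} \<Longrightarrow> twisted_char G X (F s)"
    "\<And>s. s \<in> S - {id} \<Longrightarrow> F s \<one> \<noteq> F s (w s)" by metis
  \<comment> \<open>Each new factor \<open>F b\<close> minus a constant splits the sum in two, and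
    \<open>F b\<close> is absorbed into \<open>f\<close> because twisted characters are closed under
    products. Hence \<open>f\<close> must stay general in the induction.\<close>
  have prod: "(\<Sum>s\<in>S. signof s * (f (w s) * (\<Prod>b\<in>B. F b (w s) - F b (w b)))) = 0"
    if "finite B" "B \<subseteq> S - {id}" "twisted_char G X f" for B f
    using that
  proof (induction B arbitrary: f rule: finite_induct)
    case empty
    then show ?case using ann by simp
  next
    case (insert b B)
    have "(\<Sum>s\<in>S. signof s * (f (w s) * (\<Prod>b\<in>insert b B. F b (w s) - F b (w b))))
      = (\<Sum>s\<in>S. signof s * ((f (w s) * F b (w s)) * (\<Prod>b\<in>B. F b (w s) - F b (w b))))
        - F b (w b) * (\<Sum>s\<in>S. signof s * (f (w s) * (\<Prod>b\<in>B. F b (w s) - F b (w b))))"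
      using insert.hyps by (simp add: algebra_simps sum_subtractf sum_distrib_left)
    moreover have "twisted_char G X (\<lambda>g. f g * F b g)"
      using twisted_char_mult[OF insert.prems(2) F(1)] insert.prems(1) by blast
    ultimately show ?case
      using insert.IH[of f] insert.IH[of "\<lambda>g. f g * F b g"] insert.prems by (simp del: id_apply)
  qed
  have "(\<Sum>s\<in>S. signof s * (1 * (\<Prod>b\<in>S - {id}. F b (w s) - F b (w b)))) = 0"
    using prod[of "S - {id}" "\<lambda>_. 1"] finS twisted_char_one by simp
  \<comment> \<open>For s other than \<open>id\<close> the factor with b = s is 0. At
    \<open>id\<close> the sign is 1 and \<open>w id\<close> is the unit.\<close>
  moreover have "(\<Sum>s\<in>S. signof s * (1 * (\<Prod>b\<in>S - {id}. F b (w s) - F b (w b))))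
    = (\<Sum>s\<in>S. if s = id then (\<Prod>b\<in>S - {id}. F b \<one> - F b (w b)) else 0)"
    using finS w_id by (intro sum.cong refl) (auto simp: prod_zero_iff)
  ultimately have "(\<Prod>b\<in>S - {id}. F b \<one> - F b (w b)) = 0" using finS idS by simp
  then show False using F(2) finS by (simp add: prod_zero_iff)
qed

theorem theorem1:
  fixes G :: "('a, 'b) monoid_scheme" and X :: "'a topology" and n :: nat
  assumes "linear_lie_group G X"
    and "n \<ge> 1"
    and "\<forall>m \<pi>. irreducible_rep G X m \<pi> \<longrightarrow> m \<le> n"
    and "\<forall>g\<in>carrier G. g \<noteq> \<one>\<^bsub>G\<^esub> \<longrightarrow>
           (\<exists>m \<pi>. irreducible_rep G X m \<pi> \<and> \<pi> g \<noteq> 1\<^sub>m m)"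
  shows "\<exists>A. A \<lhd> G \<and> closedin X A \<and>
           (\<forall>a\<in>A. \<forall>b\<in>A. a \<otimes>\<^bsub>G\<^esub> b = b \<otimes>\<^bsub>G\<^esub> a) \<and>
           finite (rcosets\<^bsub>G\<^esub> A)"
proof -
  have lie: "lie_group G X" using assms(1) unfolding linear_lie_group_def by blast
  interpret group G using lie unfolding lie_group_def by blast
  have top: "topspace X = carrier G" "Hausdorff_space X"
    "continuous_map (prod_topology X X) X (\<lambda>(x, y). x \<otimes>\<^bsub>G\<^esub> y)"
    using lie unfolding lie_group_def by blast+
  obtain m \<pi> where \<pi>: "cont_rep G X m \<pi>" "inj_on \<pi> (carrier G)"
    using assms(1) unfolding linear_lie_group_def by blast
  have "finite (rcosets\<^bsub>G\<^esub> (fc_centre G))"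
  proof (rule finite_index_fc_centre_if_rewritable)
    fix xs assume xs: "length xs = Suc (n\<^sup>2)" "set xs \<subseteq> carrier G" "distinct xs"
    show "\<exists>ys. mset ys = mset xs \<and> ys \<noteq> xs \<and> list_mult G ys = list_mult G xs"
      using rewritable_if_bounded_dim[OF top(1) _ _ xs] assms(3,4) by blast
  qed
  then show ?thesis by (rule virtually_abelian_if_finite_index_fc_centre[OF _ \<pi> top])
qed

end
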